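(* Let $p_0$ be an odd prime, $p$ a power of $p_0$, $q$ a power of $p$. Let $R(x) = \sum_{i=0}^e a_i x^{p^i} \in \mathbb{F}_q[x]$ with $e \geq 1$, $a_e \neq 0$, and let $A \subset H_R$ be a maximal abelian subgroup with $A \subset \mathbb{F}_q^2$. Let $k \geq 1$ be an integer prime to $p_0$. If Condition $(\ast)$ (for $R$ and $A$) fails, then the smooth projective compactification $\overline{C}_R$ over $\mathbb{F}_q$ of $y^p - y = xR(x)$ is neither $\mathbb{F}_{q^k}$-maximal nor $\mathbb{F}_{q^k}$-minimal.
   Context: $\mathbb{F}$ is an algebraic closure of $\mathbb{F}_{p_0}$; $\mathrm{Tr}_{q/p}$ denotes the trace $\mathbb{F}_q \to \mathbb{F}_p$. Define $E_R(x) = R(x)^{p^e} + \sum_{i=0}^e (a_i x)^{p^{e-i}}$, $V_R = \{x \in \mathbb{F} : E_R(x) = 0\}$, $f_R(x,y) = -\sum_{i=0}^{e-1}\left(\sum_{j=0}^{e-i-1}(a_i x^{p^i} y)^{p^j} + (xR(y))^{p^i}\right)$, and the Heisenberg group $H_R = \{(\alpha,\beta) \in \mathbb{F}^2 : \alpha \in V_R,\ \beta^p - \beta = \alpha R(\alpha)\}$ with law $(\alpha,\beta)(\alpha',\beta') = (\alpha+\alpha', \beta+\beta'+f_R(\alpha,\alpha'))$. For a maximal abelian subgroup $A$, let $\overline{A} \subset V_R$ be its image under $(\alpha,\beta) \mapsto \alpha$ (an $e$-dimensional $\mathbb{F}_p$-space, contained in $\mathbb{F}_q$ when $A \subset \mathbb{F}_q^2$).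 Let $F_A(x) = \prod_{\alpha \in \overline{A}}(x - \alpha) = \sum_{i=0}^e b_i x^{p^i}$ (monic, $\mathbb{F}_p$-linearized, $b_0 \neq 0$), let $c_A = (-1)^e a_e/(2b_0)$, and let $a(x) \in \mathbb{F}_q[x]$ be the unique $\mathbb{F}_p$-linearized polynomial with $F_A(a(x)) = x^q - x$; its root set $\mathrm{Ker}\, a \subset \mathbb{F}_q$. Condition $(\ast)$: for every $\lambda \in \mathbb{F}_q$ such that $\mathrm{Tr}_{q/p}(\lambda t) = 0$ for all $t \in \mathrm{Ker}\, a$, one has $\mathrm{Tr}_{q/p}(c_A^{-1}\lambda^2) = 0$. $\overline{C}_R$ has genus $g = p^e(p-1)/2$; for a power $Q$ of $q$ it is $\mathbb{F}_Q$-maximal (resp. minimal) if $|\overline{C}_R(\mathbb{F}_Q)| = Q+1+2gQ^{1/2}$ (resp. $Q+1-2gQ^{1/2}$). *)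

theory Defs
  imports Complex_Main "HOL-Algebra.Generated_Fields" "HOL-Algebra.Algebraic_Closure_Type"
begin

section \<open>Finite fields inside an algebraic closure\<close>

text \<open>The type \<open>'a\<close> plays the role of an algebraic closure \<open>F\<close> of the field with \<open>p\<^sub>0\<close>
  elements.  In characteristic \<open>p\<^sub>0\<close> the set \<open>\<int>\<close> is the prime field.\<close>

definition is_closure_of_prime_field :: "'a::alg_closed_field itself \<Rightarrow> nat \<Rightarrow> bool" where
  "is_closure_of_prime_field _ p0 \<longleftrightarrow> CHAR('a) = p0 \<and>
     (\<forall>x::'a. \<exists>f. f \<noteq> 0 \<and> (\<forall>i. coeff f i \<in> \<int>) \<and> poly f x = 0)"

definition Fq :: "nat \<Rightarrow> 'a::field set" where
  "Fq q = {x. x ^ q = x}"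

text \<open>The trace from the field with \<open>p ^ n\<close> elements to the one with \<open>p\<close> elements, as the sum of
  the Galois conjugates \<open>x, x ^ p, \<dots>, x ^ p ^ (n - 1)\<close>.\<close>

definition trace_Fq :: "nat \<Rightarrow> nat \<Rightarrow> 'a::field \<Rightarrow> 'a" where
  "trace_Fq p n x = (\<Sum>i<n. x ^ (p ^ i))"

definition linearized :: "nat \<Rightarrow> 'a::field poly \<Rightarrow> bool" where
  "linearized p f \<longleftrightarrow> (\<exists>m b. f = (\<Sum>i\<le>m. monom (b i) (p ^ i)))"


section \<open>The Heisenberg group\<close>

definition R_poly :: "nat \<Rightarrow> nat \<Rightarrow> (nat \<Rightarrow> 'a::field) \<Rightarrow> 'a poly" where
  "R_poly p e a = (\<Sum>i\<le>e. monom (a i) (p ^ i))"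

definition E_R :: "nat \<Rightarrow> nat \<Rightarrow> (nat \<Rightarrow> 'a::field) \<Rightarrow> 'a \<Rightarrow> 'a" where
  "E_R p e a x = poly (R_poly p e a) x ^ (p ^ e) + (\<Sum>i\<le>e. (a i * x) ^ (p ^ (e - i)))"

definition V_R :: "nat \<Rightarrow> nat \<Rightarrow> (nat \<Rightarrow> 'a::field) \<Rightarrow> 'a set" where
  "V_R p e a = {x. E_R p e a x = 0}"

definition f_R :: "nat \<Rightarrow> nat \<Rightarrow> (nat \<Rightarrow> 'a::field) \<Rightarrow> 'a \<Rightarrow> 'a \<Rightarrow> 'a" where
  "f_R p e a x y =
     - (\<Sum>i<e. (\<Sum>j<e - i. (a i * x ^ (p ^ i) * y) ^ (p ^ j))
               + (x * poly (R_poly p e a) y) ^ (p ^ i))"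

definition H_R :: "nat \<Rightarrow> nat \<Rightarrow> (nat \<Rightarrow> 'a::field) \<Rightarrow> ('a \<times> 'a) monoid" where
  "H_R p e a =
     \<lparr> carrier = {(\<alpha>, \<beta>). \<alpha> \<in> V_R p e a \<and> \<beta> ^ p - \<beta> = \<alpha> * poly (R_poly p e a) \<alpha>},
       monoid.mult = (\<lambda>(\<alpha>, \<beta>) (\<alpha>', \<beta>'). (\<alpha> + \<alpha>', \<beta> + \<beta>' + f_R p e a \<alpha> \<alpha>')),
       one = (0, 0) \<rparr>"

definition max_abelian_subgroup :: "'g set \<Rightarrow> 'g monoid \<Rightarrow> bool" where
  "max_abelian_subgroup A G \<longleftrightarrow>
     subgroup A G \<and> comm_group (G\<lparr>carrier := A\<rparr>) \<and>
     (\<forall>B. subgroup B G \<and> comm_group (G\<lparr>carrier := B\<rparr>) \<and> A \<subseteq> B \<longrightarrow> B = A)"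


section \<open>The trace condition\<close>

definition F_A :: "('a \<times> 'a) set \<Rightarrow> 'a::field poly" where
  "F_A A = (\<Prod>\<alpha>\<in>fst ` A. [:- \<alpha>, 1:])"

text \<open>\<open>b\<^sub>0\<close> is the coefficient of \<open>x ^ p ^ 0 = x\<close> in \<open>F_A\<close>.\<close>

definition c_A :: "nat \<Rightarrow> (nat \<Rightarrow> 'a::field) \<Rightarrow> ('a \<times> 'a) set \<Rightarrow> 'a" where
  "c_A e a A = (- 1) ^ e * a e / (2 * coeff (F_A A) 1)"

definition a_A :: "nat \<Rightarrow> nat \<Rightarrow> ('a \<times> 'a) set \<Rightarrow> 'a::field poly" where
  "a_A p q A = (THE f. linearized p f \<and> (\<forall>i. coeff f i \<in> Fq q) \<and>
                       pcompose (F_A A) f = monom 1 q - monom 1 1)"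

definition condition_star ::
  "nat \<Rightarrow> nat \<Rightarrow> nat \<Rightarrow> (nat \<Rightarrow> 'a::field) \<Rightarrow> ('a \<times> 'a) set \<Rightarrow> bool" where
  "condition_star p n e a A \<longleftrightarrow>
     (\<forall>l\<in>Fq (p ^ n).
        (\<forall>t. poly (a_A p (p ^ n) A) t = 0 \<longrightarrow> trace_Fq p n (l * t) = 0) \<longrightarrow>
        trace_Fq p n (inverse (c_A e a A) * l ^ 2) = 0)"


section \<open>Rational points of smooth projective curves\<close>

text \<open>A smooth projective curve is represented by its function field \<open>K\<close> over the constant field
  \<open>k\<close>: its closed points are the places of \<open>K\<close> over \<open>k\<close>, that is, the valuation rings \<open>V\<close> with
  \<open>k \<subset> V \<subset> K\<close>, and a closed point is \<open>k\<close>-rational iff its residue field is \<open>k\<close>.  Both fields are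
  subfields of an ambient field given by a type.\<close>

definition valuation_rings :: "'b::field set \<Rightarrow> 'b set \<Rightarrow> 'b set set" where
  "valuation_rings k K = {V. subring V ring_of_type_algebra \<and> k \<subset> V \<and> V \<subset> K \<and>
                             (\<forall>z\<in>K. z \<noteq> 0 \<longrightarrow> z \<in> V \<or> inverse z \<in> V)}"

definition place_ideal :: "'b::field set \<Rightarrow> 'b set" where
  "place_ideal V = {z \<in> V. z = 0 \<or> inverse z \<notin> V}"

definition rational_points :: "'b::field set \<Rightarrow> 'b set \<Rightarrow> 'b set set" where
  "rational_points k K =
     {V \<in> valuation_rings k K. \<forall>z\<in>V. \<exists>c\<in>k. z - c \<in> place_ideal V}"

text \<open>The ambient field of the curve \<open>y ^ p - y = x * R x\<close> is an algebraic closure of \<open>F(x)\<close>.\<close>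

definition of_poly :: "'a::field poly \<Rightarrow> 'a poly fract alg_closure" where
  "of_poly f = to_ac (to_fract f)"

definition constants :: "nat \<Rightarrow> 'a::field poly fract alg_closure set" where
  "constants Q = (\<lambda>c. of_poly [:c:]) ` Fq Q"

text \<open>The function field of the curve over the field with \<open>Q\<close> elements.  All solutions \<open>y\<close> of the
  equation are adjoined, which avoids a choice: they differ by elements of the field with \<open>p\<close>
  elements, so any one of them generates the same field.\<close>

definition function_field ::
  "nat \<Rightarrow> nat \<Rightarrow> (nat \<Rightarrow> 'a::field) \<Rightarrow> nat \<Rightarrow> 'a poly fract alg_closure set" where
  "function_field p e a Q =
     generate_field ring_of_type_algebra
       (constants Q \<union> {of_poly (monom 1 1)} \<union>
        {y. y ^ p - y = of_poly (monom 1 1 * R_poly p e a)})"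

text \<open>For \<open>Q\<close> a power of \<open>q\<close>, the field above is the constant field extension to \<open>Q\<close> elements of
  the function field over \<open>q\<close> elements, so the following set consists of the points over the field
  with \<open>Q\<close> elements of the smooth projective compactification over the one with \<open>q\<close> elements.\<close>

definition curve_points ::
  "nat \<Rightarrow> nat \<Rightarrow> (nat \<Rightarrow> 'a::field) \<Rightarrow> nat \<Rightarrow> 'a poly fract alg_closure set set" where
  "curve_points p e a Q = rational_points (constants Q) (function_field p e a Q)"

definition genus_C :: "nat \<Rightarrow> nat \<Rightarrow> nat" where
  "genus_C p e = p ^ e * (p - 1) div 2"

definition curve_maximal :: "nat \<Rightarrow> nat \<Rightarrow> (nat \<Rightarrow> 'a::field) \<Rightarrow> nat \<Rightarrow> bool" where
  "curve_maximal p e a Q \<longleftrightarrow>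
     real (card (curve_points p e a Q)) = real Q + 1 + 2 * real (genus_C p e) * sqrt (real Q)"

definition curve_minimal :: "nat \<Rightarrow> nat \<Rightarrow> (nat \<Rightarrow> 'a::field) \<Rightarrow> nat \<Rightarrow> bool" where
  "curve_minimal p e a Q \<longleftrightarrow>
     real (card (curve_points p e a Q)) = real Q + 1 - 2 * real (genus_C p e) * sqrt (real Q)"

end

(* Write w(x,y) = f_R(x,y) - f_R(y,x), which is a nondegenerate alternating F_p-form on V_R, and
   F_Q for the field with Q = q^k elements.

   1. The quadratic form Tr(x R(x)) on F_Q has polar form Tr(x^(p^e) E_R(y)), whose radical is the
   intersection W of V_R and F_Q.  Its second moment and the Cauchy-Schwarz inequality bound the
   deviation of the number of affine points from Q by (p - 1) sqrt(|W| Q).  If W is a proper subspace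
   of V_R, this is too small for a maximal or minimal curve even if the number of points at infinity
   is only known to be at most one.

   2. For x in V_R the element d = x^q - x is w-orthogonal to the image of A, hence lies in that image
   and so in F_q.  Thus x^(q^k) = x + k d, and V_R contained in F_Q implies V_R contained in F_q,
   because k is prime to p_0.

   3. One has E_R(x) = sum_j (g b_(e-j) F_A(x))^(p^j) with g = a_e / b_0.  If l is orthogonal to
   Ker a = F_A(F_q), then moving the Frobenius twists across the trace gives
   sum_j (b_(e-j) l)^(p^j) = 0, so the solutions z of g F_A(z) = l lie in V_R.  When V_R is contained
   in F_q, this yields 0 = Tr(l F_A(z)) = Tr(l^2 / g), which is the trace condition.

   The affine points of the smooth model are the local rings of the plane curve: x - c is a local
   parameter at (c,d).  At infinity the monomials x^j y^i with i < p have distinct pole orders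
   p j + (p^e + 1) i, so a place with a pole of x is determined by comparing leading monomials. *)
theory Submission
  imports Defs
begin

section \<open>Finite fields and \<open>p\<close>-polynomials\<close>

text \<open>The curve is given only by a function field inside an algebraic closure of
  \<open>F(x)\<close>, so the independence of \<open>1, y, ..., y ^ (p - 1)\<close> over the
  polynomials must be established before a function has a value at a point. Instead of
  irreducibility of the Artin-Schreier polynomial, a place with a pole of \<open>x\<close> on the
  whole closure is used: it exists by Chevalley extension, and no nonzero combination can cancel
  there. No value groups occur; statements about orders are statements about quotients lying in a
  valuation ring or in its maximal ideal. Character sums are avoided as well: fibres of the trace
  form are counted directly. The resulting estimate has room to spare. A proper subspace of
  \<open>V_R\<close> has at most half of its \<open>p ^ (2 * e)\<close> elements, so the deviation
  is at most \<open>2 g sqrt Q / sqrt 2\<close>, and \<open>2 g \<ge> 6\<close> makes the gap to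
  \<open>2 g sqrt Q\<close> larger than the one point in doubt. Since \<open>p\<close> may be a
  proper power of the characteristic, the image of \<open>A\<close> is at first only an additive
  group; its linearity over the field with \<open>p\<close> elements comes from maximality.\<close>

lemma card_roots_separable:
  fixes f :: "'a::alg_closed_field poly"
  assumes "\<And>x. poly f x = 0 \<Longrightarrow> poly (pderiv f) x \<noteq> 0"
  shows "card {x. poly f x = 0} = degree f"
proof -
  have f0: "f \<noteq> 0" using assms by fastforce
  obtain M where M: "size M = degree f" "f = smult (lead_coeff f) (\<Prod>x\<in>#M. [:- x, 1:])"
    using alg_closed_imp_factorization[OF f0] by auto
  have prod0: "poly (\<Prod>x\<in>#N. [:- x, 1:]) y = 0 \<longleftrightarrow> y \<in># N" for N :: "'a multiset" and y
    by (induction N) auto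
  have roots: "{x. poly f x = 0} = set_mset M"
    using f0 by (subst M(2)) (auto simp: prod0)
  have "count M x \<le> 1" for x
  proof (rule ccontr)
    assume "\<not> count M x \<le> 1"
    hence "{#x, x#} \<subseteq># M"
      by (auto simp: subseteq_mset_def)
    then obtain N where N: "M = {#x, x#} + N"
      by (metis mset_subset_eq_exists_conv)
    have "f = [:- x, 1:] * ([:- x, 1:] * smult (lead_coeff f) (\<Prod>x\<in>#N. [:- x, 1:]))"
      by (subst M(2), subst N) (simp add: mult.assoc)
    then obtain g where g: "f = [:- x, 1:] * ([:- x, 1:] * g)" by blast
    have "poly f x = 0" "poly (pderiv f) x = 0"
      by (simp_all add: g pderiv_mult del: mult_pCons_left)
    thus False using assms by blast
  qed
  hence "M = mset_set (set_mset M)"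
    by (intro multiset_eqI) (metis One_nat_def count_eq_zero_iff count_greater_zero_iff count_mset_set(1)
        count_mset_set(3) finite_set_mset le_antisym Suc_leI)
  hence "size M = card (set_mset M)"
    by (metis size_mset_set)
  thus ?thesis using M roots by simp
qed

text \<open>Additive polynomials as functions, so that composition and Frobenius twists become
  arithmetic with values. The bound \<open>m\<close> counts coefficients: degree
  \<open>p ^ e\<close> corresponds to \<open>m = Suc e\<close>.\<close>

definition lin :: "nat \<Rightarrow> (nat \<Rightarrow> 'a::field) \<Rightarrow> nat \<Rightarrow> 'a \<Rightarrow> 'a" where
  "lin p c m x = (\<Sum>i<m. c i * x ^ (p ^ i))"

text \<open>Here \<open>p\<close> is any positive power of the characteristic, so
  \<open>Fq p\<close> need not be the prime field, and additivity alone does not give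
  \<open>Fq p\<close>-linearity.\<close>

locale frobenius =
  fixes ty :: "'a::alg_closed_field itself" and p s :: nat
  assumes prime_char: "prime CHAR('a)" and s_pos: "s > 0" and p_eq: "p = CHAR('a) ^ s"
begin

lemma p_gt_1: "p > 1"
  using prime_char s_pos p_eq by (metis one_less_power prime_gt_1_nat)

lemma p_pos [simp]: "p > 0" using p_gt_1 by simp

lemma frob_add: "(x + y :: 'a) ^ (p ^ i) = x ^ (p ^ i) + y ^ (p ^ i)"
  by (rule freshmans_dream'[OF prime_char, where n = "s * i"]) (simp add: p_eq power_mult)

lemma frob_sum: "(sum f S :: 'a) ^ (p ^ i) = (\<Sum>x\<in>S. f x ^ (p ^ i))"
  by (rule freshmans_dream_sum'[OF prime_char, where n = "s * i"]) (simp add: p_eq power_mult)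

lemma frob_minus: "(- x :: 'a) ^ (p ^ i) = - (x ^ (p ^ i))"
  using frob_add[of x "- x" i] by (simp add: zero_power eq_neg_iff_add_eq_0 add.commute)

lemma frob_diff: "(x - y :: 'a) ^ (p ^ i) = x ^ (p ^ i) - y ^ (p ^ i)"
  using frob_add[of x "- y" i] by (simp add: frob_minus)

lemma frob_add1: "(x + y :: 'a) ^ p = x ^ p + y ^ p" using frob_add[of x y 1] by simp
lemma frob_diff1: "(x - y :: 'a) ^ p = x ^ p - y ^ p" using frob_diff[of x y 1] by simp
lemma frob_minus1: "(- x :: 'a) ^ p = - (x ^ p)" using frob_minus[of x 1] by simp
lemma frob_sum1: "(sum f S :: 'a) ^ p = (\<Sum>x\<in>S. f x ^ p)" using frob_sum[of f S 1] by simp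

lemma frob_inj: "(x :: 'a) ^ (p ^ i) = y ^ (p ^ i) \<longleftrightarrow> x = y"
  using frob_diff[of x y i] by (metis power_eq_0_iff right_minus_eq)

lemma frob_surj: "\<exists>y :: 'a. y ^ (p ^ i) = x"
  using nth_root_exists[of "p ^ i" x] by simp

lemma frob_of_int: "(of_int m :: 'a) ^ (p ^ i) = of_int m"
proof -
  have "(of_nat k :: 'a) ^ (p ^ i) = of_nat k" for k
    by (induction k) (auto simp: frob_add zero_power)
  thus ?thesis by (cases m) (auto simp: frob_minus frob_add simp flip: of_nat_Suc simp del: of_nat_Suc)
qed

lemma of_nat_p: "(of_nat p :: 'a) = 0"
  using p_eq s_pos by (simp add: of_nat_eq_0_iff_char_dvd dvd_power)

lemma Fq_add: "x \<in> Fq (p ^ n) \<Longrightarrow> y \<in> Fq (p ^ n) \<Longrightarrow> (x + y :: 'a) \<in> Fq (p ^ n)"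
  by (simp add: Fq_def frob_add)
lemma Fq_diff: "x \<in> Fq (p ^ n) \<Longrightarrow> y \<in> Fq (p ^ n) \<Longrightarrow> (x - y :: 'a) \<in> Fq (p ^ n)"
  by (simp add: Fq_def frob_diff)
lemma Fq_minus: "x \<in> Fq (p ^ n) \<Longrightarrow> (- x :: 'a) \<in> Fq (p ^ n)"
  by (simp add: Fq_def frob_minus)
lemma Fq_mult: "x \<in> Fq (p ^ n) \<Longrightarrow> y \<in> Fq (p ^ n) \<Longrightarrow> (x * y :: 'a) \<in> Fq (p ^ n)"
  by (simp add: Fq_def power_mult_distrib)
lemma Fq_inverse: "x \<in> Fq (p ^ n) \<Longrightarrow> (inverse x :: 'a) \<in> Fq (p ^ n)"
  by (simp add: Fq_def power_inverse)
lemma Fq_divide: "x \<in> Fq (p ^ n) \<Longrightarrow> y \<in> Fq (p ^ n) \<Longrightarrow> (x / y :: 'a) \<in> Fq (p ^ n)"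
  by (simp add: Fq_def power_divide)
lemma Fq_power: "x \<in> Fq (p ^ n) \<Longrightarrow> (x ^ k :: 'a) \<in> Fq (p ^ n)"
  by (simp add: Fq_def) (metis mult.commute power_mult)
lemma Fq_0: "(0 :: 'a) \<in> Fq (p ^ n)" by (simp add: Fq_def)
lemma Fq_1: "(1 :: 'a) \<in> Fq (p ^ n)" by (simp add: Fq_def)
lemma Fq_of_int: "(of_int m :: 'a) \<in> Fq (p ^ n)" by (simp add: Fq_def frob_of_int)
lemma Fq_sum: "(\<And>i. i \<in> S \<Longrightarrow> f i \<in> Fq (p ^ n)) \<Longrightarrow> (sum f S :: 'a) \<in> Fq (p ^ n)"
  by (induction S rule: infinite_finite_induct) (auto intro: Fq_add Fq_0)
lemmas Fq_closed = Fq_add Fq_diff Fq_minus Fq_mult Fq_inverse Fq_divide Fq_power Fq_0 Fq_1 Fq_of_int Fq_sum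

lemma Fq_mono: "n dvd m \<Longrightarrow> (Fq (p ^ n) :: 'a set) \<subseteq> Fq (p ^ m)"
proof
  fix x :: 'a assume "n dvd m" "x \<in> Fq (p ^ n)"
  then obtain k where k: "m = n * k" and x: "x ^ (p ^ n) = x" by (auto simp: Fq_def)
  have "x ^ ((p ^ n) ^ k) = x"
    by (induction k) (simp_all add: power_mult x)
  thus "x \<in> Fq (p ^ m)" by (simp add: Fq_def k power_mult)
qed

lemma Fp_sub: "(x :: 'a) \<in> Fq p \<Longrightarrow> x \<in> Fq (p ^ m)"
  using Fq_mono[of 1 m] by auto

lemma Fp_frob: "(x :: 'a) \<in> Fq p \<Longrightarrow> x ^ (p ^ m) = x"
  using Fp_sub[of x m] by (simp add: Fq_def)

lemma lin_add: "lin p c m (x + y) = lin p c m x + lin p c m (y :: 'a)"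
  by (simp add: lin_def frob_add algebra_simps sum.distrib)

lemma lin_minus: "lin p c m (- x) = - lin p c m (x :: 'a)"
  by (simp add: lin_def frob_minus sum_negf)

lemma lin_diff: "lin p c m (x - y) = lin p c m x - lin p c m (y :: 'a)"
  using lin_add[of c m x "- y"] by (simp add: lin_minus)

lemma lin_0 [simp]: "lin p c m (0 :: 'a) = 0"
  by (simp add: lin_def zero_power)

lemma lin_scale: "t \<in> Fq p \<Longrightarrow> lin p c m (t * x) = t * lin p c m (x :: 'a)"
  by (simp add: lin_def power_mult_distrib Fp_frob sum_distrib_left algebra_simps)

lemma lin_frob: "lin p c m (x :: 'a) ^ (p ^ j) = (\<Sum>i<m. c i ^ (p ^ j) * x ^ (p ^ (i + j)))"
  by (simp add: lin_def frob_sum power_mult_distrib power_add power_mult)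

section \<open>Additive polynomials: roots, surjectivity and right division\<close>

definition lin_poly :: "(nat \<Rightarrow> 'a) \<Rightarrow> nat \<Rightarrow> 'a poly" where
  "lin_poly c m = (\<Sum>i<m. monom (c i) (p ^ i))"

lemma poly_lin_poly: "poly (lin_poly c m) x = lin p c m x"
  by (simp add: lin_poly_def lin_def poly_sum poly_monom)

lemma p_power_eq_iff: "p ^ i = p ^ j \<longleftrightarrow> i = j"
  using p_gt_1 by (simp add: power_inject_exp)

lemma coeff_lin_poly: "coeff (lin_poly c m) (p ^ i) = (if i < m then c i else 0)"
  by (simp add: lin_poly_def coeff_sum coeff_monom p_power_eq_iff)

lemma degree_lin_poly_less: "m > 0 \<Longrightarrow> degree (lin_poly c m) < p ^ m"
  unfolding lin_poly_def
proof (rule degree_sum_less)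
  fix i assume "i \<in> {..<m}"
  hence "p ^ i < p ^ m" using p_gt_1 by simp
  thus "degree (monom (c i) (p ^ i)) < p ^ m"
    using degree_monom_le le_less_trans by blast
qed simp

lemma degree_lin_poly: "(c :: nat \<Rightarrow> 'a) m \<noteq> 0 \<Longrightarrow> degree (lin_poly c (Suc m)) = p ^ m"
proof (rule antisym)
  show "degree (lin_poly c (Suc m)) \<le> p ^ m"
    unfolding lin_poly_def
    using p_gt_1
    by (intro degree_sum_le) (auto intro!: order.trans[OF degree_monom_le] power_increasing)
  assume "c m \<noteq> 0"
  thus "p ^ m \<le> degree (lin_poly c (Suc m))"
    by (intro le_degree) (simp add: coeff_lin_poly)
qed

lemma pderiv_lin_poly: "pderiv (lin_poly c (Suc m)) = [:c 0:]"
proof -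
  have "pderiv (monom (c i) (p ^ i)) = (if i = 0 then [:c 0:] else 0)" for i
    using of_nat_p by (auto simp: pderiv_monom monom_0 of_nat_power)
  moreover have "pderiv (sum f S) = (\<Sum>i\<in>S. pderiv (f i))" for f :: "nat \<Rightarrow> 'a poly" and S
    by (induction S rule: infinite_finite_induct) (auto simp: pderiv_add)
  ultimately show ?thesis
    by (simp add: lin_poly_def sum.delta del: sum.lessThan_Suc)
qed

text \<open>The separable polynomial \<open>x ^ (p ^ N) - x\<close> with
  \<open>N = Suc (degree (g - h))\<close> has more roots than a nonzero \<open>g - h\<close> could
  have. Pointwise identities thereby become polynomial ones.\<close>

lemma poly_ext:
  fixes g h :: "'a poly"
  assumes "\<And>x. poly g x = poly h x"
  shows "g = h"
proof (rule ccontr)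
  assume "g \<noteq> h"
  hence nz: "g - h \<noteq> 0" by simp
  let ?c = "\<lambda>i. if i = 0 then - 1 else if i = Suc (degree (g - h)) then 1 else (0 :: 'a)"
  let ?f = "lin_poly ?c (Suc (Suc (degree (g - h))))"
  have "card {x. poly ?f x = 0} = degree ?f"
    by (rule card_roots_separable) (simp add: pderiv_lin_poly)
  also have "\<dots> = p ^ Suc (degree (g - h))" by (rule degree_lin_poly) simp
  also have "\<dots> > degree (g - h)"
    using power_gt_expt[of p "Suc (degree (g - h))"] p_gt_1 by simp
  finally have "degree (g - h) < card {x. poly ?f x = 0}" .
  also have "\<dots> \<le> card {x. poly (g - h) x = 0}"
    using poly_roots_finite[OF nz] assms by (intro card_mono) auto
  also have "\<dots> \<le> degree (g - h)" by (rule card_poly_roots_bound[OF nz])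
  finally show False by simp
qed

text \<open>The degree is below \<open>p ^ m\<close>. Coefficients are read off in this way from
  vanishing on \<open>Abar\<close>, on \<open>V\<close> or on a finite field. Infinite sets are a
  separate case because \<open>card\<close> is 0 on them.\<close>

lemma lin_zero:
  fixes c :: "nat \<Rightarrow> 'a"
  assumes "\<And>x. x \<in> S \<Longrightarrow> lin p c m x = 0" and "infinite S \<or> card S \<ge> p ^ m" and "i < m"
  shows "c i = 0"
proof -
  have "lin_poly c m = 0"
  proof (rule ccontr)
    assume nz: "lin_poly c m \<noteq> 0"
    have sub: "S \<subseteq> {x. poly (lin_poly c m) x = 0}" using assms(1) by (auto simp: poly_lin_poly)
    have "finite S" using sub poly_roots_finite[OF nz] finite_subset by blast
    moreover have "card S \<le> degree (lin_poly c m)"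
      using card_mono[OF poly_roots_finite[OF nz] sub] card_poly_roots_bound[OF nz] by simp
    ultimately show False using assms(2,3) degree_lin_poly_less[of m c] by linarith
  qed
  thus ?thesis using coeff_lin_poly[of c m i] assms(3) by simp
qed

text \<open>The derivative is the constant \<open>c 0\<close>, so all roots are simple.\<close>

lemma card_lin_roots:
  fixes c :: "nat \<Rightarrow> 'a"
  assumes "c 0 \<noteq> 0" "c m \<noteq> 0"
  shows "card {x. lin p c (Suc m) x = 0} = p ^ m"
proof -
  note pderiv_lin_poly[of c m]
  hence "card {x. poly (lin_poly c (Suc m)) x = 0} = degree (lin_poly c (Suc m))"
    using assms by (intro card_roots_separable) simp
  thus ?thesis using assms by (simp add: degree_lin_poly poly_lin_poly)
qed

lemma lin_surj:
  fixes c :: "nat \<Rightarrow> 'a"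
  assumes "c i \<noteq> 0" "i < m"
  shows "\<exists>x. lin p c m x = y"
proof -
  let ?f = "lin_poly c m - [:y:]"
  have "coeff ?f (p ^ i) \<noteq> 0" using assms p_pos
    by (auto simp: coeff_lin_poly coeff_pCons split: nat.split simp del: p_pos)
  hence "degree ?f > 0" using le_degree[of ?f "p ^ i"] p_pos
    by (metis bot_nat_0.extremum_uniqueI bot_nat_0.not_eq_extremum nat_power_eq_Suc_0_iff not_gr_zero p_pos power_not_zero)
  then obtain x where "poly ?f x = 0" using alg_closed_imp_poly_has_root by blast
  thus ?thesis by (auto simp: poly_lin_poly)
qed

lemma card_Fq: "n > 0 \<Longrightarrow> card (Fq (p ^ n) :: 'a set) = p ^ n"
proof -
  assume n: "n > 0"
  let ?c = "\<lambda>i. if i = 0 then - 1 else if i = n then 1 else (0 :: 'a)"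
  have "lin p ?c (Suc n) x = x ^ (p ^ n) - x" for x
  proof -
    have "lin p ?c (Suc n) x = (\<Sum>i\<in>{0, n}. ?c i * x ^ (p ^ i))"
      unfolding lin_def using n by (intro sum.mono_neutral_right) auto
    thus ?thesis using n by simp
  qed
  moreover have "card {x. lin p ?c (Suc n) x = 0} = p ^ n"
    by (rule card_lin_roots) (use n in auto)
  ultimately show ?thesis by (simp add: Fq_def)
qed

lemma finite_Fq: "n > 0 \<Longrightarrow> finite (Fq (p ^ n) :: 'a set)"
  using card_Fq[of n] p_pos by (metis card.infinite less_numeral_extra(3) zero_less_power)

lemma card_Fp: "card (Fq p :: 'a set) = p" using card_Fq[of 1] by simp
lemma finite_Fp: "finite (Fq p :: 'a set)" using finite_Fq[of 1] by simp

lemma lin_eqD: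
  fixes c d :: "nat \<Rightarrow> 'a"
  assumes "\<And>x. lin p c m x = lin p d m x" "i < m"
  shows "c i = d i"
proof -
  have "c i - d i = 0"
  proof (rule lin_zero[where c = "\<lambda>i. c i - d i" and S = "Fq (p ^ m)"])
    show "lin p (\<lambda>i. c i - d i) m x = 0" for x
      using assms(1)[of x] by (simp add: lin_def algebra_simps sum_subtractf)
    show "infinite (Fq (p ^ m)) \<or> p ^ m \<le> card (Fq (p ^ m) :: 'a set)"
      using assms(2) card_Fq[of m] by linarith
  qed (use assms(2) in auto)
  thus ?thesis by simp
qed

text \<open>Right division with respect to composition, by a monic additive polynomial. The set
  \<open>K\<close> tracks where the quotient has its coefficients; it is applied to the field with
  \<open>p ^ n\<close> elements and to \<open>UNIV\<close>.\<close>

lemma lin_right_div: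
  fixes b c :: "nat \<Rightarrow> 'a"
  assumes "b e = 1" and "\<And>i. i \<le> e \<Longrightarrow> b i \<in> K"
    and K: "\<And>u v w j. u \<in> K \<Longrightarrow> v \<in> K \<Longrightarrow> w \<in> K \<Longrightarrow> u - v * w ^ (p ^ j) \<in> K"
    and "\<And>i. i < e + d \<Longrightarrow> c i \<in> K"
  shows "\<exists>g r. (\<forall>i<d. g i \<in> K) \<and>
    (\<forall>x::'a. lin p c (e + d) x = lin p g d (lin p b (Suc e) x) + lin p r e x)"
  using assms(4)
proof (induction d arbitrary: c)
  case 0
  show ?case by (rule exI[of _ c], rule exI[of _ c]) (simp add: lin_def)
next
  case (Suc d)
  let ?t = "c (e + d)"
  \<comment> \<open>Subtracting \<open>?t\<close> times the \<open>p ^ d\<close>-th power of the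
    divisor cancels the coefficient at \<open>e + d\<close>, because \<open>b e = 1\<close>.\<close>
  define c' where "c' = (\<lambda>i. c i - (if i \<ge> d then ?t * b (i - d) ^ (p ^ d) else 0))"
  have c'k: "c' i \<in> K" if "i < e + d" for i
  proof (cases "d \<le> i")
    case True
    thus ?thesis unfolding c'_def using K that assms(2)[of "i - d"] Suc.prems by simp
  qed (use that Suc.prems in \<open>simp add: c'_def\<close>)
  obtain g r where g: "\<forall>i<d. g i \<in> K"
    "\<And>x. lin p c' (e + d) x = lin p g d (lin p b (Suc e) x) + lin p r e x"
    using Suc.IH[of c', OF c'k] by auto
  have eq: "lin p c (e + Suc d) x = lin p c' (e + d) x + ?t * lin p b (Suc e) x ^ (p ^ d)" for x
  proof -
    have A: "?t * lin p b (Suc e) x ^ (p ^ d) =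
        (\<Sum>i<e + Suc d. (if i \<ge> d then ?t * b (i - d) ^ (p ^ d) else 0) * x ^ (p ^ i))"
    proof -
      have "(\<Sum>i<e + Suc d. (if i \<ge> d then ?t * b (i - d) ^ (p ^ d) else 0) * x ^ (p ^ i)) =
        (\<Sum>i\<in>{d..<d + Suc e}. ?t * b (i - d) ^ (p ^ d) * x ^ (p ^ i))"
        by (rule sum.mono_neutral_cong_right) auto
      also have "\<dots> = (\<Sum>i<Suc e. ?t * b i ^ (p ^ d) * x ^ (p ^ (i + d)))"
        by (rule sum.reindex_bij_witness[of _ "\<lambda>i. i + d" "\<lambda>i. i - d"]) auto
      finally show ?thesis
        by (simp only: lin_frob sum_distrib_left mult.assoc)
    qed
    have "lin p c (e + Suc d) x - ?t * lin p b (Suc e) x ^ (p ^ d) = lin p c' (e + Suc d) x"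
      unfolding A by (simp only: lin_def c'_def sum_subtractf[symmetric] left_diff_distrib)
    also have "\<dots> = lin p c' (e + d) x"
      using assms(1) by (simp add: lin_def c'_def)
    finally show ?thesis by (simp add: algebra_simps)
  qed
  let ?g = "g(d := ?t)"
  have "lin p ?g (Suc d) y = lin p g d y + ?t * y ^ (p ^ d)" for y
    by (simp add: lin_def)
  hence "\<forall>x. lin p c (e + Suc d) x = lin p ?g (Suc d) (lin p b (Suc e) x) + lin p r e x"
    using eq g(2) by simp
  moreover have "\<forall>i<Suc d. ?g i \<in> K"
    using g(1) Suc.prems[of "e + d"] by (auto simp: less_Suc_eq)
  ultimately show ?case by blast
qed

section \<open>The trace and Artin-Schreier equations\<close>

lemma trace_add: "trace_Fq p m (x + y :: 'a) = trace_Fq p m x + trace_Fq p m y"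
  by (simp add: trace_Fq_def frob_add sum.distrib)

lemma trace_minus: "trace_Fq p m (- x :: 'a) = - trace_Fq p m x"
  by (simp add: trace_Fq_def frob_minus sum_negf)

lemma trace_diff: "trace_Fq p m (x - y :: 'a) = trace_Fq p m x - trace_Fq p m y"
  using trace_add[of m x "- y"] by (simp add: trace_minus)

lemma trace_0 [simp]: "trace_Fq p m (0 :: 'a) = 0"
  by (simp add: trace_Fq_def zero_power)

lemma trace_sum: "trace_Fq p m (sum f S :: 'a) = (\<Sum>i\<in>S. trace_Fq p m (f i))"
  by (induction S rule: infinite_finite_induct) (auto simp: trace_add)

lemma trace_scale: "t \<in> Fq p \<Longrightarrow> trace_Fq p m (t * x :: 'a) = t * trace_Fq p m x"
  by (simp add: trace_Fq_def power_mult_distrib Fp_frob sum_distrib_left)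

text \<open>The easy half of additive Hilbert 90: a solution of \<open>x ^ p - x = t\<close> lies in
  \<open>Fq (p ^ m)\<close> exactly when the trace of \<open>t\<close> is 0.\<close>

lemma trace_telescope: "trace_Fq p m ((x :: 'a) ^ p - x) = x ^ (p ^ m) - x"
proof -
  have "trace_Fq p m (x ^ p - x) = (\<Sum>i<m. x ^ (p ^ Suc i) - x ^ (p ^ i))"
    by (simp add: trace_Fq_def frob_diff power_mult)
  thus ?thesis using sum_lessThan_telescope[of "\<lambda>i. x ^ (p ^ i)" m] by simp
qed

lemma trace_frob1: "(x :: 'a) \<in> Fq (p ^ m) \<Longrightarrow> trace_Fq p m (x ^ p) = trace_Fq p m x"
  using trace_telescope[of m x] by (simp add: trace_diff Fq_def)

lemma trace_frob: "(x :: 'a) \<in> Fq (p ^ m) \<Longrightarrow> trace_Fq p m (x ^ (p ^ i)) = trace_Fq p m x"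
proof (induction i)
  case (Suc i)
  have "x ^ (p ^ Suc i) = (x ^ (p ^ i)) ^ p" by (metis mult.commute power_Suc power_mult)
  thus ?case using Suc trace_frob1[of "x ^ (p ^ i)" m] by (simp add: Fq_power del: power_Suc)
qed simp

lemma trace_in_Fp: "(x :: 'a) \<in> Fq (p ^ m) \<Longrightarrow> trace_Fq p m x \<in> Fq p"
proof -
  assume x: "x \<in> Fq (p ^ m)"
  have "trace_Fq p m x ^ p = trace_Fq p m (x ^ p)"
    by (simp add: trace_Fq_def frob_sum1 mult.commute flip: power_mult)
  thus ?thesis using trace_frob1[OF x] by (simp add: Fq_def)
qed

text \<open>The trace is an additive polynomial with \<open>m\<close> coefficients equal to 1, too
  few to vanish at \<open>p ^ m\<close> points.\<close>

lemma trace_nonzero: "m > 0 \<Longrightarrow> \<exists>x\<in>(Fq (p ^ m) :: 'a set). trace_Fq p m x \<noteq> 0"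
proof (rule ccontr)
  assume m: "m > 0" and "\<not> (\<exists>x\<in>(Fq (p ^ m) :: 'a set). trace_Fq p m x \<noteq> 0)"
  hence A: "\<And>x::'a. x \<in> Fq (p ^ m) \<Longrightarrow> lin p (\<lambda>_. 1) m x = 0"
    by (auto simp: trace_Fq_def lin_def)
  have "(1 :: 'a) = 0"
    by (rule lin_zero[where i = 0 and c = "\<lambda>_. 1", OF A]) (use m card_Fq[of m] in auto)
  thus False by simp
qed

lemma artin_schreier_root: "\<exists>y. y ^ p - y = (t :: 'a)"
proof -
  obtain y where y: "lin p (\<lambda>i. if i = 0 then - 1 else 1) 2 y = t"
    using lin_surj[of "\<lambda>i. if i = 0 then - 1 else 1" 0 2 t] by auto
  have "lin p (\<lambda>i. if i = 0 then - 1 else 1) 2 y = y ^ p - y"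
    by (simp add: lin_def numeral_2_eq_2)
  thus ?thesis using y by auto
qed

text \<open>A nonzero \<open>Fq p\<close>-linear form takes all values equally often: translation by
  a multiple of \<open>z\<close> carries one fibre to another.\<close>

lemma card_fibre:
  fixes \<phi> :: "'a \<Rightarrow> 'a" and S :: "'a set"
  assumes fin: "finite S" and add: "\<And>x y :: 'a. x \<in> S \<Longrightarrow> y \<in> S \<Longrightarrow> x + y \<in> S"
    and scale: "\<And>t x. t \<in> Fq p \<Longrightarrow> x \<in> S \<Longrightarrow> t * x \<in> S"
    and \<phi>: "\<And>x y. x \<in> S \<Longrightarrow> y \<in> S \<Longrightarrow> \<phi> (x + y) = \<phi> x + \<phi> y"
      "\<And>t x. t \<in> Fq p \<Longrightarrow> x \<in> S \<Longrightarrow> \<phi> (t * x) = t * \<phi> x" "\<And>x. x \<in> S \<Longrightarrow> \<phi> x \<in> Fq p"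
    and nz: "z \<in> S" "\<phi> z \<noteq> 0" and c: "c \<in> Fq p"
  shows "p * card {x\<in>S. \<phi> x = c} = card S"
proof -
  have F: "\<And>u v :: 'a. u \<in> Fq p \<Longrightarrow> v \<in> Fq p \<Longrightarrow> u - v \<in> Fq p"
          "\<And>u v :: 'a. u \<in> Fq p \<Longrightarrow> v \<in> Fq p \<Longrightarrow> u / v \<in> Fq p"
    using Fq_diff[where n = 1] Fq_divide[where n = 1] by auto
  have card_eq: "card {x\<in>S. \<phi> x = c'} = card {x\<in>S. \<phi> x = c}" if c': "c' \<in> Fq p" for c'
  proof (rule bij_betw_same_card)
    let ?u = "((c - c') / \<phi> z) * z" and ?v = "((c' - c) / \<phi> z) * z"
    have uv: "?u \<in> S" "?v \<in> S" "\<phi> ?u = c - c'" "\<phi> ?v = c' - c"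
      using scale[OF F(2)[OF F(1) \<phi>(3)]] \<phi>(2)[OF F(2)[OF F(1) \<phi>(3)]] nz c c' by auto
    have "?u + ?v = 0" by (simp add: diff_divide_distrib algebra_simps)
    hence uv0: "(x + ?u) + ?v = x" "(x + ?v) + ?u = x" for x
      by (metis add.assoc add.right_neutral add.commute)+
    show "bij_betw (\<lambda>x. x + ?u) {x\<in>S. \<phi> x = c'} {x\<in>S. \<phi> x = c}"
    proof (rule bij_betw_byWitness[where f' = "\<lambda>x. x + ?v"])
      show "(\<lambda>x. x + ?u) ` {x \<in> S. \<phi> x = c'} \<subseteq> {x \<in> S. \<phi> x = c}"
        using add[OF _ uv(1)] \<phi>(1)[OF _ uv(1)] uv(3) by auto
      show "(\<lambda>x. x + ?v) ` {x \<in> S. \<phi> x = c} \<subseteq> {x \<in> S. \<phi> x = c'}"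
        using add[OF _ uv(2)] \<phi>(1)[OF _ uv(2)] uv(4) by auto
    qed (use uv0 in blast)+
  qed
  have "card S = (\<Sum>c'\<in>Fq p. card {x\<in>S. \<phi> x = c'})"
  proof -
    have "S = (\<Union>c'\<in>Fq p. {x\<in>S. \<phi> x = c'})" using \<phi>(3) by auto
    thus ?thesis
      using fin finite_Fp by (subst \<open>S = _\<close>, subst card_UN_disjoint) auto
  qed
  also have "\<dots> = (\<Sum>c'\<in>(Fq p :: 'a set). card {x\<in>S. \<phi> x = c})"
    using card_eq by (intro sum.cong) auto
  finally show ?thesis by (simp add: card_Fp)
qed

end

section \<open>The pairing on the zeros of \<open>E_R\<close>\<close>

context frobenius
begin

text \<open>Records only a bound on the number of coefficients, so the degree of the pairing can be
  estimated without writing its coefficients out.\<close>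

definition lin_fun :: "nat \<Rightarrow> ('a \<Rightarrow> 'a) \<Rightarrow> bool" where
  "lin_fun m g \<longleftrightarrow> (\<exists>c. \<forall>x. g x = lin p c m x)"

lemma lin_fun_monom: "i < m \<Longrightarrow> lin_fun m (\<lambda>x. t * x ^ (p ^ i))"
proof -
  assume "i < m"
  hence "t * x ^ (p ^ i) = lin p (\<lambda>j. if j = i then t else 0) m x" for x
    by (simp add: lin_def if_distrib[of "\<lambda>u. u * _"] sum.delta cong: if_cong)
  thus ?thesis unfolding lin_fun_def by blast
qed

lemma lin_fun_add: "lin_fun m g \<Longrightarrow> lin_fun m h \<Longrightarrow> lin_fun m (\<lambda>x. g x + h x)"
proof -
  assume "lin_fun m g" "lin_fun m h"
  then obtain c d where "\<And>x. g x = lin p c m x" "\<And>x. h x = lin p d m x"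
    unfolding lin_fun_def by blast
  hence "g x + h x = lin p (\<lambda>i. c i + d i) m x" for x
    by (simp add: lin_def sum.distrib algebra_simps)
  thus ?thesis unfolding lin_fun_def by blast
qed

lemma lin_fun_minus: "lin_fun m g \<Longrightarrow> lin_fun m (\<lambda>x. - g x)"
proof -
  assume "lin_fun m g"
  then obtain c where "\<And>x. g x = lin p c m x" unfolding lin_fun_def by blast
  hence "- g x = lin p (\<lambda>i. - c i) m x" for x by (simp add: lin_def sum_negf)
  thus ?thesis unfolding lin_fun_def by blast
qed

lemma lin_fun_diff: "lin_fun m g \<Longrightarrow> lin_fun m h \<Longrightarrow> lin_fun m (\<lambda>x. g x - h x)"
  using lin_fun_add[OF _ lin_fun_minus, of m g h] by simp

lemma lin_fun_sum: "(\<And>i. i \<in> S \<Longrightarrow> lin_fun m (g i)) \<Longrightarrow> lin_fun m (\<lambda>x. \<Sum>i\<in>S. g i x)"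
proof (induction S rule: infinite_finite_induct)
  case (insert i S) thus ?case by (simp add: lin_fun_add)
qed (auto simp: lin_fun_def lin_def intro!: exI[of _ "\<lambda>_. 0"])

end

locale heisenberg = frobenius ty p s for ty :: "'a::alg_closed_field itself" and p s +
  fixes e n :: nat and a :: "nat \<Rightarrow> 'a"
  assumes odd_p: "odd p" and e_pos: "e > 0" and n_pos: "n > 0"
    and a_Fq: "\<And>i. i \<le> e \<Longrightarrow> a i \<in> Fq (p ^ n)" and ae_nz: "a e \<noteq> 0"
begin

abbreviation "R x \<equiv> poly (R_poly p e a) x"
abbreviation "E \<equiv> E_R p e a"
abbreviation "V \<equiv> V_R p e a"
abbreviation "f \<equiv> f_R p e a"
text \<open>The commutator pairing: two elements of \<open>H_R\<close> commute iff \<open>w\<close>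
  of their first components is 0.\<close>

definition "w x y = f x y - f y x"

lemma two_nz: "(2 :: 'a) \<noteq> 0"
proof
  assume "(2 :: 'a) = 0"
  hence "CHAR('a) dvd 2" using of_nat_eq_0_iff_char_dvd[where 'a = 'a, of 2] by simp
  hence "CHAR('a) = 2" using prime_char primes_dvd_imp_eq two_is_prime_nat by blast
  thus False using odd_p p_eq s_pos by simp
qed

lemma R_lin: "R x = lin p a (Suc e) x"
  by (simp add: R_poly_def poly_sum poly_monom lin_def lessThan_Suc_atMost)

lemma R_add: "R (x + y) = R x + R y" by (simp add: R_lin lin_add)
lemma R_diff: "R (x - y) = R x - R y" by (simp add: R_lin lin_diff)
lemma R_minus: "R (- x) = - R x" by (simp add: R_lin lin_minus)
lemma R_0 [simp]: "R 0 = 0" by (simp add: R_lin)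
lemma R_scale: "t \<in> Fq p \<Longrightarrow> R (t * x) = t * R x" by (simp add: R_lin lin_scale)
lemma R_Fq: "n dvd m \<Longrightarrow> x \<in> Fq (p ^ m) \<Longrightarrow> R x \<in> Fq (p ^ m)"
  unfolding R_lin lin_def using a_Fq Fq_mono[of n m] by (intro Fq_closed) auto

text \<open>The twisted sum fills the indices up to \<open>e\<close> and
  \<open>R x ^ (p ^ e)\<close> those from \<open>e\<close> to \<open>2 * e\<close>; at
  \<open>j = e\<close> both contribute.\<close>

definition E_coeff :: "nat \<Rightarrow> 'a" where
  "E_coeff j = (if j \<le> e then a (e - j) ^ (p ^ j) else 0) + (if e \<le> j then a (j - e) ^ (p ^ e) else 0)"

lemma E_lin: "E x = lin p E_coeff (Suc (2 * e)) x"
proof -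
  have A: "R x ^ (p ^ e) = (\<Sum>j<Suc (2 * e). (if e \<le> j then a (j - e) ^ (p ^ e) else 0) * x ^ (p ^ j))"
  proof -
    have "R x ^ (p ^ e) = (\<Sum>i<Suc e. a i ^ (p ^ e) * x ^ (p ^ (i + e)))"
      by (simp only: R_lin lin_frob)
    also have "\<dots> = (\<Sum>j\<in>{e..<e + Suc e}. a (j - e) ^ (p ^ e) * x ^ (p ^ j))"
      by (rule sum.reindex_bij_witness[of _ "\<lambda>i. i - e" "\<lambda>i. i + e"]) auto
    also have "\<dots> = (\<Sum>j<Suc (2 * e). (if e \<le> j then a (j - e) ^ (p ^ e) else 0) * x ^ (p ^ j))"
      by (rule sum.mono_neutral_cong_left) auto
    finally show ?thesis .
  qed
  have B: "(\<Sum>i\<le>e. (a i * x) ^ (p ^ (e - i))) =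
     (\<Sum>j<Suc (2 * e). (if j \<le> e then a (e - j) ^ (p ^ j) else 0) * x ^ (p ^ j))"
  proof -
    have "(\<Sum>i\<le>e. (a i * x) ^ (p ^ (e - i))) = (\<Sum>j\<le>e. a (e - j) ^ (p ^ j) * x ^ (p ^ j))"
      by (rule sum.reindex_bij_witness[of _ "\<lambda>i. e - i" "\<lambda>i. e - i"]) (auto simp: power_mult_distrib)
    also have "\<dots> = (\<Sum>j<Suc (2 * e). (if j \<le> e then a (e - j) ^ (p ^ j) else 0) * x ^ (p ^ j))"
      by (rule sum.mono_neutral_cong_left) auto
    finally show ?thesis .
  qed
  show ?thesis
    by (simp only: E_R_def A B lin_def E_coeff_def sum.distrib[symmetric] distrib_right add.commute)
qed

lemma E_add: "E (x + y) = E x + E y" by (simp add: E_lin lin_add)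
lemma E_scale: "t \<in> Fq p \<Longrightarrow> E (t * x) = t * E x" by (simp add: E_lin lin_scale)
lemma E_0 [simp]: "E 0 = 0" by (simp add: E_lin)

lemma E_coeff_0: "E_coeff 0 = a e" using e_pos by (simp add: E_coeff_def)

text \<open>The lowest and highest coefficients of \<open>E\<close> are \<open>a e\<close> and
  \<open>a e ^ (p ^ e)\<close>, so \<open>E\<close> is separable of degree
  \<open>p ^ (2 * e)\<close>.\<close>

lemma card_V: "card V = p ^ (2 * e)"
  unfolding V_R_def E_lin
  by (rule card_lin_roots) (use e_pos ae_nz in \<open>auto simp: E_coeff_0, auto simp: E_coeff_def\<close>)

lemma finite_V: "finite V"
  using card_V p_pos by (metis card.infinite less_numeral_extra(3) zero_less_power)

lemma V_add: "x \<in> V \<Longrightarrow> y \<in> V \<Longrightarrow> x + y \<in> V" by (simp add: V_R_def E_add)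
lemma V_scale: "t \<in> Fq p \<Longrightarrow> x \<in> V \<Longrightarrow> t * x \<in> V" by (simp add: V_R_def E_scale)
lemma V_0: "0 \<in> V" by (simp add: V_R_def)
lemma V_minus: "x \<in> V \<Longrightarrow> - x \<in> V" using V_scale[of "- 1" x] Fq_minus[OF Fq_1, of 1] by simp
lemma V_diff: "x \<in> V \<Longrightarrow> y \<in> V \<Longrightarrow> x - y \<in> V" using V_add[of x "- y"] V_minus by simp

lemma f_add_left: "f (x + x') y = f x y + f x' y"
  by (simp add: f_R_def frob_add algebra_simps sum.distrib)
lemma f_add_right: "f x (y + y') = f x y + f x y'"
  by (simp add: f_R_def R_add frob_add algebra_simps sum.distrib)
lemma f_scale_left: "t \<in> Fq p \<Longrightarrow> f (t * x) y = t * f x y"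
  by (simp add: f_R_def power_mult_distrib Fp_frob sum_distrib_left algebra_simps sum.distrib)
lemma f_scale_right: "t \<in> Fq p \<Longrightarrow> f x (t * y) = t * f x y"
  by (simp add: f_R_def R_scale power_mult_distrib Fp_frob sum_distrib_left algebra_simps sum.distrib)
lemma f_0_left [simp]: "f 0 y = 0" by (simp add: f_R_def zero_power)
lemma f_0_right [simp]: "f x 0 = 0" by (simp add: f_R_def zero_power)
lemma f_minus_left: "f (- x) y = - f x y" using f_add_left[of x "- x" y] by (simp add: eq_neg_iff_add_eq_0 add.commute)
lemma f_minus_right: "f x (- y) = - f x y" using f_add_right[of x y "- y"] by (simp add: eq_neg_iff_add_eq_0 add.commute)

text \<open>Both parts of the sum defining \<open>f_R\<close> telescope under
  \<open>z ^ p - z\<close>. What remains is the polar form of \<open>x * R x\<close> minus a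
  multiple of \<open>E y\<close>; for \<open>y\<close> in \<open>V\<close> this is the identity that
  keeps the group law inside \<open>H_R\<close>.\<close>

lemma f_telescope: "f x y ^ p - f x y = x * R y + y * R x - x ^ (p ^ e) * E y"
proof -
  have pw: "(z ^ (p ^ i)) ^ p = z ^ (p ^ Suc i)" for z :: 'a and i
    by (metis mult.commute power_Suc power_mult)
  have "f x y ^ p - f x y = - (\<Sum>i<e. (\<Sum>j<e - i. (a i * x ^ (p ^ i) * y) ^ (p ^ Suc j) - (a i * x ^ (p ^ i) * y) ^ (p ^ j))
      + ((x * R y) ^ (p ^ Suc i) - (x * R y) ^ (p ^ i)))"
    unfolding f_R_def frob_minus1 frob_sum1 frob_add1 pw sum_subtractf sum.distrib by simp
  also have "\<dots> = - ((\<Sum>i<e. (a i * x ^ (p ^ i) * y) ^ (p ^ (e - i)) - a i * x ^ (p ^ i) * y)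
      + ((x * R y) ^ (p ^ e) - x * R y))"
  proof -
    have "(\<Sum>j<k. z ^ (p ^ Suc j) - z ^ (p ^ j)) = z ^ (p ^ k) - z" for z :: 'a and k
      using sum_lessThan_telescope[of "\<lambda>i. z ^ (p ^ i)" k] by simp
    thus ?thesis by (simp only: sum.distrib)
  qed
  \<comment> \<open>The exponents \<open>i\<close> and \<open>e - i\<close> add up to
    \<open>e\<close>, so \<open>x ^ (p ^ e)\<close> can be taken out and the summands of
    \<open>E y\<close> with index below \<open>e\<close> appear.\<close>
  also have "(\<Sum>i<e. (a i * x ^ (p ^ i) * y) ^ (p ^ (e - i)) - a i * x ^ (p ^ i) * y) =
     x ^ (p ^ e) * (\<Sum>i<e. (a i * y) ^ (p ^ (e - i))) - y * (\<Sum>i<e. a i * x ^ (p ^ i))"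
  proof -
    have "(a i * x ^ (p ^ i) * y) ^ (p ^ (e - i)) = x ^ (p ^ e) * (a i * y) ^ (p ^ (e - i))" if "i < e" for i
    proof -
      have "(x ^ (p ^ i)) ^ (p ^ (e - i)) = x ^ (p ^ e)"
        using that by (simp flip: power_mult power_add)
      thus ?thesis by (simp add: power_mult_distrib)
    qed
    hence "(\<Sum>i<e. (a i * x ^ (p ^ i) * y) ^ (p ^ (e - i))) = (\<Sum>i<e. x ^ (p ^ e) * (a i * y) ^ (p ^ (e - i)))"
      by (intro sum.cong) auto
    thus ?thesis by (simp only: sum_subtractf sum_distrib_left) (simp add: mult.commute)
  qed
  also have "(\<Sum>i<e. (a i * y) ^ (p ^ (e - i))) = E y - R y ^ (p ^ e) - a e * y"
    by (simp add: E_R_def lessThan_Suc_atMost[symmetric])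
  also have "(\<Sum>i<e. a i * x ^ (p ^ i)) = R x - a e * x ^ (p ^ e)"
    by (simp add: R_lin lin_def)
  finally show ?thesis by (simp add: power_mult_distrib algebra_simps)
qed

lemma f_telescope_V: "y \<in> V \<Longrightarrow> f x y ^ p - f x y = x * R y + y * R x"
  using f_telescope[of x y] by (simp add: V_R_def)

lemma f_Fq: "n dvd m \<Longrightarrow> x \<in> Fq (p ^ m) \<Longrightarrow> y \<in> Fq (p ^ m) \<Longrightarrow> f x y \<in> Fq (p ^ m)"
  unfolding f_R_def using a_Fq Fq_mono[of n m] R_Fq[of m y] by (intro Fq_closed) auto

lemma R_q: "R (x ^ (p ^ n)) = R x ^ (p ^ n)"
proof -
  have "a i ^ (p ^ n) = a i" if "i < Suc e" for i using a_Fq[of i] that by (simp add: Fq_def)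
  thus ?thesis by (simp add: R_lin lin_frob) (simp add: lin_def mult.commute flip: power_mult power_add)
qed

lemma E_q: "E (x ^ (p ^ n)) = E x ^ (p ^ n)"
proof -
  have a: "a i ^ (p ^ n) = a i" if "i \<le> e" for i using a_Fq[of i] that by (simp add: Fq_def)
  have c: "(z ^ (p ^ k)) ^ (p ^ n) = (z ^ (p ^ n)) ^ (p ^ k)" for z :: 'a and k by (metis mult.commute power_mult)
  show ?thesis
    unfolding E_R_def R_q frob_add frob_sum
    by (intro arg_cong2[of _ _ _ _ "(+)"] sum.cong) (auto simp: c power_mult_distrib a)
qed

lemma f_q: "f (x ^ (p ^ n)) (y ^ (p ^ n)) = f x y ^ (p ^ n)"
proof -
  have a: "a i ^ (p ^ n) = a i" if "i \<le> e" for i using a_Fq[of i] that by (simp add: Fq_def)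
  have c: "(z ^ (p ^ k)) ^ (p ^ n) = (z ^ (p ^ n)) ^ (p ^ k)" for z :: 'a and k by (metis mult.commute power_mult)
  show ?thesis
    unfolding f_R_def R_q frob_add frob_sum frob_minus
    by (intro arg_cong[of _ _ uminus] arg_cong2[of _ _ _ _ "(+)"] sum.cong)
       (auto simp: c power_mult_distrib a)
qed

lemma w_add_left: "w (x + x') y = w x y + w x' y" by (simp add: w_def f_add_left f_add_right)
lemma w_add_right: "w x (y + y') = w x y + w x y'" by (simp add: w_def f_add_left f_add_right)
lemma w_scale_left: "t \<in> Fq p \<Longrightarrow> w (t * x) y = t * w x y"
  by (simp add: w_def f_scale_left f_scale_right algebra_simps)
lemma w_scale_right: "t \<in> Fq p \<Longrightarrow> w x (t * y) = t * w x y"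
  by (simp add: w_def f_scale_left f_scale_right algebra_simps)
lemma w_self [simp]: "w x x = 0" by (simp add: w_def)
lemma w_commute: "w x y = - w y x" by (simp add: w_def)
lemma w_0_right [simp]: "w x 0 = 0" by (simp add: w_def)
lemma w_minus_left: "w (- x) y = - w x y" by (simp add: w_def f_minus_left f_minus_right)
text \<open>With \<open>x\<close> in \<open>V\<close> this puts \<open>w x y\<close> into
  \<open>Fq p\<close>. With \<open>x\<close> arbitrary it is an identity of additive polynomials in
  \<open>x\<close>, whose coefficients are compared when \<open>E\<close> is factored.\<close>

lemma w_telescope: "y \<in> V \<Longrightarrow> w x y ^ p - w x y = y ^ (p ^ e) * E x"
  using f_telescope[of y x] f_telescope_V[of y x] by (simp add: w_def frob_diff1 algebra_simps)

lemma w_in_Fp: "x \<in> V \<Longrightarrow> y \<in> V \<Longrightarrow> w x y \<in> Fq p"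
  using w_telescope[of y x] by (simp add: V_R_def Fq_def)

text \<open>Only the summand \<open>i = e - 1\<close> of \<open>f y x\<close> reaches the exponent
  \<open>p ^ (2 * e - 1)\<close>, through the top term of \<open>R x\<close>.\<close>

lemma w_leading: "\<exists>c. \<forall>x. w x y = lin p c (2 * e - 1) x + (y * a e) ^ (p ^ (e - 1)) * x ^ (p ^ (2 * e - 1))"
proof -
  let ?m = "2 * e - 1"
  have 1: "lin_fun ?m (\<lambda>x. f x y)"
  proof -
    have "lin_fun ?m (\<lambda>x. - (\<Sum>i<e. (\<Sum>j<e - i. (a i * y) ^ (p ^ j) * x ^ (p ^ (i + j))) + R y ^ (p ^ i) * x ^ (p ^ i)))"
      by (intro lin_fun_minus lin_fun_sum lin_fun_add lin_fun_monom) auto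
    also have "(\<lambda>x. - (\<Sum>i<e. (\<Sum>j<e - i. (a i * y) ^ (p ^ j) * x ^ (p ^ (i + j))) + R y ^ (p ^ i) * x ^ (p ^ i))) = (\<lambda>x. f x y)"
      by (simp add: f_R_def fun_eq_iff power_mult_distrib power_add power_mult algebra_simps)
    finally show ?thesis .
  qed
  have 2: "lin_fun ?m (\<lambda>x. f y x + (y * a e) ^ (p ^ (e - 1)) * x ^ (p ^ (2 * e - 1)))"
  proof -
    have R: "(y * R x) ^ (p ^ i) = (\<Sum>l<e. (y * a l) ^ (p ^ i) * x ^ (p ^ (l + i))) + (y * a e) ^ (p ^ i) * x ^ (p ^ (e + i))" for x i
      by (simp add: power_mult_distrib R_lin lin_frob sum_distrib_left algebra_simps del: sum.lessThan_Suc)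
         (simp add: algebra_simps)
    have "f y x + (y * a e) ^ (p ^ (e - 1)) * x ^ (p ^ (2 * e - 1)) =
      - ((\<Sum>i<e. (\<Sum>j<e - i. (a i * y ^ (p ^ i)) ^ (p ^ j) * x ^ (p ^ j)))
        + (\<Sum>i<e. (\<Sum>l<e. (y * a l) ^ (p ^ i) * x ^ (p ^ (l + i)))) + (\<Sum>i<e - 1. (y * a e) ^ (p ^ i) * x ^ (p ^ (e + i))))" for x
    proof -
      have "(\<Sum>i<e. (y * a e) ^ (p ^ i) * x ^ (p ^ (e + i))) =
        (\<Sum>i<e - 1. (y * a e) ^ (p ^ i) * x ^ (p ^ (e + i))) + (y * a e) ^ (p ^ (e - 1)) * x ^ (p ^ (2 * e - 1))"
        using e_pos by (cases e) (auto simp: mult_2)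
      thus ?thesis
        unfolding f_R_def R by (simp add: sum.distrib power_mult_distrib algebra_simps)
    qed
    moreover have "lin_fun ?m (\<lambda>x. - ((\<Sum>i<e. (\<Sum>j<e - i. (a i * y ^ (p ^ i)) ^ (p ^ j) * x ^ (p ^ j)))
        + (\<Sum>i<e. (\<Sum>l<e. (y * a l) ^ (p ^ i) * x ^ (p ^ (l + i)))) + (\<Sum>i<e - 1. (y * a e) ^ (p ^ i) * x ^ (p ^ (e + i)))))"
      by (intro lin_fun_minus lin_fun_sum lin_fun_add lin_fun_monom) auto
    ultimately show ?thesis by simp
  qed
  from lin_fun_diff[OF 1 2] show ?thesis
    unfolding lin_fun_def by (simp add: w_def algebra_simps)
qed

lemma w_lin: "\<exists>c. \<forall>x. w x y = lin p c (2 * e) x"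
proof -
  obtain c where c: "\<And>x. w x y = lin p c (2 * e - 1) x + (y * a e) ^ (p ^ (e - 1)) * x ^ (p ^ (2 * e - 1))"
    using w_leading by blast
  have "w x y = lin p (c(2 * e - 1 := (y * a e) ^ (p ^ (e - 1)))) (Suc (2 * e - 1)) x" for x
    by (simp add: c lin_def)
  thus ?thesis using e_pos by auto
qed

text \<open>In \<open>x\<close> the pairing has degree below \<open>p ^ (2 * e) = card V\<close>, so
  vanishing on \<open>V\<close> kills its top coefficient, a power of
  \<open>y * a e\<close>.\<close>

lemma w_nondegenerate:
  assumes "\<And>x. x \<in> V \<Longrightarrow> w x y = 0"
  shows "y = 0"
proof -
  obtain c where c: "\<And>x. w x y = lin p c (2 * e - 1) x + (y * a e) ^ (p ^ (e - 1)) * x ^ (p ^ (2 * e - 1))"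
    using w_leading by blast
  let ?c = "c(2 * e - 1 := (y * a e) ^ (p ^ (e - 1)))"
  have "w x y = lin p ?c (Suc (2 * e - 1)) x" for x
    by (simp add: c lin_def)
  hence "\<And>x. x \<in> V \<Longrightarrow> lin p ?c (Suc (2 * e - 1)) x = 0" using assms by simp
  from lin_zero[where c = ?c and i = "2 * e - 1", OF this] show ?thesis
    using card_V e_pos ae_nz by auto
qed

end

section \<open>Maximal abelian subgroups\<close>

context heisenberg
begin

abbreviation "H \<equiv> H_R p e a"

lemma carrier_H: "(\<alpha>, \<beta>) \<in> carrier H \<longleftrightarrow> \<alpha> \<in> V \<and> \<beta> ^ p - \<beta> = \<alpha> * R \<alpha>"
  by (simp add: H_R_def)

lemma mult_H [simp]: "(\<alpha>, \<beta>) \<otimes>\<^bsub>H\<^esub> (\<alpha>', \<beta>') = (\<alpha> + \<alpha>', \<beta> + \<beta>' + f \<alpha> \<alpha>')"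
  by (simp add: H_R_def)

lemma one_H [simp]: "\<one>\<^bsub>H\<^esub> = (0, 0)"
  by (simp add: H_R_def)

lemma mult_closed_H:
  "(\<alpha>, \<beta>) \<in> carrier H \<Longrightarrow> (\<alpha>', \<beta>') \<in> carrier H \<Longrightarrow> (\<alpha> + \<alpha>', \<beta> + \<beta>' + f \<alpha> \<alpha>') \<in> carrier H"
  using f_telescope_V[of \<alpha>' \<alpha>]
  by (auto simp: carrier_H V_add frob_add1 R_add algebra_simps)

lemma inv_closed_H: "(\<alpha>, \<beta>) \<in> carrier H \<Longrightarrow> (- \<alpha>, - \<beta> + f \<alpha> \<alpha>) \<in> carrier H"
  using f_telescope_V[of \<alpha> \<alpha>]
  by (auto simp: carrier_H V_minus frob_add1 frob_minus1 frob_diff1 R_minus algebra_simps)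

lemma group_H: "group H"
proof (rule groupI)
  fix x y z
  show "x \<in> carrier H \<Longrightarrow> y \<in> carrier H \<Longrightarrow> x \<otimes>\<^bsub>H\<^esub> y \<in> carrier H"
    by (cases x; cases y) (simp add: mult_closed_H)
  show "x \<otimes>\<^bsub>H\<^esub> y \<otimes>\<^bsub>H\<^esub> z = x \<otimes>\<^bsub>H\<^esub> (y \<otimes>\<^bsub>H\<^esub> z)"
    by (cases x; cases y; cases z) (simp add: f_add_left f_add_right algebra_simps)
  show "\<one>\<^bsub>H\<^esub> \<otimes>\<^bsub>H\<^esub> x = x"
    by (cases x) simp
  show "\<exists>y\<in>carrier H. y \<otimes>\<^bsub>H\<^esub> x = \<one>\<^bsub>H\<^esub>" if "x \<in> carrier H"
    using that by (cases x) (auto intro!: bexI[OF _ inv_closed_H] simp: f_minus_left)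
qed (simp add: carrier_H V_0)

lemma inv_H: "(\<alpha>, \<beta>) \<in> carrier H \<Longrightarrow> inv\<^bsub>H\<^esub> (\<alpha>, \<beta>) = (- \<alpha>, - \<beta> + f \<alpha> \<alpha>)"
  by (rule group.inv_equality[OF group_H]) (use inv_closed_H in \<open>auto simp: f_minus_left\<close>)

end

locale max_abelian = heisenberg ty p s e n a for ty :: "'a::alg_closed_field itself" and p s e n a +
  fixes A :: "('a \<times> 'a) set"
  assumes max_abelian: "max_abelian_subgroup A (H_R p e a)"
    and A_Fq: "A \<subseteq> Fq (p ^ n) \<times> Fq (p ^ n)"
begin

definition "Abar = fst ` A"

lemma sub_A: "subgroup A H" and comm_A: "comm_group (H\<lparr>carrier := A\<rparr>)"
  and max_A: "subgroup B H \<Longrightarrow> comm_group (H\<lparr>carrier := B\<rparr>) \<Longrightarrow> A \<subseteq> B \<Longrightarrow> B = A"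
  using max_abelian by (auto simp: max_abelian_subgroup_def)

lemma Abar_sub_V: "Abar \<subseteq> V"
  using subgroup.subset[OF sub_A] by (auto simp: Abar_def carrier_H)

lemma Abar_sub_Fq: "Abar \<subseteq> Fq (p ^ n)"
  using A_Fq by (auto simp: Abar_def)

lemma Abar_0: "0 \<in> Abar"
  using subgroup.one_closed[OF sub_A] by (force simp: Abar_def)

lemma Abar_add: "x \<in> Abar \<Longrightarrow> y \<in> Abar \<Longrightarrow> x + y \<in> Abar"
proof -
  assume "x \<in> Abar" "y \<in> Abar"
  then obtain u v where "(x, u) \<in> A" "(y, v) \<in> A" by (auto simp: Abar_def)
  from subgroup.m_closed[OF sub_A this] show ?thesis by (force simp: Abar_def)
qed

lemma Abar_minus: "x \<in> Abar \<Longrightarrow> - x \<in> Abar"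
proof -
  assume "x \<in> Abar"
  then obtain u where u: "(x, u) \<in> A" by (auto simp: Abar_def)
  have "(x, u) \<in> carrier H" using subgroup.subset[OF sub_A] u by blast
  hence "(- x, - u + f x x) \<in> A" using subgroup.m_inv_closed[OF sub_A u] inv_H by simp
  thus ?thesis by (force simp: Abar_def)
qed

lemma w_Abar: "x \<in> Abar \<Longrightarrow> y \<in> Abar \<Longrightarrow> w x y = 0"
proof -
  assume "x \<in> Abar" "y \<in> Abar"
  then obtain u v where "(x, u) \<in> A" "(y, v) \<in> A" by (auto simp: Abar_def)
  thus ?thesis
    using comm_monoid.m_comm[OF comm_group.axioms(1)[OF comm_A], of "(x, u)" "(y, v)"]
    by (simp add: w_def)
qed

text \<open>Maximality makes \<open>Abar\<close> its own orthogonal complement: an orthogonal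
  \<open>x\<close> could be adjoined to \<open>A\<close> without losing commutativity.\<close>

lemma perp_Abar_sub: 
  assumes x: "x \<in> V" and perp: "\<And>y. y \<in> Abar \<Longrightarrow> w x y = 0"
  shows "x \<in> Abar"
proof -
  \<comment> \<open>The full preimage in \<open>H\<close> of the group generated by
    \<open>Abar\<close> and \<open>x\<close>. Integer multiples are taken because
    \<open>Abar\<close> is so far only an additive group; integers lie in \<open>Fq p\<close>, so
    \<open>w\<close> is linear in them.\<close>
  define B where "B = {z \<in> carrier H. \<exists>m::int. \<exists>b\<in>Abar. fst z = b + of_int m * x}"
  have BI: "(\<alpha>, \<beta>) \<in> carrier H \<Longrightarrow> b \<in> Abar \<Longrightarrow> \<alpha> = b + of_int m * x \<Longrightarrow> (\<alpha>, \<beta>) \<in> B" for \<alpha> \<beta> b m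
    by (auto simp: B_def)
  have subB: "subgroup B H"
  proof (rule group.subgroupI[OF group_H])
    have "(0, 0) \<in> B" unfolding B_def
      using Abar_0 by (auto simp: carrier_H V_0 zero_power intro!: exI[of _ "0 :: int"])
    thus "B \<noteq> {}" by blast
    show "inv\<^bsub>H\<^esub> z \<in> B" if zB: "z \<in> B" for z
    proof (cases z)
      case (Pair \<alpha> \<beta>)
      then obtain m b where b: "b \<in> Abar" "\<alpha> = b + of_int m * x" and c: "(\<alpha>, \<beta>) \<in> carrier H"
        using zB by (auto simp: B_def)
      have "- \<alpha> = - b + of_int (- m) * x" using b by simp
      thus ?thesis unfolding Pair inv_H[OF c]
        by (rule BI[OF inv_closed_H[OF c] Abar_minus[OF b(1)]])
    qed
    show "z \<otimes>\<^bsub>H\<^esub> z' \<in> B" if zB: "z \<in> B" "z' \<in> B" for z z'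
    proof (cases z; cases z')
      fix \<alpha> \<beta> \<alpha>' \<beta>' assume z: "z = (\<alpha>, \<beta>)" "z' = (\<alpha>', \<beta>')"
      then obtain m b m' b' where b: "b \<in> Abar" "\<alpha> = b + of_int m * x" and c: "(\<alpha>, \<beta>) \<in> carrier H"
        and b': "b' \<in> Abar" "\<alpha>' = b' + of_int m' * x" and c': "(\<alpha>', \<beta>') \<in> carrier H"
        using zB by (auto simp: B_def)
      have "\<alpha> + \<alpha>' = (b + b') + of_int (m + m') * x" using b b' by (simp add: algebra_simps)
      thus ?thesis unfolding z mult_H
        by (rule BI[OF mult_closed_H[OF c c'] Abar_add[OF b(1) b'(1)]])
    qed
  qed (auto simp: B_def)
  have "comm_group (H\<lparr>carrier := B\<rparr>)"
  proof (rule group.group_comm_groupI)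
    show "group (H\<lparr>carrier := B\<rparr>)" by (rule subgroup.subgroup_is_group[OF subB group_H])
    fix z z' assume "z \<in> carrier (H\<lparr>carrier := B\<rparr>)" "z' \<in> carrier (H\<lparr>carrier := B\<rparr>)"
    then obtain \<alpha> \<beta> m b \<alpha>' \<beta>' m' b' where z: "z = (\<alpha>, \<beta>)" "z' = (\<alpha>', \<beta>')"
      and b: "b \<in> Abar" "\<alpha> = b + of_int m * x" "b' \<in> Abar" "\<alpha>' = b' + of_int m' * x"
      by (cases z; cases z') (auto simp: B_def)
    have t: "(of_int k :: 'a) \<in> Fq p" for k using Fq_of_int[of k 1] by simp
    have "w \<alpha> \<alpha>' = 0" using b perp w_Abar
      by (simp add: w_add_left w_add_right w_scale_left[OF t] w_scale_right[OF t] w_commute[of b x])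
    thus "z \<otimes>\<^bsub>H\<lparr>carrier := B\<rparr>\<^esub> z' = z' \<otimes>\<^bsub>H\<lparr>carrier := B\<rparr>\<^esub> z"
      by (simp add: z w_def algebra_simps)
  qed
  moreover have "A \<subseteq> B"
    using subgroup.subset[OF sub_A] by (auto simp: B_def Abar_def intro!: exI[of _ "0 :: int"] rev_bexI)
  ultimately have BA: "B = A" using max_A subB by blast
  obtain y where "y ^ p - y = x * R x" using artin_schreier_root by blast
  hence "(x, y) \<in> B"
    using x Abar_0 by (auto simp: B_def carrier_H intro!: exI[of _ "1 :: int"] bexI[of _ 0])
  thus ?thesis by (force simp: BA Abar_def)
qed

text \<open>Scalar multiples stay orthogonal to \<open>Abar\<close>, since \<open>w\<close> is
  \<open>Fq p\<close>-bilinear, and therefore stay in \<open>Abar\<close>.\<close>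

lemma Abar_scale: "t \<in> Fq p \<Longrightarrow> x \<in> Abar \<Longrightarrow> t * x \<in> Abar"
  by (rule perp_Abar_sub) (use Abar_sub_V V_scale w_Abar in \<open>auto simp: w_scale_left\<close>)

lemma finite_Abar: "finite Abar"
  using finite_V Abar_sub_V finite_subset by blast

text \<open>A Lagrangian subspace has half the dimension. Orthogonal pairs in
  \<open>V \<times> Abar\<close> are counted in both orders; with \<open>N = card Abar\<close> the
  outcome is \<open>(p - 1) * (N ^ 2 - card V) = 0\<close>.\<close>

lemma card_Abar: "card Abar = p ^ e"
proof -
  have 1: "p * card {y\<in>Abar. w x y = 0} = card Abar * (if x \<in> Abar then p else 1)" if x: "x \<in> V" for x
  proof (cases "x \<in> Abar")
    case True
    hence "{y\<in>Abar. w x y = 0} = Abar" using w_Abar by auto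
    thus ?thesis using True by simp
  next
    case False
    then obtain y0 where y0: "y0 \<in> Abar" "w x y0 \<noteq> 0" using perp_Abar_sub x by blast
    have "p * card {y\<in>Abar. w x y = 0} = card Abar"
      using y0 Abar_sub_V w_in_Fp[OF x] Fq_0[of 1]
      by (intro card_fibre[where z = y0]) (auto simp: finite_Abar Abar_add Abar_scale w_add_right w_scale_right)
    thus ?thesis using False by simp
  qed
  have 2: "p * card {x\<in>V. w x y = 0} = card V * (if y = 0 then p else 1)" if y: "y \<in> Abar" for y
  proof (cases "y = 0")
    case False
    then obtain x0 where x0: "x0 \<in> V" "w x0 y \<noteq> 0" using w_nondegenerate by blast
    have "p * card {x\<in>V. w x y = 0} = card V"
      using x0 y Abar_sub_V w_in_Fp[of _ y] Fq_0[of 1]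
      by (intro card_fibre[where z = x0]) (auto simp: finite_V V_add V_scale w_add_left w_scale_left)
    thus ?thesis using False by simp
  qed simp
  have c: "card {y\<in>S. P y} = (\<Sum>y\<in>S. if P y then 1 else 0)" if "finite S" for S :: "'a set" and P
    using that by (simp add: sum.If_cases Int_def)
  have "(\<Sum>x\<in>V. card {y\<in>Abar. w x y = 0}) = (\<Sum>y\<in>Abar. card {x\<in>V. w x y = 0})"
    unfolding c[OF finite_V] c[OF finite_Abar] by (rule sum.swap)
  hence "(\<Sum>x\<in>V. p * card {y\<in>Abar. w x y = 0}) = (\<Sum>y\<in>Abar. p * card {x\<in>V. w x y = 0})"
    by (simp flip: sum_distrib_left)
  hence "card Abar * (\<Sum>x\<in>V. if x \<in> Abar then p else 1) = card V * (\<Sum>y\<in>Abar. if y = 0 then p else 1)"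
    by (simp add: 1 2 sum_distrib_left)
  moreover have "(\<Sum>x\<in>V. if x \<in> Abar then p else 1) = p * card Abar + (card V - card Abar)"
    using finite_V Abar_sub_V finite_Abar
    by (simp add: sum.If_cases Int_absorb1 card_Diff_subset flip: Diff_eq)
  moreover have "(\<Sum>y\<in>Abar. if y = 0 then p else 1) = p + (card Abar - 1)"
    using finite_Abar Abar_0 by (simp add: sum.remove[of _ 0])
  ultimately have eq: "card Abar * (p * card Abar + (card V - card Abar)) = card V * (p + (card Abar - 1))"
    by simp
  have le: "card Abar \<le> card V" "card Abar \<ge> 1"
    using card_mono[OF finite_V Abar_sub_V] finite_Abar Abar_0
    by (auto simp: Suc_le_eq card_gt_0_iff)
  have "int (card Abar) * (int p * card Abar + (int (card V) - card Abar)) = int (card V) * (p + (int (card Abar) - 1))"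
    using arg_cong[OF eq, of int] le by (simp add: of_nat_diff add_diff_eq)
  hence "(int p - 1) * (int (card Abar) ^ 2 - card V) = 0"
    by (simp add: algebra_simps power2_eq_square)
  hence "int (card Abar) ^ 2 = card V" using p_gt_1 by simp
  hence "int (card Abar) ^ 2 = (int p ^ e) ^ 2" by (simp add: card_V power_mult mult.commute)
  hence "int (card Abar) = int p ^ e" by simp
  thus ?thesis by (metis of_nat_eq_iff of_nat_power)
qed

text \<open>The polynomial of a subspace grows by one dimension at a time: if \<open>L\<close> has
  kernel \<open>U\<close> and \<open>v\<close> lies outside \<open>U\<close>, then
  \<open>L x ^ p - L v ^ (p - 1) * L x\<close> has kernel \<open>U + Fq p * v\<close>. At
  \<open>i = e\<close> a count of roots turns the inclusion into equality.\<close>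

lemma exists_lin_within_Abar:
  "i \<le> e \<Longrightarrow> \<exists>b. b i = 1 \<and> b 0 \<noteq> 0 \<and> {x. lin p b (Suc i) x = 0} \<subseteq> Abar"
proof (induction i)
  case 0
  show ?case by (rule exI[of _ "\<lambda>_. 1"]) (auto simp: lin_def Abar_0)
next
  case (Suc i)
  then obtain b where b: "b i = 1" "b 0 \<noteq> 0" "{x. lin p b (Suc i) x = 0} \<subseteq> Abar" by auto
  have "card {x. lin p b (Suc i) x = 0} = p ^ i" using b by (intro card_lin_roots) auto
  moreover have "p ^ i < p ^ e" using Suc.prems p_gt_1 by simp
  ultimately have "{x. lin p b (Suc i) x = 0} \<noteq> Abar" using card_Abar by auto
  then obtain v where v: "v \<in> Abar" "lin p b (Suc i) v \<noteq> 0" using b(3) by blast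
  define L where "L = lin p b (Suc i)"
  have L0: "L v \<noteq> 0" using v by (simp add: L_def)
  define c where "c = (\<lambda>j. (if j \<ge> 1 then b (j - 1) ^ p else 0) - (if j \<le> i then L v ^ (p - 1) * b j else 0))"
  have c: "lin p c (Suc (Suc i)) x = L x ^ p - L v ^ (p - 1) * L x" for x
  proof -
    have "L x ^ p = (\<Sum>j<Suc i. b j ^ p * x ^ (p ^ (j + 1)))"
      unfolding L_def using lin_frob[of b "Suc i" x 1] by simp
    also have "\<dots> = (\<Sum>j<Suc (Suc i). (if j \<ge> 1 then b (j - 1) ^ p else 0) * x ^ (p ^ j))"
      by (subst (2) sum.lessThan_Suc_shift) simp
    finally have 1: "L x ^ p = \<dots>" .
    have 2: "L v ^ (p - 1) * L x = (\<Sum>j<Suc (Suc i). (if j \<le> i then L v ^ (p - 1) * b j else 0) * x ^ (p ^ j))"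
    proof -
      have "L x = (\<Sum>j<Suc i. b j * x ^ (p ^ j))" by (simp only: L_def lin_def)
      hence "L v ^ (p - 1) * L x = (\<Sum>j<Suc i. L v ^ (p - 1) * b j * x ^ (p ^ j))"
        by (simp only: sum_distrib_left mult.assoc)
      also have "\<dots> = (\<Sum>j<Suc (Suc i). (if j \<le> i then L v ^ (p - 1) * b j else 0) * x ^ (p ^ j))"
        by (rule sum.mono_neutral_cong_left) auto
      finally show ?thesis .
    qed
    show ?thesis unfolding 1 2 by (simp only: lin_def c_def left_diff_distrib sum_subtractf)
  qed
  have "x \<in> Abar" if "lin p c (Suc (Suc i)) x = 0" for x
  proof -
    define t where "t = L x / L v"
    have "L x ^ p = L v ^ (p - 1) * L x" using that c by simp
    hence "L x ^ p * L v = L v ^ p * L x"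
      using p_pos by (metis mult.assoc mult.commute power_minus_mult)
    hence "t ^ p = t" using L0 by (simp add: t_def power_divide field_simps)
    hence t: "t \<in> Fq p" by (simp add: Fq_def)
    have "L (x - t * v) = 0" using L0 unfolding L_def
      by (simp add: lin_diff lin_scale[OF t]) (simp add: t_def L_def)
    hence "x - t * v \<in> Abar" using b(3) by (auto simp: L_def)
    from Abar_add[OF this Abar_scale[OF t v(1)]] show ?thesis by simp
  qed
  moreover have "c (Suc i) = 1" "c 0 \<noteq> 0" using b L0 by (auto simp: c_def)
  ultimately show ?case by blast
qed

text \<open>Shows that the product over \<open>Abar\<close> is additive: it and
  \<open>lin_poly b (Suc e)\<close> are monic of degree \<open>p ^ e\<close>, so their difference
  has too small a degree to vanish on \<open>Abar\<close>. The same argument against the conjugate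
  polynomial places the \<open>b i\<close> in \<open>Fq (p ^ n)\<close>.\<close>

lemma obtain_F_A:
  obtains b where "b e = 1" "b 0 \<noteq> 0" "\<And>i. i \<le> e \<Longrightarrow> b i \<in> Fq (p ^ n)"
    "F_A A = lin_poly b (Suc e)" "\<And>x. lin p b (Suc e) x = 0 \<longleftrightarrow> x \<in> Abar"
proof -
  obtain b where b: "b e = 1" "b 0 \<noteq> 0" and sub: "{x. lin p b (Suc e) x = 0} \<subseteq> Abar"
    using exists_lin_within_Abar by blast
  have "card {x. lin p b (Suc e) x = 0} = card Abar"
    using card_lin_roots[of b e] b card_Abar by simp
  hence eq: "{x. lin p b (Suc e) x = 0} = Abar"
    using sub finite_Abar by (metis card_subset_eq)
  have roots: "lin p b (Suc e) x = 0 \<longleftrightarrow> x \<in> Abar" for x using eq by blast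
  have bq: "b i \<in> Fq (p ^ n)" if "i \<le> e" for i
  proof (cases "i = e")
    case False
    have "lin p (\<lambda>i. b i ^ (p ^ n) - b i) e x = 0" if x: "x \<in> Abar" for x
    proof -
      have x': "lin p b (Suc e) x = 0" "x ^ (p ^ n) = x" using x roots Abar_sub_Fq by (auto simp: Fq_def)
      have "(\<Sum>i<Suc e. b i ^ (p ^ n) * x ^ (p ^ (i + n))) = 0"
        using x'(1) lin_frob[of b "Suc e" x n] by (simp add: zero_power)
      moreover have "x ^ (p ^ (i + n)) = x ^ (p ^ i)" for i
        using x'(2) by (metis add.commute power_add power_mult)
      ultimately have "lin p (\<lambda>i. b i ^ (p ^ n)) (Suc e) x = 0" by (simp add: lin_def)
      hence "lin p (\<lambda>i. b i ^ (p ^ n)) (Suc e) x - lin p b (Suc e) x = 0" using x' by simp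
      thus ?thesis by (simp add: lin_def b sum_subtractf left_diff_distrib)
    qed
    from lin_zero[where c = "\<lambda>i. b i ^ (p ^ n) - b i" and i = i, OF this]
    show ?thesis using False that card_Abar by (simp add: Fq_def)
  qed (simp add: b Fq_1)
  have "F_A A = lin_poly b (Suc e)"
  proof (rule ccontr)
    let ?d = "F_A A - lin_poly b (Suc e)"
    assume "F_A A \<noteq> lin_poly b (Suc e)"
    hence d0: "?d \<noteq> 0" by simp
    have F: "F_A A = (\<Prod>\<alpha>\<in>Abar. [:- \<alpha>, 1:])" by (simp add: F_A_def Abar_def)
    have dF: "degree (F_A A) = p ^ e" unfolding F
      by (subst degree_prod_eq_sum_degree) (auto simp: card_Abar)
    have lF: "lead_coeff (F_A A) = 1" unfolding F by (simp add: lead_coeff_prod)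
    have dL: "degree (lin_poly b (Suc e)) = p ^ e" using b by (intro degree_lin_poly) simp
    have lL: "lead_coeff (lin_poly b (Suc e)) = 1" unfolding dL using b coeff_lin_poly[of b "Suc e" e] by simp
    have "coeff ?d (p ^ e) = 0" using dF dL lF lL by simp
    moreover have "degree ?d \<le> p ^ e" using dF dL by (intro degree_diff_le) auto
    ultimately have deg: "degree ?d < p ^ e"
      using d0 by (metis leading_coeff_0_iff le_neq_implies_less)
    have "poly (F_A A) x = 0" if "x \<in> Abar" for x
      using finite_Abar that by (auto simp: F poly_prod)
    hence "Abar \<subseteq> {x. poly ?d x = 0}" by (auto simp: poly_lin_poly roots)
    hence "card Abar \<le> degree ?d"
      using card_mono[OF poly_roots_finite[OF d0]] card_poly_roots_bound[OF d0] le_trans by blast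
    thus False using deg card_Abar by simp
  qed
  thus thesis using that b bq roots by blast
qed

end

section \<open>Counting points and the rationality of \<open>V_R\<close>\<close>

context heisenberg
begin

lemma card_artin_schreier:
  assumes "(t :: 'a) \<in> Fq (p ^ m)"
  shows "card {d \<in> Fq (p ^ m). d ^ p - d = t} = (if trace_Fq p m t = 0 then p else 0)"
proof -
  have K: "d \<in> Fq (p ^ m) \<longleftrightarrow> trace_Fq p m t = 0" if "d ^ p - d = t" for d :: 'a
    using trace_telescope[of m d] that by (simp add: Fq_def)
  obtain d0 :: 'a where d0: "d0 ^ p - d0 = t" using artin_schreier_root by blast
  have "{d. d ^ p - d = t} = (\<lambda>i. d0 + i) ` Fq p"
  proof safe
    fix d :: 'a assume "t = d ^ p - d"
    hence "d - d0 \<in> Fq p" using d0 by (simp add: Fq_def frob_diff1 algebra_simps)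
    thus "d \<in> (\<lambda>i. d0 + i) ` Fq p" by (metis add.commute diff_add_cancel imageI)
  qed (use d0 in \<open>simp add: Fq_def frob_add1\<close>)
  hence "card {d. d ^ p - d = t} = p" by (simp add: card_image card_Fp)
  moreover have "{d \<in> Fq (p ^ m). d ^ p - d = t} = (if trace_Fq p m t = 0 then {d. d ^ p - d = t} else {})"
    using K by auto
  ultimately show ?thesis by simp
qed

lemma card_affine_points:
  assumes m: "m > 0" "n dvd m"
  shows "card {(c, d). c \<in> Fq (p ^ m) \<and> d \<in> Fq (p ^ m) \<and> d ^ p - d = c * R c} =
    p * card {c \<in> Fq (p ^ m). trace_Fq p m (c * R c) = 0}"
proof -
  let ?K = "Fq (p ^ m)"
  have "{(c, d). c \<in> ?K \<and> d \<in> ?K \<and> d ^ p - d = c * R c} = (SIGMA c:?K. {d \<in> ?K. d ^ p - d = c * R c})"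
    by auto
  also have "card \<dots> = (\<Sum>c\<in>?K. card {d \<in> ?K. d ^ p - d = c * R c})"
    using finite_Fq[OF m(1)] by (intro card_SigmaI) auto
  also have "\<dots> = (\<Sum>c\<in>?K. if trace_Fq p m (c * R c) = 0 then p else 0)"
    using m by (intro sum.cong refl card_artin_schreier) (auto intro: Fq_mult R_Fq)
  also have "\<dots> = p * card {c \<in> ?K. trace_Fq p m (c * R c) = 0}"
    using finite_Fq[OF m(1)] by (simp add: sum.If_cases Int_def)
  finally show ?thesis .
qed

text \<open>The quadratic form \<open>x \<mapsto> Tr (x R x)\<close> has second moment governed by the radical of its
  polar form, which by \<open>f_telescope\<close> is the set of zeros of \<open>E_R\<close>.\<close>

lemma second_moment:
  assumes m: "m > 0" "n dvd m"
  defines "N \<equiv> \<lambda>c. card {x \<in> Fq (p ^ m). trace_Fq p m (x * R x) = c}"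
  shows "p * (\<Sum>c\<in>Fq p. N c ^ 2) = p ^ m * ((p - 1) * card (V \<inter> Fq (p ^ m)) + p ^ m)"
proof -
  let ?K = "Fq (p ^ m) :: 'a set" and ?T = "trace_Fq p m :: 'a \<Rightarrow> 'a"
  note fin = finite_Fq[OF m(1)]
  define q where "q x = ?T (x * R x)" for x
  define B where "B u v = ?T (u * R v + v * R u)" for u v
  have RK: "x \<in> ?K \<Longrightarrow> R x \<in> ?K" for x using R_Fq m by blast
  have q_Fp: "x \<in> ?K \<Longrightarrow> q x \<in> Fq p" for x
    unfolding q_def by (intro trace_in_Fp Fq_mult RK)
  \<comment> \<open>\<open>f u v\<close> lies in the finite field, so the trace kills
    \<open>f u v ^ p - f u v\<close>, and \<open>f_telescope\<close> rewrites the polar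
    form.\<close>
  have B_eq: "B u v = ?T (u ^ (p ^ e) * E v)" if "u \<in> ?K" "v \<in> ?K" for u v
  proof -
    have "?T (f u v ^ p - f u v) = 0"
      using trace_frob1[OF f_Fq[OF m(2) that]] by (simp add: trace_diff)
    thus ?thesis unfolding f_telescope B_def by (simp add: trace_diff)
  qed
  have "(\<Sum>c\<in>Fq p. N c ^ 2) = (\<Sum>c\<in>Fq p. \<Sum>x\<in>{x\<in>?K. q x = c}. N c)"
    by (simp add: N_def q_def power2_eq_square)
  also have "\<dots> = (\<Sum>c\<in>Fq p. \<Sum>x\<in>{x\<in>?K. q x = c}. N (q x))" by (intro sum.cong) auto
  also have "\<dots> = (\<Sum>x\<in>?K. N (q x))"
    using sum.group[OF fin finite_Fp, of q "\<lambda>x. N (q x)"] q_Fp by blast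
  also have "\<dots> = card (SIGMA x:?K. {x' \<in> ?K. q x' = q x})"
    using fin by (subst card_SigmaI) (auto simp: N_def q_def)
  \<comment> \<open>As 2 is invertible, \<open>(x, x')\<close> can be replaced by
    \<open>(x + x', x - x')\<close>. The quadratic condition \<open>q x' = q x\<close> then becomes
    the bilinear one \<open>B (x - x') (x + x') = 0\<close>.\<close>
  also have "\<dots> = card (SIGMA v:?K. {u \<in> ?K. B u v = 0})"
  proof (rule bij_betw_same_card[where f = "\<lambda>(x, x'). (x + x', x - x')"], rule bij_betw_byWitness[where f' = "\<lambda>(v, u). ((v + u) / 2, (v - u) / 2)"])
    have h: "(1 :: 'a) / 2 \<in> ?K" using Fq_of_int[of 2 m] Fq_1 by (auto intro: Fq_divide)
    have h2: "x \<in> ?K \<Longrightarrow> x / 2 \<in> ?K" for x using Fq_mult[OF _ h, of x] by simp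
    have key: "B (x - x') (x + x') = 2 * (q x - q x')" for x x'
    proof -
      have "(x - x') * R (x + x') + (x + x') * R (x - x') = (x * R x - x' * R x') + (x * R x - x' * R x')"
        by (simp add: R_add R_diff algebra_simps)
      thus ?thesis unfolding B_def q_def by (simp only: trace_add trace_diff) simp
    qed
    have sum2: "(x + y + (x - y)) / 2 = x" "(x + y - (x - y)) / 2 = y" "(x + y) / 2 + (x - y) / 2 = x"
       "(x + y) / 2 - (x - y) / 2 = y" for x y :: 'a
    proof -
      have "x + y + (x - y) = 2 * x" "x + y - (x - y) = 2 * y" by simp_all
      thus "(x + y + (x - y)) / 2 = x" "(x + y - (x - y)) / 2 = y" "(x + y) / 2 + (x - y) / 2 = x"
         "(x + y) / 2 - (x - y) / 2 = y"
        using two_nz by (simp_all only: add_divide_distrib[symmetric] diff_divide_distrib[symmetric]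
            nonzero_mult_div_cancel_left not_False_eq_True)
    qed
    show "\<forall>a\<in>SIGMA x:?K. {x' \<in> ?K. q x' = q x}. (case case a of (x, x') \<Rightarrow> (x + x', x - x') of (v, u) \<Rightarrow> ((v + u) / 2, (v - u) / 2)) = a"
      by (auto simp: two_nz)
    show "\<forall>a\<in>SIGMA v:?K. {u \<in> ?K. B u v = 0}. (case case a of (v, u) \<Rightarrow> ((v + u) / 2, (v - u) / 2) of (x, x') \<Rightarrow> (x + x', x - x')) = a"
      by (auto simp: sum2)
    show "(\<lambda>(x, x'). (x + x', x - x')) ` (SIGMA x:?K. {x' \<in> ?K. q x' = q x}) \<subseteq> (SIGMA v:?K. {u \<in> ?K. B u v = 0})"
      by (auto simp: key intro: Fq_add Fq_diff)
    show "(\<lambda>(v, u). ((v + u) / 2, (v - u) / 2)) ` (SIGMA v:?K. {u \<in> ?K. B u v = 0}) \<subseteq> (SIGMA x:?K. {x' \<in> ?K. q x' = q x})"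
    proof safe
      fix u v assume uv: "v \<in> ?K" "u \<in> ?K" "B u v = 0"
      show "(v + u) / 2 \<in> ?K" "(v - u) / 2 \<in> ?K" using uv by (auto intro!: h2 Fq_add Fq_diff)
      show "q ((v - u) / 2) = q ((v + u) / 2)"
        using key[of "(v + u) / 2" "(v - u) / 2"] uv(3) two_nz by (simp add: sum2)
    qed
  qed
  also have "\<dots> = (\<Sum>v\<in>?K. card {u \<in> ?K. B u v = 0})"
    using fin by (intro card_SigmaI) auto
  finally have "p * (\<Sum>c\<in>Fq p. N c ^ 2) = (\<Sum>v\<in>?K. p * card {u \<in> ?K. B u v = 0})"
    by (simp only: sum_distrib_left)
  \<comment> \<open>For \<open>v\<close> in \<open>V\<close> every \<open>u\<close> is counted.
    Otherwise \<open>B _ v\<close> is a nonzero linear form, because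
    \<open>u ^ (p ^ e) * E v\<close> can be any element of the finite field, and
    \<open>card_fibre\<close> applies.\<close>
  also have "\<dots> = (\<Sum>v\<in>?K. p ^ m * (if v \<in> V then p else 1))"
  proof (rule sum.cong)
    fix v assume v: "v \<in> ?K"
    show "p * card {u \<in> ?K. B u v = 0} = p ^ m * (if v \<in> V then p else 1)"
    proof (cases "v \<in> V")
      case True
      hence "{u \<in> ?K. B u v = 0} = ?K" using B_eq[OF _ v] by (auto simp: V_R_def)
      thus ?thesis using True m by (simp add: card_Fq)
    next
      case False
      hence Ev: "E v \<noteq> 0" by (simp add: V_R_def)
      have EvK: "E v \<in> ?K"
        unfolding E_R_def using v RK a_Fq Fq_mono[OF m(2)] by (intro Fq_closed) auto
      obtain t where t: "t \<in> ?K" "?T t \<noteq> 0" using trace_nonzero[OF m(1)] by blast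
      obtain u where u: "u ^ (p ^ e) = t / E v" using frob_surj by blast
      have uK: "u \<in> ?K"
      proof -
        have "(u ^ (p ^ m)) ^ (p ^ e) = (u ^ (p ^ e)) ^ (p ^ m)"
          by (metis mult.commute power_mult)
        also have "\<dots> = u ^ (p ^ e)" using Fq_divide[OF t(1) EvK] u by (simp add: Fq_def)
        finally show ?thesis using frob_inj by (simp add: Fq_def)
      qed
      have "B u v \<noteq> 0" using B_eq[OF uK v] u t Ev by simp
      moreover have "B (x + y) v = B x v + B y v" for x y
        by (simp add: B_def R_add algebra_simps trace_add)
      moreover have "B (t * x) v = t * B x v" if "t \<in> Fq p" for x t
      proof -
        have "B (t * x) v = ?T (t * (x * R v + v * R x))"
          using that by (simp add: B_def R_scale algebra_simps)
        thus ?thesis using that by (simp add: trace_scale B_def)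
      qed
      moreover have "B x v \<in> Fq p" if "x \<in> ?K" for x
        unfolding B_def using that v RK by (intro trace_in_Fp Fq_closed)
      moreover have "0 \<in> (Fq p :: 'a set)" by (simp add: Fq_def)
      ultimately have "p * card {u \<in> ?K. B u v = 0} = card ?K"
        using uK fin by (intro card_fibre[where z = u]) (auto intro: Fq_add Fq_mult Fp_sub)
      thus ?thesis using False m by (simp add: card_Fq)
    qed
  qed simp
  also have "\<dots> = p ^ m * (p * card (V \<inter> ?K) + (card ?K - card (V \<inter> ?K)))"
    using fin by (simp add: sum_distrib_left[symmetric] sum.If_cases Int_commute[of ?K] Diff_eq[symmetric] card_Diff_subset_Int)
  also have "p * card (V \<inter> ?K) + (card ?K - card (V \<inter> ?K)) = (p - 1) * card (V \<inter> ?K) + p ^ m"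
  proof -
    have "card (V \<inter> ?K) \<le> card ?K" using fin by (intro card_mono) auto
    moreover have "p * card (V \<inter> ?K) = (p - 1) * card (V \<inter> ?K) + card (V \<inter> ?K)"
      using p_pos by (metis Suc_diff_1 add.commute mult_Suc)
    ultimately show ?thesis using m by (simp add: card_Fq)
  qed
  finally show ?thesis .
qed

text \<open>Given the total \<open>p ^ m\<close> and the second moment, Cauchy-Schwarz over the
  \<open>p - 1\<close> nonzero trace values confines the fibre over 0.\<close>

lemma affine_points_bound:
  assumes m: "m > 0" "n dvd m"
  shows "(int (p * card {c \<in> Fq (p ^ m). trace_Fq p m (c * R c) = 0}) - int (p ^ m)) ^ 2
    \<le> (int p - 1) ^ 2 * int (card (V \<inter> Fq (p ^ m))) * int (p ^ m)"
proof -
  define N where "N c = int (card {x \<in> Fq (p ^ m). trace_Fq p m (x * R x) = c})" for c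
  let ?F = "Fq p - {0 :: 'a}" and ?Q = "int (p ^ m)" and ?W = "int (card (V \<inter> Fq (p ^ m)))"
  have F0: "0 \<in> (Fq p :: 'a set)" by (simp add: Fq_def)
  have tot: "(\<Sum>c\<in>Fq p. N c) = ?Q"
  proof -
    have "(\<Sum>c\<in>Fq p. \<Sum>x\<in>{x \<in> Fq (p ^ m). trace_Fq p m (x * R x) = c}. 1 :: int) = (\<Sum>x\<in>(Fq (p ^ m) :: 'a set). 1)"
      using R_Fq[OF m(2)] by (intro sum.group finite_Fq finite_Fp m) (auto intro!: trace_in_Fp Fq_mult)
    thus ?thesis using m by (simp add: N_def card_Fq)
  qed
  have S1: "(\<Sum>c\<in>?F. N c) = ?Q - N 0" using tot F0 finite_Fp by (simp add: sum_diff1)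
  have "int p * (\<Sum>c\<in>Fq p. N c ^ 2) = ?Q * ((int p - 1) * ?W + ?Q)"
    using arg_cong[OF second_moment[OF m], of int] p_gt_1 by (simp add: N_def of_nat_diff)
  moreover have "(\<Sum>c\<in>Fq p. N c ^ 2) = N 0 ^ 2 + (\<Sum>c\<in>?F. N c ^ 2)"
    using F0 finite_Fp by (simp add: sum.remove)
  ultimately have S2: "int p * (N 0 ^ 2 + (\<Sum>c\<in>?F. N c ^ 2)) = ?Q * ((int p - 1) * ?W + ?Q)" by simp
  have cF: "int (card ?F) = int p - 1" using F0 finite_Fp card_Fp p_gt_1 by (simp add: of_nat_diff)
  have CS: "(?Q - N 0) ^ 2 \<le> (int p - 1) * (\<Sum>c\<in>?F. N c ^ 2)"
  proof -
    define M S where "M = int p - 1" and "S = (\<Sum>c\<in>?F. N c)"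
    have M: "M > 0" using p_gt_1 by (simp add: M_def)
    \<comment> \<open>The spread of \<open>N\<close> about its mean \<open>S / M\<close> on the
      nonzero values, multiplied by \<open>M\<close> to stay in the integers.\<close>
    have "0 \<le> (\<Sum>c\<in>?F. (M * N c - S) ^ 2)" by (intro sum_nonneg) simp
    also have "\<dots> = (\<Sum>c\<in>?F. M ^ 2 * N c ^ 2 - 2 * M * S * N c + S ^ 2)"
      by (intro sum.cong) (auto simp: power2_eq_square algebra_simps)
    also have "\<dots> = M ^ 2 * (\<Sum>c\<in>?F. N c ^ 2) - 2 * M * S * S + M * S ^ 2"
      using cF by (simp add: sum.distrib sum_subtractf sum_distrib_left[symmetric] S_def M_def)
    also have "\<dots> = M * (M * (\<Sum>c\<in>?F. N c ^ 2) - S ^ 2)" by (simp add: power2_eq_square algebra_simps)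
    finally have "S ^ 2 \<le> M * (\<Sum>c\<in>?F. N c ^ 2)" using M by (simp add: zero_le_mult_iff)
    thus ?thesis by (simp add: S_def M_def S1)
  qed
  have "int p * (?Q - N 0) ^ 2 \<le> (int p - 1) * (int p * (\<Sum>c\<in>?F. N c ^ 2))"
    using mult_left_mono[OF CS, of "int p"] by (simp add: algebra_simps)
  also have "\<dots> = (int p - 1) * (?Q * ((int p - 1) * ?W + ?Q) - int p * N 0 ^ 2)"
  proof -
    have "int p * (\<Sum>c\<in>?F. N c ^ 2) = ?Q * ((int p - 1) * ?W + ?Q) - int p * N 0 ^ 2"
      using S2 by (simp add: distrib_left)
    thus ?thesis by simp
  qed
  finally have "int p * (?Q - N 0) ^ 2 \<le> (int p - 1) * (?Q * ((int p - 1) * ?W + ?Q) - int p * N 0 ^ 2)" .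
  hence "(int p * N 0 - ?Q) ^ 2 \<le> (int p - 1) ^ 2 * ?W * ?Q"
    by (simp add: power2_eq_square algebra_simps)
  thus ?thesis by (simp add: N_def)
qed

end

context max_abelian
begin

lemma V_subset_descend:
  assumes V: "V \<subseteq> Fq (p ^ (n * k))" and k: "coprime k CHAR('a)"
  shows "V \<subseteq> Fq (p ^ n)"
proof
  fix x assume x: "x \<in> V"
  define d where "d = x ^ (p ^ n) - x"
  have xq: "x ^ (p ^ n) \<in> V" using x E_q[of x] by (simp add: V_R_def zero_power)
  have dV: "d \<in> V" unfolding d_def by (rule V_diff[OF xq x])
  \<comment> \<open>The \<open>p ^ n\<close>-Frobenius commutes with \<open>w\<close> and fixes
    \<open>y\<close>, while \<open>w x y\<close> lies in \<open>Fq p\<close> and is fixed too; hence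
    \<open>x ^ (p ^ n)\<close> and \<open>x\<close> pair equally with \<open>y\<close>.\<close>
  have "w d y = 0" if y: "y \<in> Abar" for y
  proof -
    have yV: "y \<in> V" and yq: "y ^ (p ^ n) = y" using y Abar_sub_V Abar_sub_Fq by (auto simp: Fq_def)
    have "w (x ^ (p ^ n)) y = w x y ^ (p ^ n)"
      using f_q[of x y] f_q[of y x] by (simp add: w_def yq frob_diff)
    also have "\<dots> = w x y" by (rule Fp_frob[OF w_in_Fp[OF x yV]])
    finally show ?thesis by (simp add: d_def w_add_left[of "x ^ (p ^ n)" "- x", simplified] w_minus_left)
  qed
  hence "d \<in> Abar" using perp_Abar_sub dV by blast
  hence dq: "d ^ (p ^ n) = d" using Abar_sub_Fq by (auto simp: Fq_def)
  have it: "x ^ (p ^ (n * j)) = x + of_nat j * d" for j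
  proof (induction j)
    case (Suc j)
    have "x ^ (p ^ (n * Suc j)) = (x ^ (p ^ (n * j))) ^ (p ^ n)"
      by (simp add: power_add mult.commute flip: power_mult)
    also have "\<dots> = x ^ (p ^ n) + of_nat j * d"
      using frob_of_int[of "int j" n] by (simp add: Suc.IH frob_add power_mult_distrib dq)
    finally show ?case by (simp add: d_def algebra_simps)
  qed simp
  have "x + of_nat k * d = x" using V x it[of k] by (auto simp: Fq_def)
  moreover have "(of_nat k :: 'a) \<noteq> 0"
    using k prime_char by (metis coprime_absorb_right not_prime_unit of_nat_eq_0_iff_char_dvd)
  ultimately have "d = 0" by simp
  thus "x \<in> Fq (p ^ n)" by (simp add: d_def Fq_def)
qed

end

section \<open>The trace condition\<close>

context max_abelian
begin

lemma coeff_lin_poly_Fq: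
  assumes "\<And>i. i < m \<Longrightarrow> c i \<in> Fq (p ^ n)"
  shows "coeff (lin_poly c m) i \<in> Fq (p ^ n)"
  unfolding lin_poly_def coeff_sum coeff_monom using assms by (intro Fq_sum) (auto intro: Fq_0)

text \<open>Remainders of right division by \<open>F_A\<close> have this form, so a check on
  \<open>Abar\<close> shows that they are zero.\<close>

lemma vanishing_on_Abar: "(\<And>x. x \<in> Abar \<Longrightarrow> lin p r e x = 0) \<Longrightarrow> lin p r e x = 0"
  using lin_zero[of Abar r e] card_Abar by (simp add: lin_def)

text \<open>\<open>a_A\<close> is a definite description, so existence and uniqueness come first.
  The right quotient \<open>g\<close> of \<open>x ^ (p ^ n) - x\<close> by \<open>F\<close>
  satisfies the identity for \<open>g \<circ> F\<close>; as \<open>F\<close> is onto and commutes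
  with the \<open>p ^ n\<close>-Frobenius, it also holds for \<open>F \<circ> g\<close>. Two
  solutions differ by a constant, and additive polynomials vanish at 0.\<close>

lemma a_A_spec:
  assumes z: "z \<in> Fq (p ^ n)"
  shows "poly (a_A p (p ^ n) A) (poly (F_A A) z) = 0"
proof -
  obtain b where b: "b e = 1" "b 0 \<noteq> 0" "\<And>i. i \<le> e \<Longrightarrow> b i \<in> Fq (p ^ n)"
    "F_A A = lin_poly b (Suc e)" "\<And>x. lin p b (Suc e) x = 0 \<longleftrightarrow> x \<in> Abar"
    using obtain_F_A by blast
  define F where "F = lin p b (Suc e)"
  have polyF: "poly (F_A A) x = F x" for x by (simp add: b(4) F_def poly_lin_poly)
  let ?c = "\<lambda>i. if i = 0 then - 1 else if i = n then 1 else (0 :: 'a)"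
  \<comment> \<open>Zero coefficients pad the polynomial to the length required by right division,
    with no comparison of \<open>n\<close> and \<open>e\<close>.\<close>
  have c: "lin p ?c (e + Suc n) x = x ^ (p ^ n) - x" for x
  proof -
    have "lin p ?c (e + Suc n) x = (\<Sum>i\<in>{0, n}. ?c i * x ^ (p ^ i))"
      unfolding lin_def using n_pos by (intro sum.mono_neutral_right) auto
    thus ?thesis using n_pos by simp
  qed
  obtain g r where g: "\<And>i. i < Suc n \<Longrightarrow> g i \<in> Fq (p ^ n)"
    and gr: "\<And>x. lin p ?c (e + Suc n) x = lin p g (Suc n) (F x) + lin p r e x"
  proof -
    have "?c i \<in> Fq (p ^ n)" for i using Fq_0 Fq_1 Fq_minus[OF Fq_1] by simp
    moreover have "u - v * w ^ (p ^ j) \<in> Fq (p ^ n)"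
      if "u \<in> Fq (p ^ n)" "v \<in> Fq (p ^ n)" "w \<in> Fq (p ^ n)" for u v w :: 'a and j
      using that by (intro Fq_diff Fq_mult Fq_power)
    ultimately show thesis
      using lin_right_div[where K = "Fq (p ^ n)" and d = "Suc n" and c = ?c and b = b and e = e, OF b(1,3)] that
      unfolding F_def by blast
  qed
  have "lin p r e x = 0" if "x \<in> Abar" for x
  proof -
    have "x ^ (p ^ n) = x" using that Abar_sub_Fq by (auto simp: Fq_def)
    moreover have "F x = 0" using that b(5) by (simp add: F_def)
    ultimately show ?thesis using gr[of x] c[of x] by simp
  qed
  hence right: "lin p g (Suc n) (F x) = x ^ (p ^ n) - x" for x
    using gr[of x] c[of x] vanishing_on_Abar[of r x] by simp
  have Fq': "F (x ^ (p ^ n)) = F x ^ (p ^ n)" for x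
  proof -
    have "b i ^ (p ^ n) = b i" if "i < Suc e" for i using b(3)[of i] that by (simp add: Fq_def)
    thus ?thesis unfolding F_def lin_frob by (simp add: lin_def mult.commute flip: power_mult power_add)
  qed
  have left: "F (lin p g (Suc n) x) = x ^ (p ^ n) - x" for x
  proof -
    obtain y where "F y = x" using lin_surj[of b e "Suc e" x] b(1) unfolding F_def by auto
    thus ?thesis using right[of y] Fq'[of y] by (simp add: F_def lin_diff)
  qed
  define G where "G = lin_poly g (Suc n)"
  have "a_A p (p ^ n) A = G"
    unfolding a_A_def
  proof (rule the_equality)
    have "linearized p G" unfolding linearized_def G_def lin_poly_def lessThan_Suc_atMost by blast
    moreover have "pcompose (F_A A) G = monom 1 (p ^ n) - monom 1 1"
      by (rule poly_ext) (simp add: poly_pcompose polyF G_def poly_lin_poly left poly_monom)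
    ultimately show "linearized p G \<and> (\<forall>i. coeff G i \<in> Fq (p ^ n)) \<and> pcompose (F_A A) G = monom 1 (p ^ n) - monom 1 1"
      using g unfolding G_def by (auto intro: coeff_lin_poly_Fq)
  next
    fix h :: "'a poly"
    assume h: "linearized p h \<and> (\<forall>i. coeff h i \<in> Fq (p ^ n)) \<and> pcompose (F_A A) h = monom 1 (p ^ n) - monom 1 1"
    have "pcompose (F_A A) (h - G) = 0"
    proof (rule poly_ext)
      fix x
      have "F (poly h x) = x ^ (p ^ n) - x"
        using h by (metis (no_types, lifting) polyF poly_pcompose poly_diff poly_monom mult_1 power_one_right)
      thus "poly (pcompose (F_A A) (h - G)) x = poly 0 x"
        by (simp add: poly_pcompose polyF F_def lin_diff) (simp add: G_def poly_lin_poly left flip: F_def)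
    qed
    moreover have "F_A A \<noteq> 0"
      using b(1,4) coeff_lin_poly[of b "Suc e" e] by auto
    ultimately have "degree (h - G) = 0" using pcompose_eq_0 by blast
    then obtain c where c: "h - G = [:c:]" by (metis degree_eq_zeroE)
    obtain m' b' where "h = (\<Sum>i\<le>m'. monom (b' i) (p ^ i))" using h unfolding linearized_def by blast
    hence "poly h 0 = 0" by (simp add: poly_sum poly_monom zero_power)
    moreover have "poly G 0 = 0" by (simp add: G_def poly_lin_poly)
    ultimately have "c = 0" using arg_cong[OF c, of "\<lambda>f. poly f 0"] by simp
    thus "h = G" using c by simp
  qed
  thus ?thesis using z right[of z] by (simp add: polyF G_def poly_lin_poly Fq_def)
qed

text \<open>\<open>E_R = G \<circ> F_A\<close> with \<open>G\<close> a twisted adjoint of \<open>F_A\<close>: for \<open>y\<close> in \<open>Abar\<close> also the pairing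
  with \<open>y\<close> factors through \<open>F_A\<close>, and comparing coefficients in \<open>w_telescope\<close> shows that \<open>Abar\<close> is
  annihilated by a \<open>p\<close>-polynomial made of the coefficients of \<open>G\<close>.\<close>

lemma E_factor:
  assumes b: "b e = 1" "b 0 \<noteq> 0" "\<And>x. lin p b (Suc e) x = 0 \<longleftrightarrow> x \<in> Abar"
  shows "E x = (\<Sum>j\<le>e. (a e / b 0 * b (e - j) * lin p b (Suc e) x) ^ (p ^ j))"
proof -
  define F where "F = lin p b (Suc e)"
  have F_surj: "\<exists>x. F x = z" for z using lin_surj[of b e "Suc e" z] b(1) by (simp add: F_def)
  have factor: "\<exists>g. \<forall>x. lin p c (e + d) x = lin p g d (F x)"
    if "\<And>x. x \<in> Abar \<Longrightarrow> lin p c (e + d) x = 0" for c d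
  proof -
    obtain g r where gr: "\<And>x. lin p c (e + d) x = lin p g d (F x) + lin p r e x"
      using lin_right_div[of b e UNIV d c] b(1) unfolding F_def by auto
    have "lin p r e x = 0" if "x \<in> Abar" for x
    proof -
      have "F x = 0" "lin p c (e + d) x = 0"
        using that b(3) \<open>\<And>x. x \<in> Abar \<Longrightarrow> lin p c (e + d) x = 0\<close> by (auto simp: F_def)
      thus ?thesis using gr[of x] by simp
    qed
    thus ?thesis using gr vanishing_on_Abar by auto
  qed
  have "\<And>x. x \<in> Abar \<Longrightarrow> lin p E_coeff (e + Suc e) x = 0"
    using Abar_sub_V by (auto simp: V_R_def E_lin mult_2)
  then obtain g where g: "\<And>x. E x = lin p g (Suc e) (F x)"
    using factor[of E_coeff "Suc e"] by (auto simp: E_lin mult_2)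
  \<comment> \<open>Derivatives of additive polynomials are their linear coefficients, so the chain
    rule compares these across the composition.\<close>
  have g0: "g 0 = a e / b 0"
  proof -
    have "lin_poly E_coeff (Suc (2 * e)) = pcompose (lin_poly g (Suc e)) (lin_poly b (Suc e))"
      by (rule poly_ext) (simp add: poly_pcompose poly_lin_poly g[unfolded E_lin F_def])
    hence "pderiv (lin_poly E_coeff (Suc (2 * e))) = pderiv (pcompose (lin_poly g (Suc e)) (lin_poly b (Suc e)))"
      by simp
    hence "a e = g 0 * b 0" by (simp add: pderiv_pcompose pderiv_lin_poly E_coeff_0)
    thus ?thesis using b(2) by (simp add: field_simps)
  qed
  \<comment> \<open>The pairing with \<open>y\<close> is \<open>N \<circ> F\<close>, and by
    \<open>w_telescope\<close> the polynomials \<open>N ^ p - N\<close> and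
    \<open>y ^ (p ^ e) * g\<close> have equal coefficients. Raising the coefficient at
    \<open>j\<close> to the power \<open>p ^ (e - j)\<close> makes the contributions of
    \<open>N ^ p\<close> and of \<open>N\<close> cancel in the sum.\<close>
  have ann: "(\<Sum>j\<le>e. (y ^ (p ^ e) * g j) ^ (p ^ (e - j))) = 0" if y: "y \<in> Abar" for y
  proof -
    obtain c where c: "\<And>x. w x y = lin p c (2 * e) x" using w_lin by blast
    obtain N where N: "\<And>x. w x y = lin p N e (F x)"
      using factor[of c e] w_Abar[OF _ y] c by (auto simp: mult_2)
    define N1 N2 where "N1 = (\<lambda>j. if j \<ge> 1 then N (j - 1) ^ p else 0)" and "N2 = (\<lambda>j. if j < e then N j else 0)"
    have "lin p (\<lambda>j. N1 j - N2 j) (Suc e) z = lin p (\<lambda>j. y ^ (p ^ e) * g j) (Suc e) z" for z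
    proof -
      obtain x where x: "F x = z" using F_surj by blast
      have "lin p N1 (Suc e) z = lin p N e z ^ p"
        using lin_frob[of N e z 1] unfolding lin_def by (subst sum.lessThan_Suc_shift) (simp add: N1_def)
      moreover have "lin p N2 (Suc e) z = lin p N e z" by (simp add: lin_def N2_def)
      moreover have "lin p (\<lambda>j. N1 j - N2 j) (Suc e) z = lin p N1 (Suc e) z - lin p N2 (Suc e) z"
        by (simp only: lin_def left_diff_distrib sum_subtractf)
      moreover have "lin p (\<lambda>j. y ^ (p ^ e) * g j) (Suc e) z = y ^ (p ^ e) * E x"
        by (simp only: g x lin_def sum_distrib_left mult.assoc)
      ultimately show ?thesis using w_telescope[of y x] y Abar_sub_V N[of x] x by auto
    qed
    hence "y ^ (p ^ e) * g j = N1 j - N2 j" if "j \<le> e" for j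
      using lin_eqD[of "\<lambda>j. N1 j - N2 j" "Suc e" "\<lambda>j. y ^ (p ^ e) * g j" j] that by simp
    hence "(\<Sum>j\<le>e. (y ^ (p ^ e) * g j) ^ (p ^ (e - j))) = (\<Sum>j\<le>e. N1 j ^ (p ^ (e - j))) - (\<Sum>j\<le>e. N2 j ^ (p ^ (e - j)))"
      by (simp add: frob_diff sum_subtractf)
    also have "(\<Sum>j\<le>e. N1 j ^ (p ^ (e - j))) = (\<Sum>j<e. N j ^ (p ^ (e - j)))"
    proof -
      have "(N j ^ p) ^ (p ^ (e - Suc j)) = N j ^ (p ^ (e - j))" if "j < e" for j
        using that by (metis Suc_diff_Suc power_Suc power_mult)
      thus ?thesis
        by (simp only: lessThan_Suc_atMost[symmetric] sum.lessThan_Suc_shift) (simp add: N1_def zero_power)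
    qed
    also have "(\<Sum>j\<le>e. N2 j ^ (p ^ (e - j))) = (\<Sum>j<e. N j ^ (p ^ (e - j)))"
      by (simp only: lessThan_Suc_atMost[symmetric]) (simp add: N2_def)
    finally show ?thesis by simp
  qed
  \<comment> \<open>Taking roots presents the relation \<open>ann\<close> as the
    \<open>p ^ e\<close>-th power of an additive polynomial \<open>h\<close> in \<open>y\<close>. It
    vanishes on \<open>Abar\<close>, hence is a multiple of \<open>F\<close>, and this determines
    all \<open>g j\<close>.\<close>
  have "\<exists>h. h ^ (p ^ e) = g (e - i) ^ (p ^ i)" for i using frob_surj by blast
  then obtain h where h: "\<And>i. h i ^ (p ^ e) = g (e - i) ^ (p ^ i)" by metis
  have h0: "lin p h (Suc e) y = 0" if y: "y \<in> Abar" for y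
  proof -
    have "lin p h (Suc e) y ^ (p ^ e) = (\<Sum>i\<le>e. g (e - i) ^ (p ^ i) * y ^ (p ^ (i + e)))"
      by (simp only: lin_frob h lessThan_Suc_atMost)
    also have "\<dots> = (\<Sum>j\<le>e. (y ^ (p ^ e) * g j) ^ (p ^ (e - j)))"
      by (rule sum.reindex_bij_witness[of _ "\<lambda>i. e - i" "\<lambda>i. e - i"])
         (auto simp: power_mult_distrib power_add mult.commute simp flip: power_mult)
    finally show ?thesis using ann[OF y] by simp
  qed
  have hb: "h i = h e * b i" if "i \<le> e" for i
  proof (cases "i = e")
    case False
    have "lin p (\<lambda>i. h i - h e * b i) e y = 0" if "y \<in> Abar" for y
    proof -
      have "lin p h (Suc e) y - h e * lin p b (Suc e) y = 0" using h0 b(3) that by simp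
      moreover have "lin p h (Suc e) y - h e * lin p b (Suc e) y = lin p (\<lambda>i. h i - h e * b i) (Suc e) y"
        by (simp only: lin_def sum_distrib_left sum_subtractf left_diff_distrib mult.assoc)
      ultimately show ?thesis using b(1) by (simp add: lin_def)
    qed
    from lin_zero[where c = "\<lambda>i. h i - h e * b i" and i = i, OF this] show ?thesis
      using False that card_Abar by simp
  qed (simp add: b)
  have gj: "g j = (a e / b 0 * b (e - j)) ^ (p ^ j)" if "j \<le> e" for j
  proof -
    have he: "h e ^ (p ^ e) = (a e / b 0) ^ (p ^ e)" using h[of e] g0 by simp
    have "g j ^ (p ^ (e - j)) = h (e - j) ^ (p ^ e)" using h[of "e - j"] that by simp
    also have "\<dots> = (a e / b 0 * b (e - j)) ^ (p ^ e)"
      using hb[of "e - j"] he by (simp only: power_mult_distrib diff_le_self)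
    also have "\<dots> = ((a e / b 0 * b (e - j)) ^ (p ^ j)) ^ (p ^ (e - j))"
      using that by (simp flip: power_mult power_add)
    finally show ?thesis by (simp add: frob_inj)
  qed
  have "E x = (\<Sum>j\<le>e. g j * F x ^ (p ^ j))"
    by (simp only: g lin_def lessThan_Suc_atMost)
  also have "\<dots> = (\<Sum>j\<le>e. (a e / b 0 * b (e - j) * F x) ^ (p ^ j))"
    by (intro sum.cong) (auto simp only: atMost_iff gj power_mult_distrib)
  finally show ?thesis by (simp add: F_def)
qed

lemma V_subset_imp_condition_star:
  assumes V: "V \<subseteq> Fq (p ^ n)"
  shows "condition_star p n e a A"
  unfolding condition_star_def
proof (intro ballI impI)
  fix l :: 'a assume l: "l \<in> Fq (p ^ n)" and perp: "\<forall>t. poly (a_A p (p ^ n) A) t = 0 \<longrightarrow> trace_Fq p n (l * t) = 0"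
  obtain b where b: "b e = 1" "b 0 \<noteq> 0" "\<And>i. i \<le> e \<Longrightarrow> b i \<in> Fq (p ^ n)"
    "F_A A = lin_poly b (Suc e)" "\<And>x. lin p b (Suc e) x = 0 \<longleftrightarrow> x \<in> Abar"
    using obtain_F_A by blast
  define F where "F = lin p b (Suc e)"
  have polyF: "poly (F_A A) x = F x" for x by (simp add: b(4) F_def poly_lin_poly)
  have perpF: "trace_Fq p n (l * F z) = 0" if "z \<in> Fq (p ^ n)" for z
    using perp a_A_spec[OF that] by (simp add: polyF)
  \<comment> \<open>The trace adjoint of \<open>F\<close> applied to \<open>l\<close>, with each
    summand twisted so that all share the factor \<open>z ^ (p ^ e)\<close>; negative powers of
    Frobenius are thus avoided.\<close>
  define \<mu> where "\<mu> = (\<Sum>i\<le>e. (l * b i) ^ (p ^ (e - i)))"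
  have \<mu>K: "\<mu> \<in> Fq (p ^ n)" unfolding \<mu>_def using l b(3) by (intro Fq_closed) auto
  have \<mu>: "trace_Fq p n (\<mu> * z ^ (p ^ e)) = 0" if z: "z \<in> Fq (p ^ n)" for z
  proof -
    have "trace_Fq p n (l * F z) = (\<Sum>i\<le>e. trace_Fq p n (l * b i * z ^ (p ^ i)))"
      unfolding F_def lin_def lessThan_Suc_atMost sum_distrib_left trace_sum by (simp add: mult.assoc)
    also have "\<dots> = (\<Sum>i\<le>e. trace_Fq p n ((l * b i) ^ (p ^ (e - i)) * z ^ (p ^ e)))"
    proof (rule sum.cong)
      fix i assume i: "i \<in> {..e}"
      have "l * b i * z ^ (p ^ i) \<in> Fq (p ^ n)" using i l b(3) z by (intro Fq_closed) auto
      from trace_frob[OF this, of "e - i"]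
      show "trace_Fq p n (l * b i * z ^ (p ^ i)) = trace_Fq p n ((l * b i) ^ (p ^ (e - i)) * z ^ (p ^ e))"
        using i by (simp add: power_mult_distrib flip: power_mult power_add)
    qed simp
    also have "\<dots> = trace_Fq p n (\<mu> * z ^ (p ^ e))"
      by (simp add: \<mu>_def sum_distrib_right trace_sum)
    finally show ?thesis using perpF[OF z] by simp
  qed
  \<comment> \<open>Powers \<open>z ^ (p ^ e)\<close> exhaust the finite field, so a nonzero
    \<open>\<mu>\<close> would have a multiple \<open>\<mu> * z ^ (p ^ e)\<close> of nonzero
    trace.\<close>
  have \<mu>0: "\<mu> = 0"
  proof (rule ccontr)
    assume nz: "\<mu> \<noteq> 0"
    obtain t :: 'a where t: "t \<in> Fq (p ^ n)" "trace_Fq p n t \<noteq> 0" using trace_nonzero[OF n_pos] by blast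
    obtain z where z: "z ^ (p ^ e) = t / \<mu>" using frob_surj by blast
    have "(z ^ (p ^ n)) ^ (p ^ e) = (z ^ (p ^ e)) ^ (p ^ n)" by (metis mult.commute power_mult)
    also have "\<dots> = z ^ (p ^ e)" using Fq_divide[OF t(1) \<mu>K] z by (simp add: Fq_def)
    finally have "z \<in> Fq (p ^ n)" using frob_inj by (simp add: Fq_def)
    from \<mu>[OF this] show False using z t nz by simp
  qed
  define g where "g = a e / b 0"
  have g0: "g \<noteq> 0" using ae_nz b(2) by (simp add: g_def)
  \<comment> \<open>Chosen so that the factor \<open>a e / b 0\<close> in \<open>E_factor\<close>
    cancels and \<open>E z\<close> becomes \<open>\<mu>\<close>.\<close>
  obtain z where z: "F z = l / g" using lin_surj[of b e "Suc e" "l / g"] b(1) unfolding F_def by auto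
  have "E z = (\<Sum>j\<le>e. (l * b (e - j)) ^ (p ^ j))"
    using E_factor[OF b(1,2,5), of z] z g0 by (simp add: mult.commute flip: F_def g_def)
  also have "\<dots> = \<mu>" unfolding \<mu>_def
    by (rule sum.reindex_bij_witness[of _ "\<lambda>i. e - i" "\<lambda>i. e - i"]) auto
  finally have "z \<in> V" using \<mu>0 by (simp add: V_R_def)
  hence "trace_Fq p n (l * F z) = 0" using V perpF by blast
  hence tr: "trace_Fq p n (l ^ 2 / g) = 0" by (simp add: z power2_eq_square)
  \<comment> \<open>Up to sign \<open>c_A\<close> is \<open>g / 2\<close>; the factor that separates
    it from \<open>g\<close> lies in \<open>Fq p\<close> and passes through the trace.\<close>
  have "inverse (c_A e a A) * l ^ 2 = (of_int (2 * (- 1) ^ e)) * (l ^ 2 / g)"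
  proof -
    have "coeff (F_A A) 1 = b 0" using coeff_lin_poly[of b "Suc e" 0] b(4) by simp
    hence c: "c_A e a A = (- 1) ^ e * g / 2" by (simp add: c_A_def g_def)
    have "(- 1 :: 'a) ^ e = 1 \<or> (- 1 :: 'a) ^ e = - 1" by (metis neg_one_even_power neg_one_odd_power)
    thus ?thesis unfolding c using two_nz g0 by (elim disjE) (simp_all add: field_simps)
  qed
  moreover have "(of_int (2 * (- 1) ^ e) :: 'a) \<in> Fq p"
    using Fq_of_int[of "2 * (- 1) ^ e" 1] by simp
  ultimately show "trace_Fq p n (inverse (c_A e a A) * l\<^sup>2) = 0"
    using tr by (simp only: trace_scale mult_zero_right)
qed

end

section \<open>Valuation rings\<close>

lemma ring_of_type_algebra_simps:
  fixes x y :: "'b::field"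
  shows "x \<otimes>\<^bsub>ring_of_type_algebra\<^esub> y = x * y" "x \<oplus>\<^bsub>ring_of_type_algebra\<^esub> y = x + y"
    "\<one>\<^bsub>ring_of_type_algebra\<^esub> = (1 :: 'b)" "\<zero>\<^bsub>ring_of_type_algebra\<^esub> = (0 :: 'b)"
    "carrier (ring_of_type_algebra :: 'b ring) = UNIV"
  by (simp_all add: ring_of_type_algebra_def)

lemma a_inv_ring_of_type_algebra: "\<ominus>\<^bsub>ring_of_type_algebra\<^esub> x = - (x :: 'b::field)"
proof -
  interpret field "ring_of_type_algebra :: 'b ring" by (rule field_from_type_algebra)
  show ?thesis by (rule minus_equality) (auto simp: ring_of_type_algebra_simps)
qed

lemma m_inv_ring_of_type_algebra: "x \<noteq> 0 \<Longrightarrow> inv\<^bsub>ring_of_type_algebra\<^esub> x = inverse (x :: 'b::field)"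
proof -
  assume "x \<noteq> 0"
  interpret field "ring_of_type_algebra :: 'b ring" by (rule field_from_type_algebra)
  show ?thesis by (rule comm_inv_char) (use \<open>x \<noteq> 0\<close> in \<open>auto simp: ring_of_type_algebra_simps\<close>)
qed

definition is_subring :: "'b::field set \<Rightarrow> bool" where
  "is_subring S \<longleftrightarrow> 1 \<in> S \<and> (\<forall>x\<in>S. - x \<in> S) \<and> (\<forall>x\<in>S. \<forall>y\<in>S. x + y \<in> S \<and> x * y \<in> S)"

lemma subring_iff_is_subring: "subring S (ring_of_type_algebra :: 'b::field ring) \<longleftrightarrow> is_subring S"
proof
  assume S: "subring S (ring_of_type_algebra :: 'b ring)"
  note s = subringE(3,5,6,7)[OF S, unfolded ring_of_type_algebra_simps a_inv_ring_of_type_algebra]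
  show "is_subring S" unfolding is_subring_def by (intro conjI ballI s)
next
  interpret field "ring_of_type_algebra :: 'b ring" by (rule field_from_type_algebra)
  assume "is_subring S"
  thus "subring S (ring_of_type_algebra :: 'b ring)"
    by (intro subringI) (auto simp: is_subring_def ring_of_type_algebra_simps a_inv_ring_of_type_algebra)
qed

lemma is_subring_closed:
  assumes "is_subring S"
  shows "1 \<in> S" "0 \<in> S" "x \<in> S \<Longrightarrow> - x \<in> S" "x \<in> S \<Longrightarrow> y \<in> S \<Longrightarrow> x + y \<in> S"
    "x \<in> S \<Longrightarrow> y \<in> S \<Longrightarrow> x * y \<in> S" "x \<in> S \<Longrightarrow> y \<in> S \<Longrightarrow> x - y \<in> S" "x \<in> S \<Longrightarrow> x ^ k \<in> S"
proof -
  show 1: "1 \<in> S" "x \<in> S \<Longrightarrow> - x \<in> S" "x \<in> S \<Longrightarrow> y \<in> S \<Longrightarrow> x + y \<in> S" "x \<in> S \<Longrightarrow> y \<in> S \<Longrightarrow> x * y \<in> S" for x y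
    using assms by (auto simp: is_subring_def)
  show "0 \<in> S" using 1(3)[OF 1(1) 1(2)[OF 1(1)]] by simp
  show "x \<in> S \<Longrightarrow> y \<in> S \<Longrightarrow> x - y \<in> S" using 1(3)[of x "- y"] 1(2)[of y] by simp
  show "x \<in> S \<Longrightarrow> x ^ k \<in> S" by (induction k) (auto intro: 1)
qed

lemma is_subring_sum: "is_subring S \<Longrightarrow> (\<And>i. i \<in> I \<Longrightarrow> g i \<in> S) \<Longrightarrow> sum g I \<in> S"
  by (induction I rule: infinite_finite_induct) (auto intro: is_subring_closed)

definition adjoin :: "'b::field set \<Rightarrow> 'b \<Rightarrow> 'b set" where
  "adjoin S z = {poly f z | f. \<forall>i. coeff f i \<in> S}"

lemma adjoin:
  assumes S: "is_subring S"
  shows "is_subring (adjoin S z)" "S \<subseteq> adjoin S z" "z \<in> adjoin S z"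
proof -
  note c = is_subring_closed[OF S]
  have const: "poly [:u:] z \<in> adjoin S z" if "u \<in> S" for u
    unfolding adjoin_def using that c(2) by (auto simp: coeff_pCons split: nat.split simp del: poly_pCons)
  show "S \<subseteq> adjoin S z" using const by auto
  have "poly [:0, 1:] z \<in> adjoin S z"
    unfolding adjoin_def using c(1,2) by (auto simp: coeff_pCons split: nat.split simp del: poly_pCons)
  thus "z \<in> adjoin S z" by simp
  show "is_subring (adjoin S z)" unfolding is_subring_def
  proof (intro conjI ballI)
    show "1 \<in> adjoin S z" using const[OF c(1)] by simp
    fix x assume "x \<in> adjoin S z"
    then obtain f where f: "x = poly f z" "\<forall>i. coeff f i \<in> S" by (auto simp: adjoin_def)
    show "- x \<in> adjoin S z" unfolding adjoin_def using f c(3) by (auto intro!: exI[of _ "- f"])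
    fix y assume "y \<in> adjoin S z"
    then obtain g where g: "y = poly g z" "\<forall>i. coeff g i \<in> S" by (auto simp: adjoin_def)
    show "x + y \<in> adjoin S z" unfolding adjoin_def using f g c(4) by (auto intro!: exI[of _ "f + g"])
    show "x * y \<in> adjoin S z" unfolding adjoin_def using f g c(5)
      by (auto intro!: exI[of _ "f * g"] is_subring_sum[OF S] simp: coeff_mult)
  qed
qed

text \<open>Chevalley's extension theorem: a subring maximal among those not containing \<open>t\<close> is a
  valuation ring.\<close>

theorem exists_valuation_ring:
  fixes S :: "'b::field set"
  assumes S: "is_subring S" and t: "t \<notin> S" "inverse t \<in> S"
  obtains M where "is_subring M" "S \<subseteq> M" "t \<notin> M" "\<And>z. z \<noteq> 0 \<Longrightarrow> z \<in> M \<or> inverse z \<in> M"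
proof -
  have t0: "t \<noteq> 0" using t is_subring_closed[OF S] by auto
  let ?A = "{M. is_subring M \<and> S \<subseteq> M \<and> t \<notin> M}"
  have "\<exists>M\<in>?A. \<forall>M'\<in>?A. M \<subseteq> M' \<longrightarrow> M' = M"
  proof (rule subset_Zorn_nonempty)
    show "?A \<noteq> {}" using S t by blast
    fix C assume C: "C \<noteq> {}" "subset.chain ?A C"
    hence ch: "\<And>M. M \<in> C \<Longrightarrow> M \<in> ?A" "\<And>M M'. M \<in> C \<Longrightarrow> M' \<in> C \<Longrightarrow> M \<subseteq> M' \<or> M' \<subseteq> M"
      unfolding subset.chain_def by blast+
    have "is_subring (\<Union>C)" unfolding is_subring_def
    proof (intro conjI ballI)
      show "1 \<in> \<Union>C" using C(1) ch(1) is_subring_closed(1) by blast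
      fix x assume "x \<in> \<Union>C"
      then obtain M where M: "M \<in> C" "x \<in> M" by blast
      thus "- x \<in> \<Union>C" using ch(1) is_subring_closed(3) by blast
      fix y assume "y \<in> \<Union>C"
      then obtain M' where "M' \<in> C" "y \<in> M'" by blast
      then obtain L where "L \<in> C" "x \<in> L" "y \<in> L" using M ch(2) by blast
      thus "x + y \<in> \<Union>C" "x * y \<in> \<Union>C" using ch(1) is_subring_closed(4,5) by blast+
    qed
    thus "\<Union>C \<in> ?A" using C(1) ch(1) by blast
  qed
  then obtain M where M: "is_subring M" "S \<subseteq> M" "t \<notin> M"
    and max: "\<And>M'. is_subring M' \<Longrightarrow> t \<notin> M' \<Longrightarrow> M \<subseteq> M' \<Longrightarrow> M' = M"
    by (smt (verit) mem_Collect_eq subset_trans)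
  note c = is_subring_closed[OF M(1)]
  have sM: "inverse t \<in> M" using t M by blast
  \<comment> \<open>By maximality, every ring properly containing \<open>M\<close> contains
    \<open>t\<close>.\<close>
  have adj: "t \<in> adjoin M z" if "z \<notin> M" for z
    using max[OF adjoin(1)[OF M(1), of z]] adjoin(2,3)[OF M(1), of z] that by blast
  have u0: "1 - inverse t * b \<noteq> 0" if "b \<in> M" for b
  proof
    assume "1 - inverse t * b = 0"
    hence "t * (inverse t * b) = t" by simp
    hence "b = t" using t0 by (simp flip: mult.assoc)
    thus False using that M(3) by simp
  qed
  \<comment> \<open>If the inverse were missing, \<open>t\<close> would be a polynomial in it.
    Clearing denominators puts some \<open>t * ?u ^ k\<close> into \<open>M\<close>, yet this
    element differs from \<open>t\<close> by an element of \<open>M\<close>.\<close>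
  have unit: "inverse (1 - inverse t * b) \<in> M" if b: "b \<in> M" for b
  proof (rule ccontr)
    let ?u = "1 - inverse t * b"
    assume "inverse ?u \<notin> M"
    from adj[OF this] obtain f where "t = poly f (inverse ?u)" and fM: "\<forall>i. coeff f i \<in> M"
      unfolding adjoin_def by auto
    note f = this(1)[symmetric] fM
    have u0: "?u \<noteq> 0" by (rule u0[OF b])
    have uM: "?u \<in> M" by (rule c(6)[OF c(1) c(5)[OF sM b]])
    have "poly f (inverse ?u) * ?u ^ degree f = (\<Sum>i\<le>degree f. coeff f i * ?u ^ (degree f - i))"
      unfolding poly_altdef sum_distrib_right
    proof (rule sum.cong)
      fix i assume "i \<in> {..degree f}"
      moreover have "c * inverse v ^ i * v ^ k = c * v ^ (k - i)" if "v \<noteq> 0" "i \<le> k" for c v :: 'b and k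
        using that by (simp add: power_diff field_simps)
      ultimately show "coeff f i * inverse ?u ^ i * ?u ^ degree f = coeff f i * ?u ^ (degree f - i)"
        using u0 by blast
    qed simp
    moreover have "(\<Sum>i\<le>degree f. coeff f i * ?u ^ (degree f - i)) \<in> M"
      using f(2) uM by (intro is_subring_sum[OF M(1)] c(5,7)) auto
    ultimately have 1: "t * ?u ^ degree f \<in> M" unfolding f(1) by metis
    have "\<exists>b'\<in>M. t * ?u ^ k = t - b'" for k
    proof (induction k)
      case (Suc k)
      then obtain b' where b': "b' \<in> M" "t * ?u ^ k = t - b'" by blast
      have "t * ?u ^ Suc k = (t * ?u ^ k) * ?u" by simp
      also have "\<dots> = t - (b' + b - inverse t * b * b')" unfolding b'(2)
        using t0 by (simp add: left_diff_distrib right_diff_distrib flip: mult.assoc)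
      finally show ?case using c(6)[OF c(4)[OF b'(1) b] c(5)[OF c(5)[OF sM b] b'(1)]] by (rule rev_bexI[rotated])
    qed (use c in \<open>auto intro!: bexI[of _ 0]\<close>)
    then obtain b' where "b' \<in> M" "t * ?u ^ degree f = t - b'" by blast
    hence "t \<in> M" using c(4)[OF 1, of b'] by simp
    thus False using M by simp
  qed
  \<comment> \<open>Dividing \<open>t = g (1 / z)\<close> by \<open>t\<close> isolates the unit
    \<open>?u\<close>, so \<open>z ^ ?n\<close> is an \<open>M\<close>-combination of lower powers
    of \<open>z\<close>. Replacing the leading power in \<open>f\<close> contradicts the minimal
    degree.\<close>
  have reduce: False
    if z: "z \<noteq> 0" and f: "t = poly f z" "\<forall>i. coeff f i \<in> M"
      and min: "\<And>f'. t = poly f' z \<Longrightarrow> \<forall>i. coeff f' i \<in> M \<Longrightarrow> degree f \<le> degree f'"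
      and g: "t = poly g (inverse z)" "\<forall>i. coeff g i \<in> M" and deg: "degree g \<le> degree f" for z f g
  proof -
    let ?n = "degree f" and ?u = "1 - inverse t * coeff g 0"
    define v where "v = inverse ?u * inverse t"
    have vM: "v \<in> M" unfolding v_def using unit[of "coeff g 0"] g(2) sM c(5) by blast
    have npos: "?n > 0"
    proof (rule ccontr)
      assume "\<not> ?n > 0"
      hence "poly f z = coeff f 0" by (auto elim!: degree_eq_zeroE)
      thus False using f M(3) by metis
    qed
    have gpos: "degree g > 0"
    proof (rule ccontr)
      assume "\<not> degree g > 0"
      hence "poly g (inverse z) = coeff g 0" by (auto elim!: degree_eq_zeroE)
      thus False using g M(3) by metis
    qed
    have u0: "?u \<noteq> 0" using g(2) by (intro u0) simp
    define h where "h = (\<Sum>j\<in>{1..degree g}. monom (v * coeff g j) (?n - j))"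
    have hM: "coeff h i \<in> M" for i
      unfolding h_def coeff_sum coeff_monom using c g(2) vM by (intro is_subring_sum[OF M(1)]) auto
    have "t = coeff g 0 + (\<Sum>j\<in>{1..degree g}. coeff g j * inverse z ^ j)"
      using g(1) by (simp add: poly_altdef atMost_atLeast0 sum.atLeast_Suc_atMost)
    hence "inverse t * (\<Sum>j\<in>{1..degree g}. coeff g j * inverse z ^ j) = inverse t * (t - coeff g 0)"
      by (metis add_diff_cancel_left')
    hence ueq: "inverse t * (\<Sum>j\<in>{1..degree g}. coeff g j * inverse z ^ j) = ?u"
      using t0 by (simp add: right_diff_distrib)
    hence one: "1 = v * (\<Sum>j\<in>{1..degree g}. coeff g j * inverse z ^ j)"
      unfolding v_def mult.assoc ueq using u0 by simp
    have hz: "poly h z = z ^ ?n"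
    proof -
      have "poly h z = (\<Sum>j\<in>{1..degree g}. v * (coeff g j * inverse z ^ j) * z ^ ?n)"
        unfolding h_def poly_sum poly_monom
      proof (rule sum.cong)
        fix j assume "j \<in> {1..degree g}"
        hence "z ^ ?n = z ^ j * z ^ (?n - j)" using deg by (simp flip: power_add)
        thus "v * coeff g j * z ^ (?n - j) = v * (coeff g j * inverse z ^ j) * z ^ ?n"
          using z by (simp add: field_simps)
      qed simp
      also have "\<dots> = z ^ ?n" using one by (simp flip: sum_distrib_left sum_distrib_right)
      finally show ?thesis .
    qed
    define f' where "f' = f - monom (lead_coeff f) ?n + smult (lead_coeff f) h"
    have "poly f' z = t" by (simp add: f'_def poly_monom hz f(1)[symmetric])
    moreover have "coeff f' i \<in> M" for i
      unfolding f'_def using f(2) hM c by (auto simp: coeff_monom)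
    moreover have "degree f' < ?n"
    proof -
      have "coeff h i = 0" if "i \<ge> ?n" for i
        unfolding h_def coeff_sum coeff_monom using that npos by (intro sum.neutral) auto
      hence "\<forall>i\<ge>?n. coeff f' i = 0" by (auto simp: f'_def coeff_monom le_less coeff_eq_0)
      thus ?thesis using npos by (metis coeff_0 degree_0 leading_coeff_0_iff linorder_not_le)
    qed
    ultimately show False using min[of f'] by auto
  qed
  have minpoly: "\<exists>f. t = poly f z \<and> (\<forall>i. coeff f i \<in> M) \<and>
      (\<forall>f'. t = poly f' z \<longrightarrow> (\<forall>i. coeff f' i \<in> M) \<longrightarrow> degree f \<le> degree f')" if "z \<notin> M" for z
  proof -
    have "\<exists>f. t = poly f z \<and> (\<forall>i. coeff f i \<in> M)" using adj[OF that] by (auto simp: adjoin_def)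
    from ex_has_least_nat[of "\<lambda>f. t = poly f z \<and> (\<forall>i. coeff f i \<in> M)" _ degree] this
    show ?thesis by blast
  qed
  have "z \<in> M \<or> inverse z \<in> M" if z: "z \<noteq> 0" for z
  proof (rule ccontr)
    assume "\<not> (z \<in> M \<or> inverse z \<in> M)"
    then obtain f g where f: "t = poly f z" "\<forall>i. coeff f i \<in> M"
       "\<And>f'. t = poly f' z \<Longrightarrow> \<forall>i. coeff f' i \<in> M \<Longrightarrow> degree f \<le> degree f'"
      and g: "t = poly g (inverse z)" "\<forall>i. coeff g i \<in> M"
       "\<And>f'. t = poly f' (inverse z) \<Longrightarrow> \<forall>i. coeff f' i \<in> M \<Longrightarrow> degree g \<le> degree f'"
      using minpoly[of z] minpoly[of "inverse z"] by blast
    show False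
    proof (cases "degree g \<le> degree f")
      case True
      thus False using reduce[OF z f g(1,2)] by blast
    next
      case False
      thus False using reduce[of "inverse z" g f] g f(1,2) z by simp
    qed
  qed
  thus thesis using that M by blast
qed

text \<open>Relative to a field \<open>K\<close>, in order to cover both the function field and the
  whole algebraic closure.\<close>

locale valuation_subring =
  fixes K V :: "'b::field set"
  assumes subring_K: "is_subring K" and inverse_K: "\<And>x. x \<in> K \<Longrightarrow> inverse x \<in> K"
    and subring_V: "is_subring V" and V_sub_K: "V \<subseteq> K"
    and val: "\<And>z. z \<in> K \<Longrightarrow> z \<noteq> 0 \<Longrightarrow> z \<in> V \<or> inverse z \<in> V"
begin

abbreviation "\<mm> \<equiv> place_ideal V"

lemmas K_closed = is_subring_closed[OF subring_K]
lemmas V_closed = is_subring_closed[OF subring_V]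

lemma K_divide: "x \<in> K \<Longrightarrow> y \<in> K \<Longrightarrow> x / y \<in> K"
  using K_closed(5) inverse_K by (simp add: divide_inverse)

lemma m_sub_V: "x \<in> \<mm> \<Longrightarrow> x \<in> V" by (simp add: place_ideal_def)
lemma m_sub_K: "x \<in> \<mm> \<Longrightarrow> x \<in> K" using m_sub_V V_sub_K by blast
lemma zero_in_m [simp]: "0 \<in> \<mm>" using V_closed by (simp add: place_ideal_def)
lemma one_notin_m [simp]: "1 \<notin> \<mm>" using V_closed by (simp add: place_ideal_def)
lemma not_in_V: "z \<in> K \<Longrightarrow> z \<notin> V \<Longrightarrow> inverse z \<in> \<mm>"
  using val[of z] V_closed by (auto simp: place_ideal_def)
lemma unitI: "x \<in> V \<Longrightarrow> x \<notin> \<mm> \<Longrightarrow> x \<noteq> 0 \<and> inverse x \<in> V"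
  by (auto simp: place_ideal_def)

lemma m_mult: "x \<in> \<mm> \<Longrightarrow> v \<in> V \<Longrightarrow> x * v \<in> \<mm>"
proof -
  assume x: "x \<in> \<mm>" and v: "v \<in> V"
  have "inverse (x * v) \<notin> V" if "x * v \<noteq> 0"
  proof
    assume "inverse (x * v) \<in> V"
    hence "v * inverse (x * v) \<in> V" using V_closed v by blast
    moreover have "v * inverse (x * v) = inverse x" using that by (simp add: field_simps)
    ultimately have "inverse x \<in> V" by metis
    thus False using x that by (simp add: place_ideal_def)
  qed
  thus ?thesis using x v V_closed by (auto simp: place_ideal_def)
qed

lemma m_add: "x \<in> \<mm> \<Longrightarrow> y \<in> \<mm> \<Longrightarrow> x + y \<in> \<mm>"
proof -
  have *: "x + y \<in> \<mm>" if x: "x \<in> \<mm>" and y: "y \<in> \<mm>" and q: "x / y \<in> V" and y0: "y \<noteq> 0" for x y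
  proof -
    have "y * (1 + x / y) \<in> \<mm>" using m_mult[OF y] q V_closed by blast
    moreover have "y * (1 + x / y) = x + y" using y0 by (simp add: distrib_left)
    ultimately show ?thesis by metis
  qed
  assume x: "x \<in> \<mm>" and y: "y \<in> \<mm>"
  show ?thesis
  proof (cases "x = 0 \<or> y = 0")
    case False
    hence "x / y \<in> V \<or> y / x \<in> V"
      using val[OF K_divide[OF m_sub_K[OF x] m_sub_K[OF y]]] by auto
    thus ?thesis using *[OF x y] *[OF y x] False by (auto simp: add.commute)
  qed (use x y in auto)
qed

lemma m_minus: "x \<in> \<mm> \<Longrightarrow> - x \<in> \<mm>"
  using m_mult[of x "- 1"] V_closed by simp

lemma m_diff: "x \<in> \<mm> \<Longrightarrow> y \<in> \<mm> \<Longrightarrow> x - y \<in> \<mm>"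
  using m_add[of x "- y"] m_minus by simp

lemma one_plus_m: "x \<in> \<mm> \<Longrightarrow> 1 + x \<noteq> 0 \<and> inverse (1 + x) \<in> V"
proof (rule unitI)
  assume x: "x \<in> \<mm>"
  show "1 + x \<in> V" using x m_sub_V V_closed by blast
  show "1 + x \<notin> \<mm>" using m_diff[OF _ x, of "1 + x"] by auto
qed

text \<open>Allows a statement involving \<open>y\<close> to be deduced from its \<open>p\<close>-th
  power, which is comparable with a power of \<open>xx\<close>.\<close>

lemma m_power_imp: "x ^ k \<in> \<mm> \<Longrightarrow> x \<in> K \<Longrightarrow> x \<in> \<mm>"
proof (rule ccontr)
  assume xk: "x ^ k \<in> \<mm>" and xK: "x \<in> K" and x: "x \<notin> \<mm>"
  hence x0: "x \<noteq> 0" by auto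
  have "inverse x \<in> V" using val[OF xK x0] x x0 by (auto simp: place_ideal_def)
  hence "inverse (x ^ k) \<in> V" using V_closed(7) by (simp add: power_inverse[symmetric])
  thus False using xk x0 by (simp add: place_ideal_def)
qed

lemma m_power: "x \<in> \<mm> \<Longrightarrow> k > 0 \<Longrightarrow> x ^ k \<in> \<mm>"
  using m_mult[of x "x ^ (k - 1)"] m_sub_V V_closed(7) by (cases k) auto

text \<open>\<open>t\<close> is a leading term of \<open>z\<close>: they agree up to a factor
  congruent to 1 modulo the maximal ideal. This takes the place of a numerical valuation.\<close>

definition lead :: "'b \<Rightarrow> 'b \<Rightarrow> bool" where
  "lead z t \<longleftrightarrow> t \<in> K \<and> t \<noteq> 0 \<and> (\<exists>u\<in>\<mm>. z = t * (1 + u))"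

lemma lead_refl: "t \<in> K \<Longrightarrow> t \<noteq> 0 \<Longrightarrow> lead t t"
  unfolding lead_def by (intro conjI bexI[of _ 0]) auto

lemma lead_nonzero: "lead z t \<Longrightarrow> z \<noteq> 0"
  using one_plus_m by (auto simp: lead_def)

lemma lead_mult: "lead z t \<Longrightarrow> lead z' t' \<Longrightarrow> lead (z * z') (t * t')"
proof -
  assume "lead z t" "lead z' t'"
  then obtain u u' where u: "t \<in> K" "t \<noteq> 0" "u \<in> \<mm>" "z = t * (1 + u)" and u': "t' \<in> K" "t' \<noteq> 0" "u' \<in> \<mm>" "z' = t' * (1 + u')"
    by (auto simp: lead_def)
  have "z * z' = (t * t') * (1 + (u + u' + u * u'))"
    unfolding u(4) u'(4) by (simp add: algebra_simps)
  moreover have "u + u' + u * u' \<in> \<mm>"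
    by (rule m_add[OF m_add[OF u(3) u'(3)] m_mult[OF u(3) m_sub_V[OF u'(3)]]])
  ultimately show ?thesis unfolding lead_def
    using u(2) u'(2) K_closed(5)[OF u(1) u'(1)] by (metis mult_eq_0_iff)
qed

text \<open>The strict triangle inequality: a single dominant summand cannot be cancelled.\<close>

lemma lead_sum:
  assumes "finite S" "i0 \<in> S" and lead: "\<And>i. i \<in> S \<Longrightarrow> lead (z i) (t i)"
    and small: "\<And>i. i \<in> S \<Longrightarrow> i \<noteq> i0 \<Longrightarrow> t i / t i0 \<in> \<mm>"
  shows "lead (\<Sum>i\<in>S. z i) (t i0)"
proof -
  have t0: "t i0 \<in> K" "t i0 \<noteq> 0" using lead[OF assms(2)] by (auto simp: lead_def)
  obtain u where u: "u \<in> \<mm>" "z i0 = t i0 * (1 + u)" using lead[OF assms(2)] by (auto simp: lead_def)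
  have zi: "z i / t i0 \<in> \<mm>" if i: "i \<in> S - {i0}" for i
  proof -
    obtain v where v: "v \<in> \<mm>" "z i = t i * (1 + v)" using lead[of i, unfolded lead_def] i by blast
    have "(t i / t i0) * (1 + v) \<in> \<mm>" using small[of i] i v(1) m_mult[of "t i / t i0" "1 + v"] m_sub_V[OF v(1)] V_closed(4)[OF V_closed(1), of v] by blast
    thus ?thesis by (simp add: v(2))
  qed
  have "sum g I \<in> \<mm>" if "\<And>i. i \<in> I \<Longrightarrow> g i \<in> \<mm>" for g :: "'c \<Rightarrow> 'b" and I
    using that by (induction I rule: infinite_finite_induct) (simp_all add: m_add)
  from this[OF zi] have "(\<Sum>i\<in>S - {i0}. z i / t i0) \<in> \<mm>" .
  hence "u + (\<Sum>i\<in>S - {i0}. z i / t i0) \<in> \<mm>" by (rule m_add[OF u(1)])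
  moreover have "(\<Sum>i\<in>S. z i) = t i0 * (1 + (u + (\<Sum>i\<in>S - {i0}. z i / t i0)))"
  proof -
    have "t i0 * (\<Sum>i\<in>S - {i0}. z i / t i0) = (\<Sum>i\<in>S - {i0}. z i)"
      using t0(2) by (simp flip: sum_divide_distrib)
    thus ?thesis unfolding sum.remove[OF assms(1,2)] u(2)
      by (simp only: distrib_left add.assoc mult_1_right)
  qed
  ultimately show ?thesis unfolding lead_def using t0 by blast
qed

lemma lead_divide_in_V: "lead z t \<Longrightarrow> lead z' t' \<Longrightarrow> z / z' \<in> V \<longleftrightarrow> t / t' \<in> V"
proof -
  assume "lead z t" "lead z' t'"
  then obtain u u' where u: "u \<in> \<mm>" "z = t * (1 + u)" and u': "u' \<in> \<mm>" "z' = t' * (1 + u')"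
    by (auto simp: lead_def)
  have V: "1 + u \<in> V" "1 + u' \<in> V" "inverse (1 + u) \<in> V" "inverse (1 + u') \<in> V" "1 + u \<noteq> 0" "1 + u' \<noteq> 0"
    using one_plus_m m_sub_V V_closed u u' by auto
  have "z / z' = t / t' * ((1 + u) * inverse (1 + u'))" "t / t' = z / z' * ((1 + u') * inverse (1 + u))"
  proof -
    have gen: "(t * c) / (t' * d) = t / t' * (c * inverse d)" "t / t' = (t * c) / (t' * d) * (d * inverse c)"
      if "c \<noteq> 0" "d \<noteq> 0" for c d
      using that by (simp_all add: field_simps)
    show "z / z' = t / t' * ((1 + u) * inverse (1 + u'))" "t / t' = z / z' * ((1 + u') * inverse (1 + u))"
      unfolding u(2) u'(2) by (rule gen[OF V(5,6)])+
  qed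
  thus ?thesis using V V_closed(5) by metis
qed

end

section \<open>The function field\<close>

lemma of_poly_simps [simp]:
  "of_poly 0 = 0" "of_poly 1 = 1" "of_poly (f + g) = of_poly f + of_poly g"
  "of_poly (f - g) = of_poly f - of_poly g" "of_poly (- f) = - of_poly f"
  "of_poly (f * g) = of_poly f * of_poly g"
  by (simp_all add: of_poly_def)

lemma of_poly_power [simp]: "of_poly (f ^ k) = of_poly f ^ k"
  by (induction k) auto

lemma of_poly_sum: "of_poly (sum g S) = (\<Sum>i\<in>S. of_poly (g i))"
  by (induction S rule: infinite_finite_induct) auto

lemma of_poly_eq_iff [simp]: "of_poly f = of_poly g \<longleftrightarrow> f = g"
  by (simp add: of_poly_def)

lemma of_poly_eq_0_iff [simp]: "of_poly f = 0 \<longleftrightarrow> f = 0"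
  by (simp add: of_poly_def)

definition cst :: "'a::field \<Rightarrow> 'a poly fract alg_closure" where "cst c = of_poly [:c:]"
definition xx :: "'a::field poly fract alg_closure" where "xx = of_poly (monom 1 1)"

lemma cst_simps [simp]:
  "cst 0 = 0" "cst 1 = 1" "cst (c + d) = cst c + cst d" "cst (c * d) = cst c * cst d"
  "cst (- c) = - cst c" "cst (c - d) = cst c - cst d"
proof -
  show "cst 0 = 0" "cst 1 = 1" by (simp_all add: cst_def flip: one_pCons)
  show "cst (c + d) = cst c + cst d" "cst (- c) = - cst c" "cst (c - d) = cst c - cst d"
    by (simp_all add: cst_def flip: of_poly_simps)
  show "cst (c * d) = cst c * cst d" by (simp add: cst_def flip: of_poly_simps)
qed

lemma cst_power [simp]: "cst (c ^ k) = cst c ^ k"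
  by (induction k) auto

lemma cst_eq_iff [simp]: "cst c = cst d \<longleftrightarrow> c = d" by (simp add: cst_def)
lemma cst_eq_0_iff [simp]: "cst c = 0 \<longleftrightarrow> c = 0" by (simp add: cst_def)

lemma cst_inverse: "cst (inverse c) = inverse (cst c)"
proof (cases "c = 0")
  case False
  have "cst c * cst (inverse c) = 1" using False by (simp flip: cst_simps(4))
  thus ?thesis by (metis inverse_unique)
qed simp

lemma xx_nonzero [simp]: "xx \<noteq> 0" by (simp add: xx_def)

lemma of_poly_monom: "of_poly (monom c j) = cst c * xx ^ j"
proof -
  have "monom c j = [:c:] * monom 1 1 ^ j" by (simp add: monom_power smult_monom)
  thus ?thesis by (simp only: cst_def xx_def of_poly_simps(6) of_poly_power)
qed

lemma of_poly_altdef: "of_poly g = (\<Sum>j\<le>degree g. cst (coeff g j) * xx ^ j)"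
  by (subst poly_as_sum_of_monoms[symmetric]) (simp add: of_poly_sum of_poly_monom)

lemma constants_eq: "constants q = cst ` Fq q"
  by (simp add: constants_def cst_def)

definition coeffs_in :: "'a::field set \<Rightarrow> 'a poly \<Rightarrow> bool" where
  "coeffs_in k g \<longleftrightarrow> (\<forall>i. coeff g i \<in> k)"

lemma coeffs_in_add: "is_subring k \<Longrightarrow> coeffs_in k g \<Longrightarrow> coeffs_in k h \<Longrightarrow> coeffs_in k (g + h)"
  by (simp add: coeffs_in_def is_subring_closed)
lemma coeffs_in_mult: "is_subring k \<Longrightarrow> coeffs_in k g \<Longrightarrow> coeffs_in k h \<Longrightarrow> coeffs_in k (g * h)"
  by (auto simp: coeffs_in_def coeff_mult intro!: is_subring_sum is_subring_closed(5))
lemma coeffs_in_monom: "is_subring k \<Longrightarrow> c \<in> k \<Longrightarrow> coeffs_in k (monom c i)"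
  by (simp add: coeffs_in_def is_subring_closed)
lemma coeffs_in_0: "is_subring k \<Longrightarrow> coeffs_in k 0"
  by (simp add: coeffs_in_def is_subring_closed)
lemma coeffs_in_const: "is_subring k \<Longrightarrow> c \<in> k \<Longrightarrow> coeffs_in k [:c:]"
  using coeffs_in_monom[of k c 0] by (simp add: monom_0)
lemma coeffs_in_poly: "is_subring k \<Longrightarrow> coeffs_in k g \<Longrightarrow> c \<in> k \<Longrightarrow> poly g c \<in> k"
  by (auto simp: coeffs_in_def poly_altdef intro!: is_subring_sum is_subring_closed(5,7))

lemma is_subring_UNIV: "is_subring UNIV" by (simp add: is_subring_def)

locale curve_generator = heisenberg ty p s e n a for ty :: "'a::alg_closed_field itself" and p s e n a +
  fixes y :: "'a poly fract alg_closure"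
  assumes y_eq: "y ^ p - y = of_poly (monom 1 1 * R_poly p e a)"
begin

definition "ff = monom 1 1 * R_poly p e a"

lemma ff_0: "ff \<noteq> 0" and degree_ff: "degree ff = p ^ e + 1"
proof -
  have R: "R_poly p e a = lin_poly a (Suc e)" by (simp only: R_poly_def lin_poly_def lessThan_Suc_atMost)
  have "R_poly p e a \<noteq> 0" unfolding R using ae_nz coeff_lin_poly[of a "Suc e" e] by auto
  moreover have "degree (R_poly p e a) = p ^ e" unfolding R using ae_nz by (rule degree_lin_poly)
  ultimately show "ff \<noteq> 0" "degree ff = p ^ e + 1"
    by (simp_all add: ff_def degree_mult_eq degree_monom_eq)
qed

lemma poly_ff: "poly ff c = c * R c" by (simp add: ff_def poly_monom)

lemma y_power_p: "y ^ p = y + of_poly ff" using y_eq by (simp add: ff_def algebra_simps)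

lemma coeffs_in_ff: "is_subring k \<Longrightarrow> (\<And>i. i \<le> e \<Longrightarrow> a i \<in> k) \<Longrightarrow> coeffs_in k ff"
  unfolding ff_def R_poly_def
  by (intro coeffs_in_mult coeffs_in_monom is_subring_closed(1))
     (auto simp: coeffs_in_def coeff_sum intro!: is_subring_sum is_subring_closed(2))

definition ev :: "(nat \<Rightarrow> 'a poly) \<Rightarrow> 'a poly fract alg_closure" where
  "ev r = (\<Sum>i<p. of_poly (r i) * y ^ i)"

text \<open>At infinity \<open>x\<close> has a pole of order \<open>p\<close> and \<open>y\<close> one of order \<open>p ^ e + 1\<close>.\<close>

definition pole_order :: "nat \<Rightarrow> nat \<Rightarrow> nat" where
  "pole_order i j = p * j + (p ^ e + 1) * i"

text \<open>As \<open>e > 0\<close>, the weight \<open>p ^ e + 1\<close> is 1 modulo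
  \<open>p\<close>, so the order modulo \<open>p\<close> recovers \<open>i < p\<close>.\<close>

lemma pole_order_inj: "pole_order i j = pole_order i' j' \<Longrightarrow> i < p \<Longrightarrow> i' < p \<Longrightarrow> i = i' \<and> j = j'"
proof -
  assume eq: "pole_order i j = pole_order i' j'" and i: "i < p" "i' < p"
  have pe: "p ^ e = p * p ^ (e - 1)" using e_pos by (metis Suc_diff_1 power_Suc)
  have "pole_order i j mod p = i mod p" for i j
  proof -
    have "pole_order i j = p * (j + p ^ (e - 1) * i) + i"
      unfolding pole_order_def pe by (simp add: algebra_simps)
    thus ?thesis by simp
  qed
  hence "i mod p = i' mod p" using eq by metis
  hence "i = i'" using i by simp
  thus ?thesis using eq p_pos by (simp add: pole_order_def)
qed

definition leading_index :: "(nat \<Rightarrow> 'a poly) \<Rightarrow> nat \<Rightarrow> bool" where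
  "leading_index r i0 \<longleftrightarrow> i0 < p \<and> r i0 \<noteq> 0 \<and>
    (\<forall>i<p. r i \<noteq> 0 \<longrightarrow> i \<noteq> i0 \<longrightarrow> pole_order i (degree (r i)) < pole_order i0 (degree (r i0)))"

lemma exists_leading_index:
  assumes i: "i < p" "r i \<noteq> 0"
  shows "\<exists>i0. leading_index r i0"
proof -
  let ?S = "{i. i < p \<and> r i \<noteq> 0}" and ?ord = "\<lambda>i. pole_order i (degree (r i))"
  have "Max (?ord ` ?S) \<in> ?ord ` ?S" using i by (intro Max_in) auto
  then obtain i0 where i0: "i0 < p" "r i0 \<noteq> 0" and max: "?ord i0 = Max (?ord ` ?S)" by auto
  have "?ord i < ?ord i0" if h: "i < p" "r i \<noteq> 0" "i \<noteq> i0" for i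
  proof -
    have "?ord i \<le> ?ord i0" unfolding max by (rule Max_ge) (use h in auto)
    moreover have "?ord i \<noteq> ?ord i0" using pole_order_inj[OF _ h(1) i0(1)] h(3) by metis
    ultimately show ?thesis by simp
  qed
  thus ?thesis unfolding leading_index_def using i0 by metis
qed

end

section \<open>Leading terms at a place where x has a pole\<close>

locale place_at_infinity = curve_generator ty p s e n a y + valuation_subring K W
  for ty :: "'a::alg_closed_field itself" and p s e n a y
    and K W :: "'a poly fract alg_closure set" +
  fixes k :: "'a set"
  assumes subring_k: "is_subring k" and inverse_k: "\<And>c. c \<in> k \<Longrightarrow> inverse c \<in> k"
    and a_k: "\<And>i. i \<le> e \<Longrightarrow> a i \<in> k" and k_W: "cst ` k \<subseteq> W"
    and xx_K: "xx \<in> K" and y_K: "y \<in> K" and xx_W: "xx \<notin> W"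
begin

lemma cst_unit: "c \<in> k \<Longrightarrow> cst c \<in> W" "c \<in> k \<Longrightarrow> inverse (cst c) \<in> W"
  using k_W inverse_k by (auto simp flip: cst_inverse)

lemma xx_ratio: "i < j \<Longrightarrow> xx ^ i / xx ^ j \<in> \<mm>"
proof -
  assume "i < j"
  hence "inverse xx ^ (j - i) \<in> \<mm>" using m_power[OF not_in_V[OF xx_K xx_W]] by simp
  moreover have "inverse xx ^ (j - i) = (xx ^ i / xx ^ j :: 'a poly fract alg_closure)"
    using \<open>i < j\<close> by (simp add: power_diff power_inverse field_simps)
  ultimately show ?thesis by simp
qed

lemma lead_of_poly:
  assumes "coeffs_in k g" "g \<noteq> 0"
  shows "lead (of_poly g) (cst (lead_coeff g) * xx ^ degree g)"
proof -
  let ?S = "{j. j \<le> degree g \<and> coeff g j \<noteq> 0}"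
  have ck: "coeff g j \<in> k" for j using assms by (simp add: coeffs_in_def)
  have K: "cst (coeff g j) * xx ^ j \<in> K" for j
    using K_closed(5)[OF subsetD[OF V_sub_K cst_unit(1)[OF ck]] K_closed(7)[OF xx_K]] .
  have "lead (\<Sum>j\<in>?S. cst (coeff g j) * xx ^ j) (cst (coeff g (degree g)) * xx ^ degree g)"
  proof (rule lead_sum)
    show "degree g \<in> ?S" using assms by simp
    fix j assume j: "j \<in> ?S"
    show "lead (cst (coeff g j) * xx ^ j) (cst (coeff g j) * xx ^ j)"
      by (rule lead_refl[OF K]) (use j in simp)
    assume "j \<noteq> degree g"
    hence "(xx ^ j / xx ^ degree g) * (cst (coeff g j) * inverse (cst (lead_coeff g))) \<in> \<mm>"
      using j by (intro m_mult xx_ratio V_closed(5) cst_unit ck) auto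
    thus "cst (coeff g j) * xx ^ j / (cst (lead_coeff g) * xx ^ degree g) \<in> \<mm>"
      by (simp add: divide_inverse mult_ac)
  qed simp
  moreover have "of_poly g = (\<Sum>j\<in>?S. cst (coeff g j) * xx ^ j)"
    unfolding of_poly_altdef by (rule sum.mono_neutral_right) auto
  ultimately show ?thesis by simp
qed

text \<open>\<open>y\<close> has a pole too, so it is negligible against \<open>y ^ p\<close>, which
  therefore has the size of the leading monomial of \<open>ff\<close>.\<close>

lemma y_power_p_unit: "y \<noteq> 0 \<and> (\<exists>\<eta>. \<eta> \<in> W \<and> inverse \<eta> \<in> W \<and> \<eta> \<noteq> 0 \<and> y ^ p = xx ^ (p ^ e + 1) * \<eta>)"
proof -
  let ?D = "p ^ e + 1"
  have ck: "lead_coeff ff \<in> k" using coeffs_in_ff[OF subring_k a_k] by (simp add: coeffs_in_def)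
  obtain u where u: "u \<in> \<mm>" "of_poly ff = cst (lead_coeff ff) * xx ^ ?D * (1 + u)"
    using lead_of_poly[OF coeffs_in_ff[OF subring_k a_k] ff_0] unfolding lead_def degree_ff by blast
  note c = cst_unit[OF ck] and u1 = one_plus_m[OF u(1)]
  have c0: "cst (lead_coeff ff) \<noteq> 0" using ff_0 by simp
  have yW: "y \<notin> W"
  proof
    assume yW: "y \<in> W"
    have "of_poly ff \<in> W" using V_closed(6)[OF V_closed(7)[OF yW] yW] y_power_p by (metis add_diff_cancel_left')
    hence "of_poly ff * (inverse (cst (lead_coeff ff)) * inverse (1 + u)) \<in> W"
      using c u1 by (intro V_closed(5)) auto
    moreover have "of_poly ff * (inverse (cst (lead_coeff ff)) * inverse (1 + u)) = xx ^ ?D"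
    proof -
      have "c * z * v * (inverse c * inverse v) = z" if "c \<noteq> 0" "v \<noteq> 0" for c z v :: "'a poly fract alg_closure"
        using that by (simp add: field_simps)
      thus ?thesis unfolding u(2) using c0 u1 by blast
    qed
    ultimately have "xx ^ ?D \<in> W" by simp
    hence "xx ^ 0 / xx ^ ?D * xx ^ ?D \<in> \<mm>" by (intro m_mult xx_ratio) auto
    thus False by simp
  qed
  hence y0: "y \<noteq> 0" using V_closed(2) by auto
  \<comment> \<open>Since \<open>y = y ^ p * v\<close>, the curve equation reads
    \<open>y ^ p * (1 - v) = of_poly ff\<close>.\<close>
  define v where "v = inverse y ^ (p - 1)"
  have v: "- v \<in> \<mm>" unfolding v_def using p_gt_1 by (intro m_minus m_power not_in_V[OF y_K yW]) auto
  note v1 = one_plus_m[OF v]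
  have "y ^ p * (1 + - v) = of_poly ff"
  proof -
    have "y ^ p * v = y"
      unfolding v_def using y0 p_pos by (simp add: power_inverse field_simps flip: power_minus_mult[of p y])
    thus ?thesis using y_power_p by (simp add: algebra_simps)
  qed
  hence "y ^ p = of_poly ff * inverse (1 + - v)"
    using v1 by (metis (no_types) mult.assoc mult.right_neutral right_inverse)
  hence "y ^ p = xx ^ ?D * (cst (lead_coeff ff) * ((1 + u) * inverse (1 + - v)))"
    unfolding u(2) by (simp add: mult_ac)
  moreover have "cst (lead_coeff ff) * ((1 + u) * inverse (1 + - v)) \<in> W"
    using c v1 V_closed(4)[OF V_closed(1) m_sub_V[OF u(1)]] by (intro V_closed(5)) auto
  moreover have "inverse (cst (lead_coeff ff) * ((1 + u) * inverse (1 + - v))) \<in> W"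
  proof -
    have "inverse (cst (lead_coeff ff)) * (inverse (1 + u) * (1 + - v)) \<in> W"
      using c u1 V_closed(4)[OF V_closed(1) m_sub_V[OF v]] by (intro V_closed(5)) auto
    thus ?thesis by simp
  qed
  moreover have "cst (lead_coeff ff) * ((1 + u) * inverse (1 + - v)) \<noteq> 0" using c0 u1 v1 by simp
  ultimately show ?thesis using y0 by blast
qed

text \<open>The \<open>p\<close>-th power of a monomial is \<open>xx ^ pole_order i j\<close> times
  a unit, which reduces the comparison to powers of \<open>xx\<close>.\<close>

lemma monomial_ratio:
  assumes "pole_order i j < pole_order i' j'"
  shows "(xx ^ j * y ^ i) / (xx ^ j' * y ^ i') \<in> \<mm>"
proof -
  obtain \<eta> where y0: "y \<noteq> 0" and \<eta>: "\<eta> \<in> W" "inverse \<eta> \<in> W" "\<eta> \<noteq> 0" "y ^ p = xx ^ (p ^ e + 1) * \<eta>"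
    using y_power_p_unit by blast
  have pw: "(xx ^ j * y ^ i) ^ p = xx ^ pole_order i j * \<eta> ^ i" for i j
  proof -
    have "(xx ^ j * y ^ i) ^ p = xx ^ (p * j) * (y ^ p) ^ i"
      by (simp add: power_mult_distrib mult.commute flip: power_mult)
    also have "\<dots> = xx ^ pole_order i j * \<eta> ^ i"
      unfolding \<eta>(4) pole_order_def by (simp only: power_mult_distrib power_add power_mult mult.assoc)
    finally show ?thesis .
  qed
  have "((xx ^ j * y ^ i) / (xx ^ j' * y ^ i')) ^ p =
      (xx ^ pole_order i j / xx ^ pole_order i' j') * (\<eta> ^ i * inverse \<eta> ^ i')"
    unfolding power_divide pw by (simp add: field_simps power_inverse)
  also have "\<dots> \<in> \<mm>"
    using \<eta> assms by (intro m_mult xx_ratio V_closed(5,7))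
  finally show ?thesis
    by (rule m_power_imp) (intro K_divide K_closed(5,7) xx_K y_K)
qed

lemma lead_ev:
  assumes r: "\<And>i. i < p \<Longrightarrow> coeffs_in k (r i)" and leading_index: "leading_index r i0"
  shows "lead (ev r) (cst (lead_coeff (r i0)) * (xx ^ degree (r i0) * y ^ i0))"
proof -
  let ?S = "{i. i < p \<and> r i \<noteq> 0}" and ?t = "\<lambda>i. cst (lead_coeff (r i)) * (xx ^ degree (r i) * y ^ i)"
  have y0: "y \<noteq> 0" using y_power_p_unit by blast
  have ck: "lead_coeff (r i) \<in> k" if "i < p" for i using r[OF that] by (simp add: coeffs_in_def)
  have "lead (\<Sum>i\<in>?S. of_poly (r i) * y ^ i) (?t i0)"
  proof (rule lead_sum)
    show "i0 \<in> ?S" using leading_index by (simp add: leading_index_def)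
    fix i assume i: "i \<in> ?S"
    show "lead (of_poly (r i) * y ^ i) (?t i)"
      using lead_mult[OF lead_of_poly[OF r] lead_refl[OF K_closed(7)[OF y_K]], of i i] i y0
      by (simp add: mult.assoc)
    assume "i \<noteq> i0"
    hence "pole_order i (degree (r i)) < pole_order i0 (degree (r i0))" using leading_index i by (simp add: leading_index_def)
    from m_mult[OF monomial_ratio[OF this], of "cst (lead_coeff (r i)) * inverse (cst (lead_coeff (r i0)))"]
    have "(xx ^ degree (r i) * y ^ i) / (xx ^ degree (r i0) * y ^ i0) * (cst (lead_coeff (r i)) * inverse (cst (lead_coeff (r i0)))) \<in> \<mm>"
      using cst_unit ck i leading_index by (simp add: leading_index_def V_closed(5))
    thus "?t i / ?t i0 \<in> \<mm>" by (simp add: divide_inverse mult_ac)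
  qed simp
  moreover have "ev r = (\<Sum>i\<in>?S. of_poly (r i) * y ^ i)"
    unfolding ev_def by (rule sum.mono_neutral_right) auto
  ultimately show ?thesis by simp
qed

text \<open>The right-hand side does not depend on \<open>W\<close>; this is why two places at
  infinity have the same elements.\<close>

lemma ev_ratio_iff:
  assumes r: "\<And>i. i < p \<Longrightarrow> coeffs_in k (r i)" "leading_index r i" and r': "\<And>i. i < p \<Longrightarrow> coeffs_in k (r' i)" "leading_index r' i'"
  shows "ev r / ev r' \<in> W \<longleftrightarrow> pole_order i (degree (r i)) \<le> pole_order i' (degree (r' i'))"
proof -
  let ?c = "cst (lead_coeff (r i))" and ?c' = "cst (lead_coeff (r' i'))"
  let ?z = "xx ^ degree (r i) * y ^ i" and ?z' = "xx ^ degree (r' i') * y ^ i'"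
  let ?o = "pole_order i (degree (r i))" and ?o' = "pole_order i' (degree (r' i'))"
  have y0: "y \<noteq> 0" using y_power_p_unit by blast
  have ck: "?c \<in> W" "?c' \<in> W" "inverse ?c \<in> W" "inverse ?c' \<in> W" "?c \<noteq> 0" "?c' \<noteq> 0"
    using r r' cst_unit by (auto simp: coeffs_in_def leading_index_def)
  have "ev r / ev r' \<in> W \<longleftrightarrow> (?c * ?z) / (?c' * ?z') \<in> W"
    by (rule lead_divide_in_V[OF lead_ev lead_ev]) (use r r' in auto)
  also have "\<dots> \<longleftrightarrow> ?z / ?z' \<in> W"
  proof -
    have "(?c * ?z) / (?c' * ?z') = ?z / ?z' * (?c * inverse ?c')" by (simp add: divide_inverse mult_ac)
    moreover have "?z / ?z' = (?c * ?z) / (?c' * ?z') * (?c' * inverse ?c)"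
      using ck(5,6) by (simp add: field_simps)
    ultimately show ?thesis using V_closed(5) ck by metis
  qed
  also have "\<dots> \<longleftrightarrow> ?o \<le> ?o'"
  proof (cases rule: linorder_cases[of ?o ?o'])
    case less
    thus ?thesis using m_sub_V[OF monomial_ratio[OF less]] by simp
  next
    case equal
    hence "i = i'" "degree (r i) = degree (r' i')" using pole_order_inj[OF equal] r(2) r'(2) by (auto simp: leading_index_def)
    thus ?thesis using y0 V_closed(1) by simp
  next
    case greater
    have "?z' / ?z * (?z / ?z') = 1" using y0 by simp
    thus ?thesis using m_mult[OF monomial_ratio[OF greater], of "?z / ?z'"] greater by auto
  qed
  finally show ?thesis .
qed

end

lemma of_poly_of_nat: "of_poly (of_nat i) = of_nat i"
  by (induction i) auto

lemma (in frobenius) frobenius_function_field: "frobenius TYPE('a poly fract alg_closure) p s"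
proof -
  have "CHAR('a poly fract alg_closure) = CHAR('a)"
  proof (rule CHAR_eqI)
    have "(of_nat CHAR('a) :: 'a poly) = 0" by (simp add: of_nat_eq_0_iff_char_dvd)
    thus "(of_nat CHAR('a) :: 'a poly fract alg_closure) = 0"
      by (metis of_poly_of_nat of_poly_simps(1))
    fix i assume "(of_nat i :: 'a poly fract alg_closure) = 0"
    hence "of_poly (of_nat i :: 'a poly) = 0" by (simp only: of_poly_of_nat)
    thus "CHAR('a) dvd i" by (simp add: of_nat_eq_0_iff_char_dvd)
  qed
  thus ?thesis using prime_char s_pos p_eq by unfold_locales auto
qed

lemma (in frobenius) exists_generator: "\<exists>y. y ^ p - y = (z :: 'a poly fract alg_closure)"
  by (rule frobenius.artin_schreier_root[OF frobenius_function_field])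

context curve_generator
begin

text \<open>Independence of \<open>1, y, ..., y ^ (p - 1)\<close> over the polynomials: at a place
  with a pole of \<open>xx\<close> one term dominates.\<close>

lemma ev_zero:
  assumes "ev r = 0" "i < p"
  shows "r i = 0"
proof (rule ccontr)
  assume "r i \<noteq> 0"
  then obtain i0 where i0: "leading_index r i0" using exists_leading_index assms(2) by blast
  \<comment> \<open>The rational functions in \<open>x\<close> whose only possible pole is at 0.
    They contain the constants and \<open>inverse xx\<close> but not \<open>xx\<close>, so Chevalley
    extension yields a place of the algebraic closure with a pole of \<open>xx\<close>.\<close>
  define S :: "'a poly fract alg_closure set" where "S = {of_poly g / xx ^ N | g N. degree g \<le> N}"
  have SI: "of_poly g / xx ^ N \<in> S" if "degree g \<le> N" for g N using that unfolding S_def by blast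
  have sub: "is_subring S" unfolding is_subring_def
  proof (intro conjI ballI)
    show "1 \<in> S" using SI[of 1 0] by simp
    fix z assume "z \<in> S"
    then obtain g N where g: "z = of_poly g / xx ^ N" "degree g \<le> N" by (auto simp: S_def)
    show "- z \<in> S" using SI[of "- g" N] g by simp
    fix z' assume "z' \<in> S"
    then obtain g' N' where g': "z' = of_poly g' / xx ^ N'" "degree g' \<le> N'" by (auto simp: S_def)
    have "z + z' = of_poly (g * monom 1 N' + g' * monom 1 N) / xx ^ (N + N')"
      by (simp add: g(1) g'(1) of_poly_monom power_add add_frac_eq)
    moreover have "degree (g * monom 1 N' + g' * monom 1 N) \<le> N + N'"
      using degree_mult_le[of g "monom 1 N'"] degree_mult_le[of g' "monom 1 N"] g(2) g'(2)
      by (intro degree_add_le) (auto simp: degree_monom_eq)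
    ultimately show "z + z' \<in> S" using SI by metis
    have "z * z' = of_poly (g * g') / xx ^ (N + N')" by (simp add: g g' power_add)
    moreover have "degree (g * g') \<le> N + N'" using degree_mult_le[of g g'] g(2) g'(2) by simp
    ultimately show "z * z' \<in> S" using SI by metis
  qed
  have xS: "xx \<notin> S"
  proof
    assume "xx \<in> S"
    then obtain g :: "'a poly" and N where g: "xx = of_poly g / xx ^ N" "degree g \<le> N" unfolding S_def by blast
    have "of_poly g = of_poly g / xx ^ N * xx ^ N" by simp
    also have "\<dots> = xx ^ Suc N" by (simp flip: g(1))
    also have "\<dots> = of_poly (monom 1 (Suc N))" by (simp add: of_poly_monom)
    finally have "g = monom 1 (Suc N)" by simp
    thus False using g(2) by (simp add: degree_monom_eq)
  qed
  have "inverse xx \<in> S" using SI[of 1 1] by (simp add: divide_inverse)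
  then obtain M where M: "is_subring M" "S \<subseteq> M" "xx \<notin> M" "\<And>z. z \<noteq> 0 \<Longrightarrow> z \<in> M \<or> inverse z \<in> M"
    using exists_valuation_ring[OF sub xS] by blast
  have "cst ` UNIV \<subseteq> M" using SI[of "[:_:]" 0] M(2) by (auto simp: cst_def)
  then interpret place_at_infinity ty p s e n a y UNIV M UNIV
    using M by unfold_locales (auto simp: is_subring_UNIV)
  have "ev r \<noteq> 0" by (rule lead_nonzero[OF lead_ev[OF _ i0]]) (simp add: coeffs_in_def)
  thus False using assms by simp
qed

definition times_y :: "(nat \<Rightarrow> 'a poly) \<Rightarrow> nat \<Rightarrow> 'a poly" where
  "times_y r i = (if i = 0 then ff * r (p - 1) else r (i - 1)) + (if i = 1 then r (p - 1) else 0)"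

text \<open>Multiplication by \<open>y\<close> in the basis of powers, where the top coefficient
  returns through \<open>y ^ p = y + ff\<close>. The map \<open>h\<close> and the element
  \<open>Y\<close> are kept general to serve both the function field and evaluation at a
  point.\<close>

lemma times_y:
  fixes h :: "'a poly \<Rightarrow> 'z::comm_ring_1"
  assumes add: "\<And>f g. h (f + g) = h f + h g" and mult: "\<And>f g. h (f * g) = h f * h g"
    and y: "Y ^ p = Y + h ff"
  shows "Y * (\<Sum>i<p. h (r i) * Y ^ i) = (\<Sum>i<p. h (times_y r i) * Y ^ i)"
proof -
  obtain q where q: "p = Suc (Suc q)" using p_gt_1 by (cases p; cases "p - 1") auto
  have h0: "h 0 = 0" using add[of 0 0] by simp
  have "(\<Sum>i<p. h (times_y r i) * Y ^ i) =
     (\<Sum>i<p. h (if i = 0 then ff * r (p - 1) else r (i - 1)) * Y ^ i) + (\<Sum>i<p. h (if i = 1 then r (p - 1) else 0) * Y ^ i)"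
    by (simp only: times_y_def add distrib_right sum.distrib)
  also have "(\<Sum>i<p. h (if i = 0 then ff * r (p - 1) else r (i - 1)) * Y ^ i) = h ff * h (r (p - 1)) + (\<Sum>i<Suc q. h (r i) * Y ^ Suc i)"
    unfolding q by (subst sum.lessThan_Suc_shift) (simp add: mult del: sum.lessThan_Suc)
  also have "(\<Sum>i<p. h (if i = 1 then r (p - 1) else 0) * Y ^ i) = (\<Sum>i\<in>{1}. h (r (p - 1)) * Y ^ i)"
    by (rule sum.mono_neutral_cong_right) (auto simp: q h0)
  finally have rhs: "(\<Sum>i<p. h (times_y r i) * Y ^ i) =
     (\<Sum>i<Suc q. h (r i) * Y ^ Suc i) + h (r (p - 1)) * Y ^ p"
    by (simp add: y algebra_simps del: sum.lessThan_Suc)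
  have "Y * (\<Sum>i<p. h (r i) * Y ^ i) = (\<Sum>i<Suc q. h (r i) * Y ^ Suc i) + h (r (Suc q)) * Y ^ Suc (Suc q)"
    unfolding q sum.lessThan_Suc[of _ "Suc q"] by (simp add: distrib_left sum_distrib_left mult_ac del: sum.lessThan_Suc)
  thus ?thesis unfolding rhs by (simp add: q)
qed

end

section \<open>Evaluation of polynomial functions at an affine point\<close>

locale affine_point = curve_generator ty p s e n a y
  for ty :: "'a::alg_closed_field itself" and p s e n a y +
  fixes k :: "'a set" and c d :: 'a
  assumes subring_k: "is_subring k" and inverse_k: "\<And>u. u \<in> k \<Longrightarrow> inverse u \<in> k"
    and a_k: "\<And>i. i \<le> e \<Longrightarrow> a i \<in> k" and c_k: "c \<in> k" and d_k: "d \<in> k"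
    and on_curve: "d ^ p - d = c * R c"
begin

lemmas k_closed = is_subring_closed[OF subring_k]

definition pt :: "(nat \<Rightarrow> 'a poly) \<Rightarrow> 'a" where
  "pt r = (\<Sum>i<p. poly (r i) c * d ^ i)"

text \<open>The graph of the evaluation of polynomial functions at the point \<open>(c, d)\<close>.\<close>

definition Ev :: "('a poly fract alg_closure \<times> 'a) set" where
  "Ev = {(ev r, pt r) | r. \<forall>i<p. coeffs_in k (r i)}"

lemma EvI: "(\<And>i. i < p \<Longrightarrow> coeffs_in k (r i)) \<Longrightarrow> (ev r, pt r) \<in> Ev"
  unfolding Ev_def by blast

lemma EvE: 
  assumes "(g, u) \<in> Ev"
  obtains r where "g = ev r" "u = pt r" "\<And>i. i < p \<Longrightarrow> coeffs_in k (r i)"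
  using assms unfolding Ev_def by blast

lemma Ev_value: "(g, u) \<in> Ev \<Longrightarrow> u \<in> k"
  by (erule EvE) (auto simp: pt_def intro!: is_subring_sum[OF subring_k] k_closed(5,7) coeffs_in_poly[OF subring_k] c_k d_k)

text \<open>The value is well defined because \<open>ev_zero\<close> makes the coefficients of a
  function unique.\<close>

lemma Ev_unique: "(g, u) \<in> Ev \<Longrightarrow> (g, u') \<in> Ev \<Longrightarrow> u = u'"
proof (elim EvE)
  fix r r' assume eq: "g = ev r" "u = pt r" "g = ev r'" "u' = pt r'"
  have "ev (\<lambda>i. r i - r' i) = 0" using eq by (simp add: ev_def algebra_simps sum_subtractf)
  hence "r i = r' i" if "i < p" for i using ev_zero[of "\<lambda>i. r i - r' i" i] that by simp
  thus "u = u'" by (simp add: eq pt_def)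
qed

lemma Ev_add: "(g, u) \<in> Ev \<Longrightarrow> (g', u') \<in> Ev \<Longrightarrow> (g + g', u + u') \<in> Ev"
proof (elim EvE)
  fix r r' assume eq: "g = ev r" "u = pt r" "g' = ev r'" "u' = pt r'"
    and r: "\<And>i. i < p \<Longrightarrow> coeffs_in k (r i)" "\<And>i. i < p \<Longrightarrow> coeffs_in k (r' i)"
  have "g + g' = ev (\<lambda>i. r i + r' i)" "u + u' = pt (\<lambda>i. r i + r' i)"
    by (simp_all add: eq ev_def pt_def algebra_simps sum.distrib)
  thus ?thesis using EvI[of "\<lambda>i. r i + r' i"] r coeffs_in_add[OF subring_k] by simp
qed

lemma Ev_0: "(0, 0) \<in> Ev"
  using EvI[of "\<lambda>_. 0"] coeffs_in_0[OF subring_k] by (simp add: ev_def pt_def)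

lemma Ev_sum: "(\<And>i. i \<in> I \<Longrightarrow> (g i, u i) \<in> Ev) \<Longrightarrow> (sum g I, sum u I) \<in> Ev"
  by (induction I rule: infinite_finite_induct) (simp_all add: Ev_0 Ev_add)

lemma Ev_poly_mult: "coeffs_in k h \<Longrightarrow> (g, u) \<in> Ev \<Longrightarrow> (of_poly h * g, poly h c * u) \<in> Ev"
proof (elim EvE)
  fix r assume eq: "g = ev r" "u = pt r" and r: "\<And>i. i < p \<Longrightarrow> coeffs_in k (r i)" and h: "coeffs_in k h"
  have "of_poly h * g = ev (\<lambda>i. h * r i)" "poly h c * u = pt (\<lambda>i. h * r i)"
    by (simp_all add: eq ev_def pt_def sum_distrib_left mult.assoc)
  thus ?thesis using EvI[of "\<lambda>i. h * r i"] r h coeffs_in_mult[OF subring_k] by simp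
qed

lemma Ev_y_mult: "(g, u) \<in> Ev \<Longrightarrow> (y * g, d * u) \<in> Ev"
proof (elim EvE)
  fix r assume eq: "g = ev r" "u = pt r" and r: "\<And>i. i < p \<Longrightarrow> coeffs_in k (r i)"
  have "y * g = ev (times_y r)" unfolding eq ev_def
    by (rule times_y) (auto simp: y_power_p)
  moreover have "d * u = pt (times_y r)" unfolding eq pt_def
    by (rule times_y[where h = "\<lambda>f. poly f c"]) (use on_curve in \<open>auto simp: poly_ff algebra_simps\<close>)
  moreover have "coeffs_in k (times_y r i)" if "i < p" for i
    unfolding times_y_def using r that p_gt_1
    by (auto intro!: coeffs_in_add coeffs_in_mult coeffs_in_0 coeffs_in_ff subring_k a_k)
  ultimately show ?thesis using EvI[of "times_y r"] by simp
qed

lemma Ev_mult: "(g, u) \<in> Ev \<Longrightarrow> (g', u') \<in> Ev \<Longrightarrow> (g * g', u * u') \<in> Ev"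
proof -
  assume g: "(g, u) \<in> Ev" and g': "(g', u') \<in> Ev"
  from g' obtain r where eq: "g' = ev r" "u' = pt r" and r: "\<And>i. i < p \<Longrightarrow> coeffs_in k (r i)" by (blast elim: EvE)
  have pw: "(y ^ i * g, d ^ i * u) \<in> Ev" for i
    by (induction i) (use g Ev_y_mult in \<open>auto simp: mult.assoc\<close>)
  have "((\<Sum>i<p. of_poly (r i) * (y ^ i * g)), (\<Sum>i<p. poly (r i) c * (d ^ i * u))) \<in> Ev"
    by (rule Ev_sum) (use r pw in \<open>auto intro: Ev_poly_mult\<close>)
  moreover have "(\<Sum>i<p. of_poly (r i) * (y ^ i * g)) = g * g'" "(\<Sum>i<p. poly (r i) c * (d ^ i * u)) = u * u'"
    by (simp_all add: eq ev_def pt_def sum_distrib_left mult_ac)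
  ultimately show ?thesis by simp
qed

lemma Ev_1: "(1, 1) \<in> Ev"
proof -
  let ?r = "\<lambda>i. if i = 0 then 1 else (0 :: 'a poly)"
  have "ev ?r = 1" "pt ?r = 1"
    unfolding ev_def pt_def by (simp_all add: if_distrib[of of_poly] if_distrib[of "\<lambda>f. poly f c"]
        if_distrib[of "\<lambda>z. z * _"] sum.delta cong: if_cong)
  thus ?thesis using EvI[of ?r] coeffs_in_0[OF subring_k] coeffs_in_const[OF subring_k k_closed(1)]
    by (simp add: one_pCons)
qed

lemma Ev_of_poly: "coeffs_in k h \<Longrightarrow> (of_poly h, poly h c) \<in> Ev"
  using Ev_poly_mult[OF _ Ev_1] by simp

lemma Ev_cst: "u \<in> k \<Longrightarrow> (cst u, u) \<in> Ev"
  using Ev_of_poly[OF coeffs_in_const[OF subring_k]] by (simp add: cst_def)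

lemma Ev_xx: "(xx, c) \<in> Ev"
  using Ev_of_poly[OF coeffs_in_monom[OF subring_k k_closed(1), of 1]] by (simp add: xx_def poly_monom)

lemma Ev_y: "(y, d) \<in> Ev"
  using Ev_y_mult[OF Ev_1] by simp

lemma Ev_minus: "(g, u) \<in> Ev \<Longrightarrow> (- g, - u) \<in> Ev"
  using Ev_mult[OF Ev_cst[OF k_closed(3)[OF k_closed(1)]], of g u] by simp

text \<open>\<open>Ev\<close> is generated under addition and multiplication by the constants,
  \<open>(xx, c)\<close> and \<open>(y, d)\<close>.\<close>

lemma Ev_induct [consumes 1, case_names cst xx y add mult]:
  assumes "(g, u) \<in> Ev"
    and cst: "\<And>u. u \<in> k \<Longrightarrow> P (cst u) u" and xx: "P xx c" and y: "P y d"
    and add: "\<And>g u g' u'. P g u \<Longrightarrow> P g' u' \<Longrightarrow> P (g + g') (u + u')"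
    and mult: "\<And>g u g' u'. P g u \<Longrightarrow> P g' u' \<Longrightarrow> P (g * g') (u * u')"
  shows "P g u"
proof -
  from assms(1) obtain r where eq: "g = ev r" "u = pt r" and r: "\<And>i. i < p \<Longrightarrow> coeffs_in k (r i)" by (blast elim: EvE)
  have P0: "P 0 0" and P1: "P 1 1" using cst[OF k_closed(2)] cst[OF k_closed(1)] by simp_all
  have pow: "P (z ^ i) (v ^ i)" if "P z v" for z v i by (induction i) (use that P1 mult in auto)
  have sum: "P (sum g I) (sum u I)" if "\<And>i. i \<in> I \<Longrightarrow> P (g i) (u i)" for g u and I :: "nat set"
    using that by (induction I rule: infinite_finite_induct) (simp_all add: P0 add)
  have poly: "P (of_poly h) (poly h c)" if "coeffs_in k h" for h
    unfolding of_poly_altdef poly_altdef using that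
    by (intro sum mult pow xx cst) (simp add: coeffs_in_def)
  show ?thesis unfolding eq ev_def pt_def
    by (intro sum mult pow y poly r) auto
qed

end

section \<open>The function field over a finite field and its place at infinity\<close>

locale rational_curve = curve_generator ty p s e n a y
  for ty :: "'a::alg_closed_field itself" and p s e n a y +
  fixes m :: nat
  assumes m_pos: "m > 0" and n_dvd_m: "n dvd m"
begin

abbreviation "k \<equiv> Fq (p ^ m) :: 'a set"
abbreviation "K \<equiv> function_field p e a (p ^ m)"

lemma subring_k: "is_subring k"
  by (auto simp: is_subring_def intro: Fq_closed)

lemma a_k: "i \<le> e \<Longrightarrow> a i \<in> k"
  using a_Fq Fq_mono[OF n_dvd_m] by blast

lemma affine_pointI: "c \<in> k \<Longrightarrow> d \<in> k \<Longrightarrow> d ^ p - d = c * R c \<Longrightarrow> affine_point p s e n a y k c d"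
  by unfold_locales (auto simp: subring_k a_k Fq_inverse)

lemma K_incl: "u \<in> k \<Longrightarrow> cst u \<in> K" "xx \<in> K" "y \<in> K"
  unfolding function_field_def constants_eq xx_def using y_eq
  by (auto intro!: generate_field.incl)

lemma subring_K: "is_subring K" and inverse_K: "z \<in> K \<Longrightarrow> inverse z \<in> K"
proof -
  let ?R = "ring_of_type_algebra :: 'a poly fract alg_closure ring"
  note G = generate_field.one[where R = ?R] generate_field.a_inv[where R = ?R] generate_field.m_inv[where R = ?R]
    generate_field.eng_add[where R = ?R] generate_field.eng_mult[where R = ?R]
  note G = G[unfolded ring_of_type_algebra_simps a_inv_ring_of_type_algebra]
  have K: "1 \<in> K" "z \<in> K \<Longrightarrow> - z \<in> K" "z \<in> K \<Longrightarrow> z' \<in> K \<Longrightarrow> z + z' \<in> K" "z \<in> K \<Longrightarrow> z' \<in> K \<Longrightarrow> z * z' \<in> K" for z z'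
    unfolding function_field_def by (fact G)+
  have K5: "inverse z \<in> K" if "z \<in> K" "z \<noteq> 0" for z
    using G(3)[OF that[unfolded function_field_def]] m_inv_ring_of_type_algebra[OF that(2)] by (simp add: function_field_def)
  show "is_subring K" unfolding is_subring_def using K by blast
  thus "inverse z \<in> K" if "z \<in> K" using K5[OF that] is_subring_closed(2) by (cases "z = 0") auto
qed

text \<open>Quotients of elements of \<open>Ev\<close> form a field containing all generators. The
  point only gives access to \<open>Ev\<close>, whose first components do not depend on it.\<close>

lemma K_repr:
  assumes "z \<in> K" and pt: "affine_point p s e n a y k c d"
  shows "\<exists>g u g' u'. (g, u) \<in> affine_point.Ev p y k c d \<and> (g', u') \<in> affine_point.Ev p y k c d \<and> g' \<noteq> 0 \<and> z = g / g'"
proof -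
  interpret affine_point ty p s e n a y k c d by (rule pt)
  interpret L: frobenius "TYPE('a poly fract alg_closure)" p s by (rule frobenius_function_field)
  let ?P = "\<lambda>z. \<exists>g u g' u'. (g, u) \<in> Ev \<and> (g', u') \<in> Ev \<and> g' \<noteq> 0 \<and> z = g / g'"
  have PI: "?P (g / g')" if "(g, u) \<in> Ev" "(g', u') \<in> Ev" "g' \<noteq> 0" for g u g' u' using that by blast
  have P1: "?P g" if "(g, u) \<in> Ev" for g u using PI[OF that Ev_1] by simp
  show ?thesis using assms(1) unfolding function_field_def
  proof (induction rule: generate_field.induct)
    case one
    show ?case using P1[OF Ev_1] by (simp add: ring_of_type_algebra_simps)
  next
    case (incl h)
    then consider "h \<in> constants (p ^ m)" | "h = xx" | "h ^ p - h = of_poly (monom 1 1 * R_poly p e a)"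
      by (auto simp: xx_def)
    thus ?case
    proof cases
      case 1
      thus ?thesis using P1 Ev_cst unfolding constants_eq by blast
    next
      case 2
      thus ?thesis using P1[OF Ev_xx] by simp
    next
      case 3
      hence "(h - y) ^ p = h - y" using y_eq by (simp add: L.frob_diff1 algebra_simps)
      hence "h - y \<in> Fq p" by (simp add: Fq_def)
      \<comment> \<open>Any other solution of the curve equation differs from \<open>y\<close> by a
        root of \<open>z ^ p = z\<close>. There are only \<open>p\<close> such roots in the large
        field, so all of them are constants.\<close>
      moreover have "cst ` (Fq p :: 'a set) = Fq p"
      proof (rule card_subset_eq)
        show "finite (Fq p :: 'a poly fract alg_closure set)" by (rule L.finite_Fp)
        show "cst ` (Fq p :: 'a set) \<subseteq> Fq p" by (auto simp: Fq_def simp flip: cst_power)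
        have "inj_on cst (Fq p :: 'a set)" by (auto simp: inj_on_def)
        thus "card (cst ` (Fq p :: 'a set)) = card (Fq p :: 'a poly fract alg_closure set)"
          by (simp add: card_image card_Fp L.card_Fp)
      qed
      ultimately obtain i where i: "i \<in> Fq p" "h = cst i + y" by (metis (no_types) diff_add_cancel imageE)
      show ?thesis using P1[OF Ev_add[OF Ev_cst[OF Fp_sub[OF i(1)]] Ev_y]] i by simp
    qed
  next
    case (a_inv h)
    then obtain g u g' u' where h: "(g, u) \<in> Ev" "(g', u') \<in> Ev" "g' \<noteq> 0" "h = g / g'" by blast
    show ?case using PI[OF Ev_minus[OF h(1)] h(2,3)] h(4) by (simp add: a_inv_ring_of_type_algebra)
  next
    case (m_inv h)
    then obtain g u g' u' where h: "(g, u) \<in> Ev" "(g', u') \<in> Ev" "g' \<noteq> 0" "h = g / g'" by blast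
    have "h \<noteq> 0" using m_inv.hyps by (simp add: ring_of_type_algebra_simps)
    thus ?case using PI[OF h(2,1)] h(4) by (simp add: m_inv_ring_of_type_algebra)
  next
    case (eng_add h h')
    then obtain g u g' u' where h: "(g, u) \<in> Ev" "(g', u') \<in> Ev" "g' \<noteq> 0" "h = g / g'" by blast
    from eng_add obtain f v f' v' where h': "(f, v) \<in> Ev" "(f', v') \<in> Ev" "f' \<noteq> 0" "h' = f / f'" by blast
    have "h + h' = (g * f' + f * g') / (g' * f')" using h h' by (simp add: field_simps)
    thus ?case using PI[OF Ev_add[OF Ev_mult[OF h(1) h'(2)] Ev_mult[OF h'(1) h(2)]] Ev_mult[OF h(2) h'(2)]] h(3) h'(3)
      by (simp add: ring_of_type_algebra_simps)
  next
    case (eng_mult h h')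
    then obtain g u g' u' where h: "(g, u) \<in> Ev" "(g', u') \<in> Ev" "g' \<noteq> 0" "h = g / g'" by blast
    from eng_mult obtain f v f' v' where h': "(f, v) \<in> Ev" "(f', v') \<in> Ev" "f' \<noteq> 0" "h' = f / f'" by blast
    show ?case using PI[OF Ev_mult[OF h(1) h'(1)] Ev_mult[OF h(2) h'(2)]] h h'
      by (simp add: ring_of_type_algebra_simps)
  qed
qed

lemma valuation_subring_curve_points:
  assumes "Z \<in> curve_points p e a (p ^ m)"
  shows "valuation_subring K Z" "cst ` k \<subseteq> Z"
proof -
  have Z: "is_subring Z" "constants (p ^ m) \<subset> Z" "Z \<subset> K" "\<And>z. z \<in> K \<Longrightarrow> z \<noteq> 0 \<Longrightarrow> z \<in> Z \<or> inverse z \<in> Z"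
    using assms unfolding curve_points_def rational_points_def valuation_rings_def subring_iff_is_subring by auto
  show "valuation_subring K Z" using Z subring_K inverse_K by unfold_locales auto
  show "cst ` k \<subseteq> Z" using Z(2) by (simp add: constants_eq psubset_eq)
qed

lemma unique_point_at_infinity:
  assumes Z: "Z \<in> curve_points p e a (p ^ m)" "xx \<notin> Z" and W: "W \<in> curve_points p e a (p ^ m)" "xx \<notin> W"
  shows "Z \<subseteq> W"
proof
  fix z assume z: "z \<in> Z"
  have inf: "place_at_infinity p s e n a y K Z k" if "Z \<in> curve_points p e a (p ^ m)" "xx \<notin> Z" for Z
  proof -
    interpret valuation_subring K Z by (rule valuation_subring_curve_points[OF that(1)])
    show ?thesis
      using that(2) valuation_subring_curve_points(2)[OF that(1)] K_incl(2,3)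
      by unfold_locales (auto simp: subring_k a_k Fq_inverse)
  qed
  interpret V: place_at_infinity ty p s e n a y K Z k by (rule inf[OF Z])
  interpret W: place_at_infinity ty p s e n a y K W k by (rule inf[OF W])
  have zK: "z \<in> K" using z V.V_sub_K by blast
  \<comment> \<open>The origin lies on every such curve and serves only to invoke
    \<open>K_repr\<close>.\<close>
  have pt: "affine_point p s e n a y k 0 0" by (rule affine_pointI) (auto simp: Fq_0 zero_power)
  obtain g u g' u' where "(g, u) \<in> affine_point.Ev p y k 0 0" "(g', u') \<in> affine_point.Ev p y k 0 0" "g' \<noteq> 0" "z = g / g'"
    using K_repr[OF zK pt] by blast
  then obtain r r' where r: "\<And>i. i < p \<Longrightarrow> coeffs_in k (r i)" and r': "\<And>i. i < p \<Longrightarrow> coeffs_in k (r' i)" and z': "ev r' \<noteq> 0" "z = ev r / ev r'"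
    by (metis affine_point.EvE[OF pt])
  show "z \<in> W"
  proof (cases "z = 0")
    case False
    have nz: "\<exists>i<p. h i \<noteq> 0" if h: "ev h \<noteq> 0" for h
    proof (rule ccontr)
      assume "\<not> (\<exists>i<p. h i \<noteq> 0)"
      thus False using h by (simp add: ev_def)
    qed
    obtain i i' where i: "leading_index r i" "leading_index r' i'"
      using nz[of r] nz[OF z'(1)] False z'(2) exists_leading_index by (metis div_0)
    show ?thesis using z V.ev_ratio_iff[OF r i(1) r' i(2)] W.ev_ratio_iff[OF r i(1) r' i(2)] z'(2) by simp
  qed (use W.V_closed(2) in simp)
qed

end

section \<open>Places at affine points\<close>

lemma common_denominator:
  fixes P :: "'a::field poly fract poly"
  shows "\<exists>A. A \<noteq> 0 \<and> (\<forall>i. \<exists>B. coeff P i * to_fract A = to_fract B)"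
proof (induction P)
  case 0
  show ?case by (rule exI[of _ 1]) (auto intro: exI[of _ 0])
next
  case (pCons z P)
  then obtain A where A: "A \<noteq> 0" "\<And>i. \<exists>B. coeff P i * to_fract A = to_fract B" by blast
  obtain u v where z: "z = to_fract u / to_fract v" "v \<noteq> 0"
    by (cases z) (auto simp: Fract_conv_to_fract)
  have "\<exists>B. coeff (pCons z P) i * to_fract (A * v) = to_fract B" for i
  proof (cases i)
    case 0
    have "z * to_fract (A * v) = to_fract (u * A)" using z by simp
    thus ?thesis unfolding 0 coeff_pCons_0 by blast
  next
    case (Suc j)
    obtain B where "coeff P j * to_fract A = to_fract B" using A by blast
    hence "coeff P j * to_fract (A * v) = to_fract (B * v)" by (simp flip: mult.assoc)
    thus ?thesis unfolding Suc coeff_pCons_Suc by blast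
  qed
  thus ?case using A(1) z(2) by (intro exI[of _ "A * v"]) auto
qed

lemma algebraic_relation:
  fixes g :: "'a::field poly fract alg_closure"
  shows "\<exists>B N. (\<exists>i\<le>N. B i \<noteq> 0) \<and> (\<Sum>i\<le>N. of_poly (B i) * g ^ i) = 0"
proof -
  obtain P where P: "P \<noteq> 0" "poly (map_poly to_ac P) g = 0" using alg_closure_algebraic by blast
  obtain A where A: "A \<noteq> 0" "\<And>i. \<exists>B. coeff P i * to_fract A = to_fract B" using common_denominator by blast
  then obtain B where B: "\<And>i. coeff P i * to_fract A = to_fract (B i)" by metis
  have "(\<Sum>i\<le>degree P. of_poly (B i) * g ^ i) = of_poly A * (\<Sum>i\<le>degree P. to_ac (coeff P i) * g ^ i)"
    unfolding sum_distrib_left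
  proof (rule sum.cong)
    fix i
    have "of_poly (B i) = to_ac (coeff P i) * of_poly A"
      unfolding of_poly_def B[symmetric] by simp
    thus "of_poly (B i) * g ^ i = of_poly A * (to_ac (coeff P i) * g ^ i)" by simp
  qed simp
  also have "(\<Sum>i\<le>degree P. to_ac (coeff P i) * g ^ i) = poly (map_poly to_ac P) g"
    unfolding poly_altdef by (simp add: coeff_map_poly degree_map_poly)
  finally have "(\<Sum>i\<le>degree P. of_poly (B i) * g ^ i) = 0" using P(2) by simp
  moreover have "B (degree P) \<noteq> 0"
  proof
    assume "B (degree P) = 0"
    hence "lead_coeff P * to_fract A = 0" using B[of "degree P"] by simp
    thus False using P(1) A(1) by simp
  qed
  ultimately show ?thesis by blast
qed

section \<open>The local ring at an affine point and its parameter x - c\<close>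

context affine_point
begin

text \<open>The graph of the evaluation at \<open>(c, d)\<close> on the local ring of the curve at that point.\<close>

definition Loc :: "('a poly fract alg_closure \<times> 'a) set" where
  "Loc = {(g / g', u / u') | g u g' u'. (g, u) \<in> Ev \<and> (g', u') \<in> Ev \<and> u' \<noteq> 0}"

lemma Ev_nonzero: "(g, u) \<in> Ev \<Longrightarrow> u \<noteq> 0 \<Longrightarrow> g \<noteq> 0"
  using Ev_unique Ev_0 by blast

lemma LocI: "(g, u) \<in> Ev \<Longrightarrow> (g', u') \<in> Ev \<Longrightarrow> u' \<noteq> 0 \<Longrightarrow> (g / g', u / u') \<in> Loc"
  unfolding Loc_def by blast

lemma LocE:
  assumes "(z, v) \<in> Loc"
  obtains g u g' u' where "(g, u) \<in> Ev" "(g', u') \<in> Ev" "u' \<noteq> 0" "g' \<noteq> 0" "z = g / g'" "v = u / u'"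
  using assms Ev_nonzero unfolding Loc_def by blast

lemma Ev_Loc: "(g, u) \<in> Ev \<Longrightarrow> (g, u) \<in> Loc"
  using LocI[OF _ Ev_1] by simp

lemma Loc_value: "(z, v) \<in> Loc \<Longrightarrow> v \<in> k"
  by (erule LocE) (simp add: divide_inverse k_closed(5) inverse_k Ev_value)

lemma Loc_unique: "(z, v) \<in> Loc \<Longrightarrow> (z, v') \<in> Loc \<Longrightarrow> v = v'"
proof (elim LocE)
  fix g u g' u' h b h' b'
  assume E: "(g, u) \<in> Ev" "(g', u') \<in> Ev" "(h, b) \<in> Ev" "(h', b') \<in> Ev"
    and nz: "u' \<noteq> 0" "g' \<noteq> 0" "b' \<noteq> 0" "h' \<noteq> 0"
    and eq: "z = g / g'" "v = u / u'" "z = h / h'" "v' = b / b'"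
  have "g * h' = h * g'" using eq nz by (simp add: frac_eq_eq)
  hence "u * b' = b * u'" using Ev_unique[of "g * h'"] Ev_mult[OF E(1,4)] Ev_mult[OF E(3,2)] by simp
  thus "v = v'" using eq nz by (simp add: frac_eq_eq)
qed

lemma Loc_add: "(z, v) \<in> Loc \<Longrightarrow> (z', v') \<in> Loc \<Longrightarrow> (z + z', v + v') \<in> Loc"
proof (elim LocE)
  fix g u g' u' h b h' b'
  assume E: "(g, u) \<in> Ev" "(g', u') \<in> Ev" "(h, b) \<in> Ev" "(h', b') \<in> Ev"
    and nz: "u' \<noteq> 0" "g' \<noteq> 0" "b' \<noteq> 0" "h' \<noteq> 0"
    and eq: "z = g / g'" "v = u / u'" "z' = h / h'" "v' = b / b'"
  have "z + z' = (g * h' + h * g') / (g' * h')" "v + v' = (u * b' + b * u') / (u' * b')"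
    using nz unfolding eq by (simp_all add: add_frac_eq)
  thus ?thesis using LocI[OF Ev_add[OF Ev_mult[OF E(1,4)] Ev_mult[OF E(3,2)]] Ev_mult[OF E(2,4)]] nz by simp
qed

lemma Loc_mult: "(z, v) \<in> Loc \<Longrightarrow> (z', v') \<in> Loc \<Longrightarrow> (z * z', v * v') \<in> Loc"
proof (elim LocE)
  fix g u g' u' h b h' b'
  assume E: "(g, u) \<in> Ev" "(g', u') \<in> Ev" "(h, b) \<in> Ev" "(h', b') \<in> Ev"
    and nz: "u' \<noteq> 0" "b' \<noteq> 0" and eq: "z = g / g'" "v = u / u'" "z' = h / h'" "v' = b / b'"
  show ?thesis using LocI[OF Ev_mult[OF E(1,3)] Ev_mult[OF E(2,4)]] nz by (simp add: eq)
qed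

lemma Loc_inverse: "(z, v) \<in> Loc \<Longrightarrow> v \<noteq> 0 \<Longrightarrow> (inverse z, inverse v) \<in> Loc"
  by (elim LocE) (use LocI in auto)

lemma Loc_cst: "u \<in> k \<Longrightarrow> (cst u, u) \<in> Loc" by (rule Ev_Loc[OF Ev_cst])
lemma Loc_1: "(1, 1) \<in> Loc" by (rule Ev_Loc[OF Ev_1])
lemma Loc_minus: "(z, v) \<in> Loc \<Longrightarrow> (- z, - v) \<in> Loc"
  using Loc_mult[OF Loc_cst[OF k_closed(3)[OF k_closed(1)]], of z v] by simp
lemma Loc_diff: "(z, v) \<in> Loc \<Longrightarrow> (z', v') \<in> Loc \<Longrightarrow> (z - z', v - v') \<in> Loc"
  using Loc_add[OF _ Loc_minus, of z v z' v'] by simp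
lemma Loc_power: "(z, v) \<in> Loc \<Longrightarrow> (z ^ i, v ^ i) \<in> Loc"
  by (induction i) (auto simp: Loc_1 Loc_mult)
lemma Loc_nonzero: "(z, v) \<in> Loc \<Longrightarrow> v \<noteq> 0 \<Longrightarrow> z \<noteq> 0"
  using Loc_unique Ev_Loc[OF Ev_0] by blast

definition "\<tau> = xx - cst c"

lemma tau_eq: "\<tau> = of_poly [:- c, 1:]"
proof -
  have "[:- c, 1:] = monom 1 1 - [:c:]" by (simp add: monom_altdef)
  thus ?thesis by (simp only: \<tau>_def xx_def cst_def of_poly_simps)
qed

lemma tau_nonzero: "\<tau> \<noteq> 0" by (simp add: tau_eq)
lemma Loc_tau: "(\<tau>, 0) \<in> Loc" using Loc_diff[OF Ev_Loc[OF Ev_xx] Loc_cst[OF c_k]] by (simp add: \<tau>_def)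

text \<open>\<open>z\<close> differs from its value by a multiple of \<open>\<tau>\<close> in the
  local ring. Once shown for all of \<open>Loc\<close>, it says that \<open>\<tau>\<close> generates
  the maximal ideal.\<close>

definition principal :: "'a poly fract alg_closure \<Rightarrow> 'a \<Rightarrow> bool" where
  "principal z v \<longleftrightarrow> (z, v) \<in> Loc \<and> (\<exists>z' v'. (z', v') \<in> Loc \<and> z = cst v + \<tau> * z')"

lemma principalI: "(z, v) \<in> Loc \<Longrightarrow> (z', v') \<in> Loc \<Longrightarrow> z = cst v + \<tau> * z' \<Longrightarrow> principal z v"
  unfolding principal_def by blast

lemma principal_add: "principal z v \<Longrightarrow> principal b u \<Longrightarrow> principal (z + b) (v + u)"
proof -
  assume "principal z v" "principal b u"
  then obtain z' v' b' u' where z: "(z, v) \<in> Loc" "(z', v') \<in> Loc" "z = cst v + \<tau> * z'"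
    and b: "(b, u) \<in> Loc" "(b', u') \<in> Loc" "b = cst u + \<tau> * b'" unfolding principal_def by blast
  show ?thesis
    by (rule principalI[OF Loc_add[OF z(1) b(1)] Loc_add[OF z(2) b(2)]]) (simp add: z(3) b(3) algebra_simps)
qed

lemma principal_mult: "principal z v \<Longrightarrow> principal b u \<Longrightarrow> principal (z * b) (v * u)"
proof -
  assume "principal z v" "principal b u"
  then obtain z' v' b' u' where z: "(z, v) \<in> Loc" "(z', v') \<in> Loc" "z = cst v + \<tau> * z'"
    and b: "(b, u) \<in> Loc" "(b', u') \<in> Loc" "b = cst u + \<tau> * b'" unfolding principal_def by blast
  have "z * b = cst (v * u) + \<tau> * (z' * b + cst v * b')"
    by (simp add: z(3) distrib_right) (simp add: b(3) algebra_simps)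
  thus ?thesis
    by (rule principalI[OF Loc_mult[OF z(1) b(1)] Loc_add[OF Loc_mult[OF z(2) b(1)] Loc_mult[OF Loc_cst[OF Loc_value[OF z(1)]] b(2)]]])
qed

text \<open>The curve is smooth and \<open>x - c\<close> is a local parameter everywhere, because the derivative of
  \<open>y ^ p - y\<close> with respect to \<open>y\<close> is \<open>- 1\<close>.\<close>

lemma principal_y: "principal y d"
proof -
  interpret L: frobenius "TYPE('a poly fract alg_closure)" p s by (rule frobenius_function_field)
  have pc: "principal (cst u) u" if "u \<in> k" for u
    by (rule principalI[OF Loc_cst[OF that] Ev_Loc[OF Ev_0]]) simp
  have px: "principal xx c"
    by (rule principalI[OF Ev_Loc[OF Ev_xx] Loc_1]) (simp add: \<tau>_def)
  have pw: "principal (xx ^ i) (c ^ i)" for i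
    using pc[OF k_closed(1)] by (induction i) (auto intro: principal_mult px)
  have sm: "principal (sum g I) (sum u I)" if "\<And>i. i \<in> I \<Longrightarrow> principal (g i) (u i)" for g u and I :: "nat set"
    using that pc[OF k_closed(2)] by (induction I rule: infinite_finite_induct) (simp_all add: principal_add)
  have "principal (of_poly ff) (poly ff c)"
    unfolding of_poly_altdef poly_altdef using coeffs_in_ff[OF subring_k a_k]
    by (intro sm principal_mult pw pc) (simp add: coeffs_in_def)
  then obtain z v where z: "(z, v) \<in> Loc" "of_poly ff = cst (poly ff c) + \<tau> * z" unfolding principal_def by blast
  define t where "t = y - cst d"
  have tL: "(t, 0) \<in> Loc" using Loc_diff[OF Ev_Loc[OF Ev_y] Loc_cst[OF d_k]] by (simp add: t_def)
  \<comment> \<open>\<open>t\<close> vanishes at the point, so \<open>b\<close> has value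
    \<open>- 1\<close> there and is a unit; \<open>b * t = \<tau> * z\<close> then makes
    \<open>t\<close> a multiple of \<open>\<tau>\<close>.\<close>
  define b where "b = t ^ (p - 1) - 1"
  have wL: "(b, - 1) \<in> Loc"
    using Loc_diff[OF Loc_power[OF tL, of "p - 1"] Loc_1] p_gt_1 by (simp add: b_def power_0_left)
  have w0: "b \<noteq> 0" using Loc_nonzero[OF wL] by simp
  have "t ^ p - t = (y ^ p - y) - (cst d ^ p - cst d)"
    by (simp add: t_def L.frob_diff1)
  also have "\<dots> = of_poly ff - cst (d ^ p - d)" by (simp add: y_power_p)
  also have "\<dots> = \<tau> * z" unfolding on_curve using z(2) by (simp add: poly_ff)
  finally have "t ^ p - t = \<tau> * z" .
  moreover have "t ^ p = t ^ (p - 1) * t" using power_minus_mult[of p t] by simp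
  ultimately have "b * t = \<tau> * z" by (simp add: b_def left_diff_distrib)
  hence "t = \<tau> * (z * inverse b)" using w0 by (simp add: field_simps)
  hence "y = cst d + \<tau> * (z * inverse b)" by (simp add: t_def algebra_simps)
  moreover have "(inverse b, inverse (- 1)) \<in> Loc" by (rule Loc_inverse[OF wL]) simp
  ultimately show ?thesis by (intro principalI[OF Ev_Loc[OF Ev_y] Loc_mult[OF z(1)]])
qed

lemma principal_Ev: "(g, u) \<in> Ev \<Longrightarrow> principal g u"
proof (induction rule: Ev_induct)
  case (cst u)
  show ?case by (rule principalI[OF Loc_cst[OF cst] Ev_Loc[OF Ev_0]]) simp
next
  case xx
  show ?case by (rule principalI[OF Ev_Loc[OF Ev_xx] Loc_1]) (simp add: \<tau>_def)
qed (auto intro: principal_y principal_add principal_mult)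

lemma principal_Loc: "(z, v) \<in> Loc \<Longrightarrow> principal z v"
proof (elim LocE)
  fix g u g' u' assume E: "(g, u) \<in> Ev" "(g', u') \<in> Ev" and nz: "u' \<noteq> 0" "g' \<noteq> 0" and eq: "z = g / g'" "v = u / u'"
  obtain h b where h: "(h, b) \<in> Loc" "g' = cst u' + \<tau> * h" using principal_Ev[OF E(2)] unfolding principal_def by blast
  have I: "(inverse g', inverse u') \<in> Loc" by (rule Loc_inverse[OF Ev_Loc[OF E(2)] nz(1)])
  have "inverse g' = cst (inverse u') + \<tau> * (- (h * (inverse g' * cst (inverse u'))))"
  proof -
    have "\<tau> * h = g' - cst u'" using h(2) by simp
    hence "\<tau> * (- (h * (inverse g' * cst (inverse u')))) = - ((g' - cst u') * (inverse g' * inverse (cst u')))"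
      by (simp add: cst_inverse flip: mult.assoc)
    also have "\<dots> = inverse g' - inverse (cst u')" using nz by (simp add: field_simps)
    finally show ?thesis by (simp add: cst_inverse)
  qed
  hence "principal (inverse g') (inverse u')"
    by (rule principalI[OF I Loc_minus[OF Loc_mult[OF h(1) Loc_mult[OF I Loc_cst[OF inverse_k[OF Ev_value[OF E(2)]]]]]]])
  from principal_mult[OF principal_Ev[OF E(1)] this] show ?thesis by (simp add: eq divide_inverse)
qed

text \<open>An algebraic relation for \<open>g\<close>, divided by its lowest power of
  \<open>g\<close>, displays a nonzero polynomial \<open>B j0\<close> as a multiple of
  \<open>g\<close> in the coordinate ring. The order of \<open>B j0\<close> at \<open>c\<close> is
  the bound.\<close>

lemma tau_power_bound_UNIV:
  assumes k: "k = UNIV" and g: "(g, u) \<in> Ev" "g \<noteq> 0"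
  shows "\<exists>N. \<forall>j b v. (b, v) \<in> Loc \<longrightarrow> g = \<tau> ^ j * b \<longrightarrow> j \<le> N"
proof -
  obtain B N where B: "\<exists>i\<le>N. B i \<noteq> 0" "(\<Sum>i\<le>N. of_poly (B i) * g ^ i) = 0" using algebraic_relation by blast
  define j0 where "j0 = (LEAST i. B i \<noteq> 0)"
  have j0: "B j0 \<noteq> 0" "\<And>i. i < j0 \<Longrightarrow> B i = 0" "j0 \<le> N"
    using B(1) LeastI_ex[of "\<lambda>i. B i \<noteq> 0"] not_less_Least[of _ "\<lambda>i. B i \<noteq> 0"] Least_le[of "\<lambda>i. B i \<noteq> 0"]
    unfolding j0_def by (blast, blast, meson le_trans)
  define h where "h = (\<Sum>i\<in>{Suc j0..N}. of_poly (B i) * g ^ (i - Suc j0))"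
  have c: "coeffs_in k f" for f by (simp add: k coeffs_in_def)
  have gp: "(g ^ i, u ^ i) \<in> Ev" for i by (induction i) (auto simp: Ev_1 Ev_mult g)
  have hE: "(h, (\<Sum>i\<in>{Suc j0..N}. poly (B i) c * u ^ (i - Suc j0))) \<in> Ev"
    unfolding h_def by (intro Ev_sum Ev_poly_mult c gp)
  have "0 = (\<Sum>i\<in>{j0..N}. of_poly (B i) * g ^ i)"
    unfolding B(2)[symmetric] using j0(2) by (intro sum.mono_neutral_right) (auto simp: not_le)
  also have "\<dots> = of_poly (B j0) * g ^ j0 + (\<Sum>i\<in>{Suc j0..N}. of_poly (B i) * g ^ i)"
    using j0(3) by (simp add: sum.atLeast_Suc_atMost)
  also have "(\<Sum>i\<in>{Suc j0..N}. of_poly (B i) * g ^ i) = g ^ Suc j0 * h"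
  proof -
    have "g ^ i = g ^ Suc j0 * g ^ (i - Suc j0)" if "i \<in> {Suc j0..N}" for i using that by (simp flip: power_add power_Suc)
    thus ?thesis unfolding h_def sum_distrib_left by (intro sum.cong) (auto simp only: mult_ac)
  qed
  finally have "g ^ j0 * (of_poly (B j0) + g * h) = 0" by (simp add: algebra_simps)
  hence gh: "of_poly (B j0) = g * (- h)" using g(2) by (simp add: eq_neg_iff_add_eq_0)
  define M where "M = order c (B j0)"
  obtain C where C: "B j0 = [:- c, 1:] ^ M * C" "\<not> [:- c, 1:] dvd C"
    using order_decomp[OF j0(1)] unfolding M_def by blast
  have Cc: "poly C c \<noteq> 0" using C(2) by (simp add: poly_eq_0_iff_dvd)
  have "j \<le> M" if b: "(b, v) \<in> Loc" and eq: "g = \<tau> ^ j * b" for j b v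
  proof (rule ccontr)
    assume "\<not> j \<le> M"
    hence j: "\<tau> ^ j = \<tau> ^ M * \<tau> ^ (j - M)" "j - M > 0" by (simp_all flip: power_add)
    have "\<tau> ^ M * of_poly C = \<tau> ^ M * (\<tau> ^ (j - M) * (b * (- h)))"
      using gh unfolding C(1) eq j(1) by (simp add: tau_eq mult_ac)
    hence "of_poly C = \<tau> ^ (j - M) * (b * (- h))"
      using tau_nonzero by (metis mult_left_cancel power_not_zero)
    moreover have "(\<tau> ^ (j - M), 0) \<in> Loc" using Loc_power[OF Loc_tau, of "j - M"] j(2) by (simp add: power_0_left)
    ultimately have "(of_poly C, 0) \<in> Loc"
      using Loc_mult[OF _ Loc_mult[OF b Loc_minus[OF Ev_Loc[OF hE]]]] by fastforce
    thus False using Loc_unique[OF _ Ev_Loc[OF Ev_of_poly[OF c[of C]]]] Cc by force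
  qed
  thus ?thesis by blast
qed

text \<open>The coefficients of the algebraic relation need not lie in \<open>k\<close>, so the
  bound is taken from the algebraically closed constant field.\<close>

lemma tau_power_bound:
  assumes g: "(g, u) \<in> Ev" "g \<noteq> 0"
  shows "\<exists>N. \<forall>j b v. (b, v) \<in> Loc \<longrightarrow> g = \<tau> ^ j * b \<longrightarrow> j \<le> N"
proof -
  interpret U: affine_point ty p s e n a y UNIV c d
    using on_curve by unfold_locales (auto simp: is_subring_UNIV)
  have Ev: "Ev \<subseteq> U.Ev" unfolding Ev_def U.Ev_def by (auto simp: coeffs_in_def)
  have Loc: "Loc \<subseteq> U.Loc" unfolding Loc_def U.Loc_def using Ev by blast
  obtain N where "\<And>j b v. (b, v) \<in> U.Loc \<Longrightarrow> g = \<tau> ^ j * b \<Longrightarrow> j \<le> N"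
    using U.tau_power_bound_UNIV[OF refl subsetD[OF Ev g(1)] g(2)] by blast
  thus ?thesis using Loc by blast
qed

text \<open>While the value is 0 another factor \<open>\<tau>\<close> splits off;
  \<open>tau_power_bound\<close> ends this.\<close>

lemma Ev_factor:
  assumes g: "(g, u) \<in> Ev" "g \<noteq> 0"
  shows "\<exists>j b v. (b, v) \<in> Loc \<and> v \<noteq> 0 \<and> g = \<tau> ^ j * b"
proof (rule ccontr)
  assume none: "\<not> ?thesis"
  have step: "\<exists>b v. (b, v) \<in> Loc \<and> g = \<tau> ^ j * b" for j
  proof (induction j)
    case 0
    show ?case using Ev_Loc[OF g(1)] by auto
  next
    case (Suc j)
    then obtain b v where b: "(b, v) \<in> Loc" "g = \<tau> ^ j * b" by blast
    hence "v = 0" using none by blast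
    then obtain b' v' where b': "(b', v') \<in> Loc" "b = \<tau> * b'"
      using principal_Loc[OF b(1)] unfolding principal_def by auto
    have "g = \<tau> ^ Suc j * b'" unfolding b(2) b'(2) by simp
    thus ?case using b'(1) by blast
  qed
  obtain N where N: "\<And>j b v. (b, v) \<in> Loc \<Longrightarrow> g = \<tau> ^ j * b \<Longrightarrow> j \<le> N"
    using tau_power_bound[OF g] by blast
  show False using step[of "Suc N"] N[of _ _ "Suc N"] by auto
qed

lemma Loc_valuation:
  assumes "(g, u) \<in> Ev" "(g', u') \<in> Ev" "g \<noteq> 0" "g' \<noteq> 0"
  shows "\<exists>v. (g / g', v) \<in> Loc \<or> (g' / g, v) \<in> Loc"
proof -
  have *: "\<exists>v. (\<tau> ^ j * b / (\<tau> ^ j' * b'), v) \<in> Loc" if "j' \<le> j" "(b, v) \<in> Loc" "(b', v') \<in> Loc" "v' \<noteq> 0" for j j' b b' v v'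
  proof -
    have "\<tau> ^ j = \<tau> ^ j' * \<tau> ^ (j - j')" using that(1) by (simp flip: power_add)
    hence "\<tau> ^ j * b / (\<tau> ^ j' * b') = \<tau> ^ (j - j') * (b * inverse b')"
      using tau_nonzero by (simp add: divide_inverse)
    thus ?thesis using Loc_mult[OF Loc_power[OF Loc_tau] Loc_mult[OF that(2) Loc_inverse[OF that(3,4)]]] by metis
  qed
  obtain j b v where b: "(b, v) \<in> Loc" "v \<noteq> 0" "g = \<tau> ^ j * b" using Ev_factor[OF assms(1,3)] by blast
  obtain j' b' v' where b': "(b', v') \<in> Loc" "v' \<noteq> 0" "g' = \<tau> ^ j' * b'" using Ev_factor[OF assms(2,4)] by blast
  show ?thesis
  proof (cases "j' \<le> j")
    case True
    thus ?thesis using *[OF True b(1) b'(1,2)] b(3) b'(3) by blast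
  next
    case False
    thus ?thesis using *[OF _ b'(1) b(1,2), of j j'] b(3) b'(3) by auto
  qed
qed

lemma place_ideal_Loc: "z \<in> place_ideal (fst ` Loc) \<longleftrightarrow> (z, 0) \<in> Loc"
proof
  assume z: "z \<in> place_ideal (fst ` Loc)"
  then obtain v where v: "(z, v) \<in> Loc" by (auto simp: place_ideal_def)
  have "v = 0"
  proof (rule ccontr)
    assume "v \<noteq> 0"
    thus False using Loc_inverse[OF v] Loc_nonzero[OF v] z by (force simp: place_ideal_def)
  qed
  thus "(z, 0) \<in> Loc" using v by simp
next
  assume z: "(z, 0) \<in> Loc"
  have "inverse z \<notin> fst ` Loc" if "z \<noteq> 0"
  proof
    assume "inverse z \<in> fst ` Loc"
    then obtain v where "(inverse z, v) \<in> Loc" by auto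
    from Loc_mult[OF z this] have "(1, 0) \<in> Loc" using that by simp
    thus False using Loc_unique[OF _ Loc_1] by fastforce
  qed
  thus "z \<in> place_ideal (fst ` Loc)" using z by (force simp: place_ideal_def)
qed

lemma is_subring_Loc: "is_subring (fst ` Loc)"
  unfolding is_subring_def
proof (intro conjI ballI)
  show "1 \<in> fst ` Loc" using Loc_1 by force
  fix z assume "z \<in> fst ` Loc"
  then obtain v where v: "(z, v) \<in> Loc" by auto
  show "- z \<in> fst ` Loc" using Loc_minus[OF v] by force
  fix z' assume "z' \<in> fst ` Loc"
  then obtain v' where v': "(z', v') \<in> Loc" by auto
  show "z + z' \<in> fst ` Loc" using Loc_add[OF v v'] by force
  show "z * z' \<in> fst ` Loc" using Loc_mult[OF v v'] by force
qed

end

section \<open>Points of the curve\<close>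

context rational_curve
begin

definition place :: "'a \<Rightarrow> 'a \<Rightarrow> 'a poly fract alg_closure set" where
  "place c d = fst ` affine_point.Loc p y k c d"

lemma Ev_sub_K:
  assumes "affine_point p s e n a y k c d" "(g, u) \<in> affine_point.Ev p y k c d"
  shows "g \<in> K"
proof -
  interpret affine_point ty p s e n a y k c d by (rule assms(1))
  show ?thesis using assms(2)
    by (induction rule: Ev_induct) (auto intro: K_incl is_subring_closed(4,5)[OF subring_K])
qed

lemma place_in_curve_points:
  assumes cd: "c \<in> k" "d \<in> k" "d ^ p - d = c * R c"
  shows "place c d \<in> curve_points p e a (p ^ m)"
    "xx - cst c \<in> place_ideal (place c d)" "y - cst d \<in> place_ideal (place c d)"
proof -
  have pt: "affine_point p s e n a y k c d" by (rule affine_pointI[OF cd])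
  interpret affine_point ty p s e n a y k c d by (rule pt)
  have O: "place c d = fst ` Loc" by (simp add: place_def)
  show 1: "xx - cst c \<in> place_ideal (place c d)" and "y - cst d \<in> place_ideal (place c d)"
    unfolding O place_ideal_Loc
    using Loc_tau Loc_diff[OF Ev_Loc[OF Ev_y] Loc_cst[OF d_k]] by (simp_all add: \<tau>_def)
  have sub: "fst ` Loc \<subseteq> K"
  proof
    fix z assume "z \<in> fst ` Loc"
    then obtain v where "(z, v) \<in> Loc" by auto
    then obtain g u g' u' where "(g, u) \<in> Ev" "(g', u') \<in> Ev" "z = g / g'" unfolding Loc_def by blast
    thus "z \<in> K"
      using is_subring_closed(5)[OF subring_K] inverse_K Ev_sub_K[OF pt] by (simp add: divide_inverse)
  qed
  have "fst ` Loc \<in> valuation_rings (constants (p ^ m)) K"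
    unfolding valuation_rings_def subring_iff_is_subring mem_Collect_eq
  proof (intro conjI ballI impI)
    show "is_subring (fst ` Loc)" by (rule is_subring_Loc)
    show "constants (p ^ m) \<subset> fst ` Loc"
    proof
      show "constants (p ^ m) \<subseteq> fst ` Loc" using Loc_cst by (force simp: constants_eq)
      have "(xx :: 'a poly fract alg_closure) \<noteq> cst u" for u
      proof
        assume "(xx :: 'a poly fract alg_closure) = cst u"
        hence "monom 1 1 = [:u:]" by (simp add: xx_def cst_def)
        thus False by (simp add: monom_altdef)
      qed
      moreover have "xx \<in> fst ` Loc" using Ev_Loc[OF Ev_xx] by force
      ultimately show "constants (p ^ m) \<noteq> fst ` Loc" by (auto simp: constants_eq)
    qed
    show "fst ` Loc \<subset> K"
    proof
      have "inverse \<tau> \<notin> fst ` Loc"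
        using place_ideal_Loc[of \<tau>] Loc_tau tau_nonzero by (simp add: place_ideal_def)
      moreover have "inverse \<tau> \<in> K"
        unfolding \<tau>_def by (intro inverse_K is_subring_closed(6)[OF subring_K] K_incl c_k)
      ultimately show "fst ` Loc \<noteq> K" by blast
    qed (rule sub)
    fix z assume z: "z \<in> K" "z \<noteq> 0"
    obtain g u g' u' where "(g, u) \<in> Ev" "(g', u') \<in> Ev" "g' \<noteq> 0" "z = g / g'"
      using K_repr[OF z(1) pt] by blast
    thus "z \<in> fst ` Loc \<or> inverse z \<in> fst ` Loc"
      using Loc_valuation[of g u g' u'] z(2) by (force simp: field_simps)
  qed
  moreover have "\<exists>b\<in>constants (p ^ m). z - b \<in> place_ideal (fst ` Loc)" if zL: "z \<in> fst ` Loc" for z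
  proof -
    obtain v where v: "(z, v) \<in> Loc" using zL by auto
    have "(z - cst v, 0) \<in> Loc" using Loc_diff[OF v Loc_cst[OF Loc_value[OF v]]] by simp
    thus ?thesis using Loc_value[OF v] unfolding place_ideal_Loc constants_eq by blast
  qed
  ultimately show "place c d \<in> curve_points p e a (p ^ m)"
    unfolding curve_points_def rational_points_def O by simp
qed

text \<open>On \<open>Ev\<close> reduction modulo the ideal of \<open>Z\<close> is evaluation, so
  denominators of \<open>Loc\<close> are units of \<open>Z\<close> and \<open>Loc\<close> is
  contained in \<open>Z\<close>. Conversely, for \<open>z\<close> outside \<open>Loc\<close> the
  inverse is a multiple of \<open>\<tau>\<close>, and \<open>z\<close> in \<open>Z\<close> would put
  1 into the ideal.\<close>

lemma place_unique:
  assumes cd: "c \<in> k" "d \<in> k" "d ^ p - d = c * R c"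
    and Z: "Z \<in> curve_points p e a (p ^ m)" "xx - cst c \<in> place_ideal Z" "y - cst d \<in> place_ideal Z"
  shows "Z = place c d"
proof -
  have pt: "affine_point p s e n a y k c d" by (rule affine_pointI[OF cd])
  interpret affine_point ty p s e n a y k c d by (rule pt)
  interpret Z: valuation_subring K Z by (rule valuation_subring_curve_points[OF Z(1)])
  have cZ: "u \<in> k \<Longrightarrow> cst u \<in> Z" for u using valuation_subring_curve_points(2)[OF Z(1)] by blast
  let ?P = "\<lambda>g u. u \<in> k \<and> g \<in> Z \<and> g - cst u \<in> place_ideal Z"
  have Pk: "?P g u" if g: "u \<in> k" "g - cst u \<in> place_ideal Z" for g u
    using g Z.V_closed(4)[OF Z.m_sub_V[OF g(2)] cZ[OF g(1)]] by simp
  have P: "(g, u) \<in> Ev \<Longrightarrow> ?P g u" for g u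
  proof (induction rule: Ev_induct)
    case (cst u)
    thus ?case using cZ by simp
  next
    case xx
    show ?case by (rule Pk[OF c_k Z(2)])
  next
    case y
    show ?case by (rule Pk[OF d_k Z(3)])
  next
    case (add g u g' u')
    have "g + g' - cst (u + u') = (g - cst u) + (g' - cst u')" by simp
    thus ?case using add Z.m_add k_closed(4) Z.V_closed(4) by metis
  next
    case (mult g u g' u')
    have "(g - cst u) * g' + (g' - cst u') * cst u \<in> place_ideal Z"
      using mult cZ by (intro Z.m_add Z.m_mult) auto
    moreover have "g * g' - cst (u * u') = (g - cst u) * g' + (g' - cst u') * cst u"
      by (simp add: algebra_simps)
    ultimately show ?case using mult k_closed(5) Z.V_closed(5) by metis
  qed
  have sub: "z \<in> Z" if zv: "(z, v) \<in> Loc" for z v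
  proof -
    obtain g u g' u' where E: "(g, u) \<in> Ev" "(g', u') \<in> Ev" "u' \<noteq> 0" "g' \<noteq> 0" "z = g / g'"
      using LocE[OF zv] by metis
    have "cst u' * cst (inverse u') = 1" using E(3) by (simp flip: cst_simps(4))
    hence "cst u' \<notin> place_ideal Z"
      using Z.m_mult[of "cst u'" "cst (inverse u')"] cZ inverse_k P[OF E(2)] Z.one_notin_m by metis
    hence "g' \<notin> place_ideal Z"
      using Z.m_diff[of g' "g' - cst u'"] P[OF E(2)] by auto
    hence "inverse g' \<in> Z" using Z.unitI P[OF E(2)] by blast
    thus ?thesis using Z.V_closed(5) P[OF E(1)] unfolding E(5) divide_inverse by blast
  qed
  have "z \<in> fst ` Loc" if z: "z \<in> Z" for z
  proof (rule ccontr)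
    assume zL: "z \<notin> fst ` Loc"
    have z0: "z \<noteq> 0" using zL Ev_Loc[OF Ev_0] by force
    obtain g u g' u' where "(g, u) \<in> Ev" "(g', u') \<in> Ev" "g' \<noteq> 0" "z = g / g'"
      using K_repr[OF subsetD[OF Z.V_sub_K z] pt] by blast
    then obtain v where v: "(inverse z, v) \<in> Loc"
      using Loc_valuation[of g u g' u'] z0 zL by (force simp: field_simps)
    have "v = 0" using Loc_inverse[OF v] zL by force
    then obtain z' v' where z': "(z', v') \<in> Loc" "inverse z = \<tau> * z'"
      using principal_Loc[OF v] unfolding principal_def by auto
    have "\<tau> * (z' * z) \<in> place_ideal Z"
      using Z(2) sub[OF z'(1)] z by (intro Z.m_mult Z.V_closed(5)) (simp_all add: \<tau>_def)
    moreover have "\<tau> * (z' * z) = 1" using z'(2) z0 by (metis left_inverse mult.assoc)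
    ultimately show False by simp
  qed
  thus ?thesis using sub unfolding place_def by force
qed

lemma finite_point_coordinates:
  assumes Z: "Z \<in> curve_points p e a (p ^ m)" and x: "xx \<in> Z"
  shows "\<exists>c\<in>k. \<exists>d\<in>k. d ^ p - d = c * R c \<and> xx - cst c \<in> place_ideal Z \<and> y - cst d \<in> place_ideal Z"
proof -
  interpret Z: valuation_subring K Z by (rule valuation_subring_curve_points[OF Z])
  interpret L: frobenius "TYPE('a poly fract alg_closure)" p s by (rule frobenius_function_field)
  have cZ: "u \<in> k \<Longrightarrow> cst u \<in> Z" for u using valuation_subring_curve_points(2)[OF Z] by blast
  have rat: "\<exists>c\<in>k. z - cst c \<in> place_ideal Z" if "z \<in> Z" for z
    using Z that unfolding curve_points_def rational_points_def constants_eq by blast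
  have ffZ: "of_poly ff \<in> Z" unfolding of_poly_altdef using coeffs_in_ff[OF subring_k a_k]
    by (intro is_subring_sum[OF Z.subring_V] Z.V_closed(5,7) cZ x) (simp add: coeffs_in_def)
  \<comment> \<open>\<open>y\<close> is integral over the polynomials in \<open>x\<close>: if it had
    a pole, dividing \<open>y ^ p = y + of_poly ff\<close> by \<open>y ^ p\<close> would put 1 into
    the maximal ideal.\<close>
  have yZ: "y \<in> Z"
  proof (rule ccontr)
    assume yn: "y \<notin> Z"
    hence y0: "y \<noteq> 0" using Z.V_closed(2) by auto
    have i: "inverse y \<in> place_ideal Z" by (rule Z.not_in_V[OF K_incl(3) yn])
    have "inverse y ^ (p - 1) * 1 + inverse y ^ p * of_poly ff \<in> place_ideal Z"
      using p_gt_1 by (intro Z.m_add Z.m_mult Z.m_power i ffZ Z.V_closed(1)) auto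
    moreover have "inverse y ^ (p - 1) * 1 + inverse y ^ p * of_poly ff = inverse y ^ p * y ^ p"
    proof -
      have "inverse y ^ p * y = inverse y ^ (p - 1) * (inverse y * y)"
        using power_minus_mult[of p "inverse y"] by (simp only: p_pos mult.assoc[symmetric])
      thus ?thesis unfolding y_power_p using y0 by (simp add: distrib_left)
    qed
    moreover have "inverse y ^ p * y ^ p = 1" using y0 by (simp flip: power_mult_distrib)
    ultimately show False by simp
  qed
  obtain c where c: "c \<in> k" "xx - cst c \<in> place_ideal Z" using rat[OF x] by blast
  obtain d where d: "d \<in> k" "y - cst d \<in> place_ideal Z" using rat[OF yZ] by blast
  have ff: "of_poly h - cst (poly h c) \<in> place_ideal Z" if "coeffs_in k h" for h
    using that
  proof (induction h)
    case (pCons u h)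
    have h: "coeffs_in k h" using pCons.prems unfolding coeffs_in_def by (metis coeff_pCons_Suc)
    have hc: "poly h c \<in> k" by (rule coeffs_in_poly[OF subring_k h c(1)])
    have eq: "of_poly (pCons u h) = cst u + xx * of_poly h"
    proof -
      have "pCons u h = [:u:] + monom 1 1 * h" by (simp add: monom_altdef)
      thus ?thesis by (simp only: cst_def xx_def of_poly_simps)
    qed
    have "(of_poly h - cst (poly h c)) * xx + (xx - cst c) * cst (poly h c) \<in> place_ideal Z"
      by (intro Z.m_add Z.m_mult pCons.IH h x c cZ hc)
    thus ?case unfolding eq by (simp add: algebra_simps)
  qed simp
  have "(y - cst d) ^ p - (y - cst d) - (of_poly ff - cst (poly ff c)) \<in> place_ideal Z"
    by (rule Z.m_diff[OF Z.m_diff[OF Z.m_power[OF d(2) p_pos] d(2)] ff[OF coeffs_in_ff[OF subring_k a_k]]])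
  moreover have "(y - cst d) ^ p - (y - cst d) - (of_poly ff - cst (poly ff c)) = cst (c * R c - (d ^ p - d))"
    by (simp add: L.frob_diff1 y_power_p poly_ff algebra_simps)
  ultimately have in_m: "cst (c * R c - (d ^ p - d)) \<in> place_ideal Z" by simp
  have "c * R c - (d ^ p - d) = 0"
  proof (rule ccontr)
    let ?t = "c * R c - (d ^ p - d)"
    assume nz: "?t \<noteq> 0"
    have "?t \<in> k" using c(1) d(1) R_Fq[OF n_dvd_m] by (intro Fq_closed) auto
    hence "cst ?t * cst (inverse ?t) \<in> place_ideal Z" by (intro Z.m_mult in_m cZ Fq_inverse)
    moreover have "cst ?t * cst (inverse ?t) = 1" using nz by (simp flip: cst_simps)
    ultimately show False by simp
  qed
  hence "d ^ p - d = c * R c" by simp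
  thus ?thesis using c d by (intro bexI[of _ c] bexI[of _ d] conjI)
qed

text \<open>\<open>t\<close> is the number of places with a pole of \<open>xx\<close>, left open
  between 0 and 1.\<close>

lemma card_curve_points:
  "\<exists>t\<le>1. card (curve_points p e a (p ^ m)) =
     p * card {c \<in> Fq (p ^ m). trace_Fq p m (c * R c) = 0} + t"
proof -
  let ?C = "curve_points p e a (p ^ m)"
  let ?A = "{(c, d). c \<in> k \<and> d \<in> k \<and> d ^ p - d = c * R c}"
  let ?F = "{Z \<in> ?C. xx \<in> Z}" and ?I = "{Z \<in> ?C. xx \<notin> Z}"
  have fin: "finite ?A"
    by (rule finite_subset[of _ "k \<times> k"]) (use finite_Fq[OF m_pos] in auto)
  have inj: "inj_on (\<lambda>(c, d). place c d) ?A"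
  proof (rule inj_onI, clarify)
    fix c d c' d'
    assume cd: "c \<in> k" "d \<in> k" "d ^ p - d = c * R c" and cd': "c' \<in> k" "d' \<in> k" "d' ^ p - d' = c' * R c'"
      and eq: "place c d = place c' d'"
    note P = place_in_curve_points[OF cd] and P' = place_in_curve_points[OF cd', folded eq]
    interpret Z: valuation_subring K "place c d" by (rule valuation_subring_curve_points[OF P(1)])
    have *: "u = u'" if "z - cst u \<in> place_ideal (place c d)" "z - cst u' \<in> place_ideal (place c d)" "u \<in> k" "u' \<in> k" for z u u'
    proof (rule ccontr)
      assume "u \<noteq> u'"
      hence "cst (u - u') * cst (inverse (u - u')) = 1"
        by (metis cst_simps(2,4) right_inverse right_minus_eq)
      moreover have "cst (u - u') \<in> place_ideal (place c d)" using Z.m_diff[OF that(2,1)] by simp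
      moreover have "cst (inverse (u - u')) \<in> place c d"
        using valuation_subring_curve_points(2)[OF P(1)] Fq_inverse[OF Fq_diff[OF that(3,4)]] by blast
      ultimately show False using Z.m_mult Z.one_notin_m by metis
    qed
    show "c = c' \<and> d = d'" using *[OF P(2) P'(2) cd(1) cd'(1)] *[OF P(3) P'(3) cd(2) cd'(2)] by simp
  qed
  have "(\<lambda>(c, d). place c d) ` ?A = ?F"
  proof
    show "(\<lambda>(c, d). place c d) ` ?A \<subseteq> ?F"
    proof clarify
      fix c d assume cd: "c \<in> k" "d \<in> k" "d ^ p - d = c * R c"
      note P = place_in_curve_points[OF cd]
      interpret Z: valuation_subring K "place c d" by (rule valuation_subring_curve_points[OF P(1)])
      have "cst c \<in> place c d" using valuation_subring_curve_points(2)[OF P(1)] cd(1) by blast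
      from Z.V_closed(4)[OF Z.m_sub_V[OF P(2)] this] show "place c d \<in> ?C \<and> xx \<in> place c d" using P(1) by simp
    qed
    show "?F \<subseteq> (\<lambda>(c, d). place c d) ` ?A"
      using finite_point_coordinates place_unique by fastforce
  qed
  hence F: "card ?F = card ?A" "finite ?F"
    using card_image[OF inj] finite_imageI[OF fin, of "\<lambda>(c, d). place c d"] by simp_all
  have I: "Z = Z'" if "Z \<in> ?I" "Z' \<in> ?I" for Z Z' using that unique_point_at_infinity by blast
  hence "?I = {} \<or> (\<exists>Z. ?I = {Z})" by blast
  moreover have "finite S \<and> card S \<le> 1" if "S = {} \<or> (\<exists>Z. S = {Z})" for S :: "'a poly fract alg_closure set set"
    using that by (elim disjE exE) simp_all
  ultimately have I1: "finite ?I \<and> card ?I \<le> 1" by blast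
  have "card (?F \<union> ?I) = card ?F + card ?I"
    by (rule card_Un_disjoint) (use F(2) I1 in auto)
  moreover have "?F \<union> ?I = ?C" by blast
  ultimately have "card ?C = card ?F + card ?I" by (simp only:)
  thus ?thesis using I1 F(1) card_affine_points[OF m_pos n_dvd_m] by auto
qed

lemma extremal_imp_V_subset:
  assumes "curve_maximal p e a (p ^ m) \<or> curve_minimal p e a (p ^ m)"
  shows "V \<subseteq> k"
proof (rule ccontr)
  assume not_sub: "\<not> V \<subseteq> k"
  define N0 where "N0 = card {c \<in> Fq (p ^ m). trace_Fq p m (c * R c) = 0}"
  define Q where "Q = real (p ^ m)"
  define D where "D = real p ^ e * (real p - 1)"
  define T where "T = D * sqrt Q"
  obtain t where t: "t \<le> 1" "card (curve_points p e a (p ^ m)) = p * N0 + t"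
    using card_curve_points unfolding N0_def by blast
  have Q1: "Q \<ge> 1" unfolding Q_def using p_pos by (simp add: Suc_leI)
  have p3: "p \<ge> 3" using p_gt_1 odd_p by (cases "p = 2") auto
  have "2 * genus_C p e = p ^ e * (p - 1)" using odd_p by (simp add: genus_C_def)
  hence "2 * real (genus_C p e) = D"
    using p_gt_1 unfolding D_def
    by (simp add: of_nat_diff flip: of_nat_eq_iff[where 'a = real])
  hence ext: "real (p * N0 + t) = Q + 1 + T \<or> real (p * N0 + t) = Q + 1 - T"
    using assms unfolding curve_maximal_def curve_minimal_def t(2) Q_def T_def by auto
  \<comment> \<open>\<open>T\<close> is \<open>2 g sqrt Q\<close>, and \<open>p \<ge> 3\<close>
    bounds it below. The estimates will give \<open>(T - 1) ^ 2 \<le> T ^ 2 / 2\<close>, hence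
    \<open>T \<le> 4\<close>; the shift by 1 absorbs the uncertain point at infinity.\<close>
  have T6: "T \<ge> 6"
  proof -
    have "p ^ 1 \<le> p ^ e" using e_pos p_gt_1 by (intro power_increasing) auto
    hence "3 \<le> p ^ e" using p3 by simp
    hence "3 \<le> real p ^ e" by (metis of_nat_le_iff of_nat_numeral of_nat_power)
    hence "3 * 2 \<le> D" unfolding D_def using p3 by (intro mult_mono) auto
    hence "6 * 1 \<le> D * sqrt Q" using Q1 by (intro mult_mono) auto
    thus ?thesis by (simp add: T_def)
  qed
  \<comment> \<open>One further coset of \<open>V \<inter> k\<close> inside \<open>V\<close> is
    enough; the exact index is immaterial.\<close>
  have "2 * card (V \<inter> k) \<le> card V"
  proof -
    obtain v where v: "v \<in> V" "v \<notin> k" using not_sub by blast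
    have disj: "(V \<inter> k) \<inter> (\<lambda>z. v + z) ` (V \<inter> k) = {}"
      using v(2) Fq_diff[of _ m] by (auto) (metis add_diff_cancel_right')
    have "card ((V \<inter> k) \<union> (\<lambda>z. v + z) ` (V \<inter> k)) = 2 * card (V \<inter> k)"
      using finite_V disj by (subst card_Un_disjoint) (auto simp: card_image)
    moreover have "(V \<inter> k) \<union> (\<lambda>z. v + z) ` (V \<inter> k) \<subseteq> V" using v(1) V_add by blast
    ultimately show ?thesis using card_mono[OF finite_V] by metis
  qed
  hence half: "2 * real (card (V \<inter> k)) \<le> real p ^ (2 * e)"
    unfolding card_V by (metis of_nat_le_iff of_nat_mult of_nat_numeral of_nat_power)
  have "(real (p * N0) - Q) ^ 2 \<le> (real p - 1) ^ 2 * real (card (V \<inter> k)) * Q"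
  proof -
    have "real_of_int ((int (p * N0) - int (p ^ m)) ^ 2) \<le> real_of_int ((int p - 1) ^ 2 * int (card (V \<inter> k)) * int (p ^ m))"
      using affine_points_bound[OF m_pos n_dvd_m] unfolding N0_def by (simp only: of_int_le_iff)
    thus ?thesis by (simp add: Q_def)
  qed
  also have "\<dots> \<le> (real p - 1) ^ 2 * (real p ^ (2 * e) / 2) * Q"
    using half Q1 by (intro mult_right_mono mult_left_mono) auto
  also have "\<dots> = T ^ 2 / 2"
    using Q1 by (simp add: T_def D_def power_mult_distrib power_mult mult.commute)
  finally have upper: "(real (p * N0) - Q) ^ 2 \<le> T ^ 2 / 2" .
  have "T - 1 \<le> \<bar>real (p * N0) - Q\<bar>" using ext t(1) T6 by auto
  hence "(T - 1) ^ 2 \<le> (real (p * N0) - Q) ^ 2" 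
    using T6 abs_le_square_iff[of "T - 1" "real (p * N0) - Q"] by simp
  hence "(T - 1) ^ 2 \<le> T ^ 2 / 2" using upper by simp
  hence "T * T \<le> 4 * T" by (simp add: power2_eq_square algebra_simps)
  thus False using T6 by simp
qed

end

theorem theorem4p9:
  fixes p0 s p n q e k :: nat
    and a :: "nat \<Rightarrow> 'a::alg_closed_field"
    and A :: "('a \<times> 'a) set"
  assumes "is_closure_of_prime_field TYPE('a) p0"
    and "prime p0" and "odd p0"
    and "s \<ge> 1" and "p = p0 ^ s"
    and "n \<ge> 1" and "q = p ^ n"
    and "e \<ge> 1" and "\<forall>i\<le>e. a i \<in> Fq q" and "a e \<noteq> 0"
    and "max_abelian_subgroup A (H_R p e a)"
    and "A \<subseteq> Fq q \<times> Fq q"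
    and "k \<ge> 1" and "coprime k p0"
    and "\<not> condition_star p n e a A"
  shows "\<not> curve_maximal p e a (q ^ k) \<and> \<not> curve_minimal p e a (q ^ k)"
proof (rule ccontr)
  assume "\<not> ?thesis"
  hence ext: "curve_maximal p e a (p ^ (n * k)) \<or> curve_minimal p e a (p ^ (n * k))"
    using assms(7) by (auto simp: power_mult)
  have char: "CHAR('a) = p0" using assms(1) by (simp add: is_closure_of_prime_field_def)
  interpret max_abelian "TYPE('a)" p s e n a A
    using assms char by unfold_locales auto
  obtain y where y: "y ^ p - y = of_poly (monom 1 1 * R_poly p e a)" using exists_generator by blast
  interpret rational_curve "TYPE('a)" p s e n a y "n * k"
    using y assms(6,13) by unfold_locales auto
  have "V_R p e a \<subseteq> Fq (p ^ n)"
    using V_subset_descend[OF extremal_imp_V_subset[OF ext]] assms(14) char by simp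
  thus False using V_subset_imp_condition_star assms(15) by blast
qed

end
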